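(* Let $\Sigma$ be a topological Markov chain with shift $\sigma$ and let $\mu$ be a Gibbs measure on $\Sigma$ for a H\"older continuous potential (setting described in the context). Let $\{C_n\}_{n\ge1}$ be a sequence of cylinders, $C_n$ being defined on the interval $\Lambda_n\subset\mathbb{Z}$. Let $D\ge 0$ be a constant and assume that for all $m,n\ge1$ the intervals $\Lambda_m,\Lambda_n$ are $D$-nested. Then $\{C_n\}$ satisfies condition (SP). Consequently, if in addition $\sum_n\mu(C_n)=\infty$, then $\{C_n\}$ is a strongly Borel-Cantelli sequence, and for every $\varepsilon>0$, for $\mu$-a.e. $\underline{\omega}\in\Sigma$, $$S_N(\underline{\omega})=E_N+O\big(E_N^{1/2}\log^{3/2+\varepsilon}E_N\big)\quad (N\to\infty).$$
   Context: Let $M\ge 2$ and let $\mathbf A$ be an $M\times M$ matrix of zeros and ones such that $\mathbf A^K$ has all entries positive for some $K\ge1$. The topological Markov chain is $\Sigma=\{\underline{\omega}=(\omega_i)_{i\in\mathbb Z}\in\{1,\dots,M\}^{\mathbb Z}: \mathbf A_{\omega_i\omega_{i+1}}=1\ \forall i\}$ with the product topology and the left shift $(\sigma\underline{\omega})_i=\omega_{i+1}$. A Gibbs measure is the unique $\sigma$-invariant Gibbs measure (equilibrium state) $\mu$ of a H\"older continuous function $\psi:\Sigma\to\mathbb R$ (H\"older with respect to a metric $d_a(\underline\omega,\underline\omega')=a^n$, $n=\max\{n:\omega_i=\omega'_i\ \forall|i|<n\}$, $0<a<1$). A cylinder defined on a finite interval $\Lambda=[n^-,n^+]\subset\mathbb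 Z$ is a set $C=\{\underline{\omega}'\in\Sigma:\omega'_i=\omega_i \text{ for } n^-\le i\le n^+\}$ for some fixed symbols $\omega_{n^-},\dots,\omega_{n^+}$. Two intervals $[n_1^-,n_1^+]$, $[n_2^-,n_2^+]$ are $D$-nested if $[n_1^-,n_1^+]\subset[n_2^--D,n_2^++D]$ or $[n_2^-,n_2^+]\subset[n_1^--D,n_1^++D]$. For a sequence of measurable sets $A_n$ put $\chi_n$ = indicator of $\sigma^{-n}A_n$, $S_N=\sum_{n=1}^N\chi_n$, $E_N=\sum_{n=1}^N\mu(A_n)$, and $R_{mn}=\mu(\sigma^{-m}A_m\cap\sigma^{-n}A_n)-\mu(A_m)\mu(A_n)$. Condition (SP): there is $C>0$ with $\sum_{m,n=M'}^{N}R_{mn}\le C\sum_{n=M'}^N\mu(A_n)$ for all $N\ge M'\ge1$. The sequence is strongly Borel-Cantelli if $S_N/E_N\to1$ $\mu$-a.e. *)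

theory Defs
  imports "HOL-Probability.Probability" "HOL-Library.Landau_Symbols"
begin

fun mat_pow :: "nat \<Rightarrow> (nat \<Rightarrow> nat \<Rightarrow> nat) \<Rightarrow> nat \<Rightarrow> nat \<Rightarrow> nat \<Rightarrow> nat" where
  "mat_pow M A 0 i j = (if i = j then 1 else 0)"
| "mat_pow M A (Suc k) i j = (\<Sum>l\<in>{1..M}. mat_pow M A k i l * A l j)"

definition zero_one_matrix :: "nat \<Rightarrow> (nat \<Rightarrow> nat \<Rightarrow> nat) \<Rightarrow> bool" where
  "zero_one_matrix M A \<longleftrightarrow> (\<forall>i\<in>{1..M}. \<forall>j\<in>{1..M}. A i j = 0 \<or> A i j = 1)"

definition primitive_matrix :: "nat \<Rightarrow> (nat \<Rightarrow> nat \<Rightarrow> nat) \<Rightarrow> bool" where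
  "primitive_matrix M A \<longleftrightarrow> (\<exists>K\<ge>1. \<forall>i\<in>{1..M}. \<forall>j\<in>{1..M}. mat_pow M A K i j > 0)"

definition tmc :: "nat \<Rightarrow> (nat \<Rightarrow> nat \<Rightarrow> nat) \<Rightarrow> (int \<Rightarrow> nat) set" where
  "tmc M A = {\<omega>. (\<forall>i. \<omega> i \<in> {1..M}) \<and> (\<forall>i. A (\<omega> i) (\<omega> (i + 1)) = 1)}"

definition shift :: "(int \<Rightarrow> nat) \<Rightarrow> (int \<Rightarrow> nat)" where
  "shift \<omega> = (\<lambda>i. \<omega> (i + 1))"

text \<open>The metric d_a: d_a(w,w') = a^n, n = max{n. w_i = w'_i for all |i| < n}
  = min{|i|. w_i ~= w'_i}; d_a(w,w) = 0.\<close>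
definition dist_a :: "real \<Rightarrow> (int \<Rightarrow> nat) \<Rightarrow> (int \<Rightarrow> nat) \<Rightarrow> real" where
  "dist_a a \<omega> \<omega>' = (if \<omega> = \<omega>' then 0
      else a ^ (LEAST n. \<exists>i. nat \<bar>i\<bar> = n \<and> \<omega> i \<noteq> \<omega>' i))"

definition holder_on :: "(int \<Rightarrow> nat) set \<Rightarrow> real \<Rightarrow> ((int \<Rightarrow> nat) \<Rightarrow> real) \<Rightarrow> bool" where
  "holder_on S a \<psi> \<longleftrightarrow> (\<exists>L \<beta>. 0 < \<beta> \<and> \<beta> \<le> 1 \<and>
      (\<forall>\<omega>\<in>S. \<forall>\<omega>'\<in>S. \<bar>\<psi> \<omega> - \<psi> \<omega>'\<bar> \<le> L * dist_a a \<omega> \<omega>' powr \<beta>))"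

definition cylinder :: "(int \<Rightarrow> nat) set \<Rightarrow> int \<Rightarrow> int \<Rightarrow> (int \<Rightarrow> nat) \<Rightarrow> (int \<Rightarrow> nat) set" where
  "cylinder S lo hi s = {\<omega>\<in>S. \<forall>i\<in>{lo..hi}. \<omega> i = s i}"

text \<open>The measurable space: the product sigma-algebra on nat^Z (which is the
  Borel sigma-algebra of the product topology of discrete countable factors).\<close>
abbreviation seq_space :: "(int \<Rightarrow> nat) measure" where
  "seq_space \<equiv> PiM UNIV (\<lambda>_::int. count_space (UNIV::nat set))"

definition gibbs_measure ::
  "(int \<Rightarrow> nat) set \<Rightarrow> ((int \<Rightarrow> nat) \<Rightarrow> real) \<Rightarrow> (int \<Rightarrow> nat) measure \<Rightarrow> bool" where
  "gibbs_measure S \<psi> \<mu> \<longleftrightarrow>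
     prob_space \<mu> \<and> sets \<mu> = sets seq_space \<and> S \<in> sets \<mu> \<and> measure \<mu> S = 1 \<and>
     shift \<in> measurable \<mu> \<mu> \<and> distr \<mu> \<mu> shift = \<mu> \<and>
     (\<exists>P c. c > 0 \<and> (\<forall>\<omega>\<in>S. \<forall>n::nat. n \<ge> 1 \<longrightarrow>
        (let q = measure \<mu> (cylinder S 0 (int n - 1) \<omega>)
               / exp (- real n * P + (\<Sum>k<n. \<psi> ((shift ^^ k) \<omega>)))
         in inverse c \<le> q \<and> q \<le> c)))"

definition preim :: "nat \<Rightarrow> (int \<Rightarrow> nat) set \<Rightarrow> (int \<Rightarrow> nat) set" where
  "preim n B = {\<omega>. (shift ^^ n) \<omega> \<in> B}"

definition S_N :: "(nat \<Rightarrow> (int \<Rightarrow> nat) set) \<Rightarrow> nat \<Rightarrow> (int \<Rightarrow> nat) \<Rightarrow> real" where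
  "S_N A N \<omega> = (\<Sum>n=1..N. indicator (preim n (A n)) \<omega>)"

definition E_N :: "(int \<Rightarrow> nat) measure \<Rightarrow> (nat \<Rightarrow> (int \<Rightarrow> nat) set) \<Rightarrow> nat \<Rightarrow> real" where
  "E_N \<mu> A N = (\<Sum>n=1..N. measure \<mu> (A n))"

definition R_mn :: "(int \<Rightarrow> nat) measure \<Rightarrow> (nat \<Rightarrow> (int \<Rightarrow> nat) set) \<Rightarrow> nat \<Rightarrow> nat \<Rightarrow> real" where
  "R_mn \<mu> A m n = measure \<mu> (preim m (A m) \<inter> preim n (A n)) - measure \<mu> (A m) * measure \<mu> (A n)"

definition condition_SP :: "(int \<Rightarrow> nat) measure \<Rightarrow> (nat \<Rightarrow> (int \<Rightarrow> nat) set) \<Rightarrow> bool" where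
  "condition_SP \<mu> A \<longleftrightarrow> (\<exists>C>0. \<forall>M' N. 1 \<le> M' \<longrightarrow> M' \<le> N \<longrightarrow>
      (\<Sum>m=M'..N. \<Sum>n=M'..N. R_mn \<mu> A m n) \<le> C * (\<Sum>n=M'..N. measure \<mu> (A n)))"

definition strongly_BC :: "(int \<Rightarrow> nat) measure \<Rightarrow> (nat \<Rightarrow> (int \<Rightarrow> nat) set) \<Rightarrow> bool" where
  "strongly_BC \<mu> A \<longleftrightarrow> (AE \<omega> in \<mu>. (\<lambda>N. S_N A N \<omega> / E_N \<mu> A N) \<longlonglongrightarrow> 1)"

definition D_nested :: "int \<Rightarrow> int \<Rightarrow> int \<Rightarrow> int \<Rightarrow> int \<Rightarrow> bool" where
  "D_nested D l1 h1 l2 h2 \<longleftrightarrow> {l1..h1} \<subseteq> {l2 - D..h2 + D} \<or> {l2..h2} \<subseteq> {l1 - D..h1 + D}"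

end

(*
A two-sided Hoelder potential is cohomologous to a potential phi of the future
coordinates only, and the Gibbs bounds compare the probability m(w) of a word w with
exp(S_n phi) on the corresponding one-sided cylinder. The transfer operator L of phi
contracts a cone of log-Hoelder functions, so the finite-volume weights
Q(w; p, q) = (L^q L_w L^p 1)(z) / (L^(p+|w|+q) 1)(z) are psi-mixing and almost independent
of p and q, with exponentially small errors. No eigenmeasure is constructed: under Q the
frequency of w along widely spaced blocks of a long word has small variance around
Q(w; n, n), its mean under m is exactly m(w) by stationarity, and m <= K Q; hence
m(w) = lim Q(w; n, n). So m is psi-mixing with exponential rate and decays exponentially
in the length of words.

If Lambda_m lies in a D-neighbourhood of Lambda_n and k = |m - n| - D > 0, then the shifted
Lambda_n protrudes by at least k beyond the shifted Lambda_m on one side. Either k/2 symbols of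
C_n protrude, and they cost a factor exponentially small in k, or the two intervals are
at distance at least k/2. Either way R_mn <= C r^|m-n| (mu(C_m) + mu(C_n)), which gives (SP).
The almost sure rate follows from (SP) by dyadic chaining in the scale E_N.
*)
theory Submission
  imports Defs
begin

section \<open>Contraction of the transfer operator\<close>

text \<open>The Gibbs inequality alone yields only quasi-independence: joining two words costs a
  constant factor, so R_mn would be bounded only by a multiple of \<mu>(C_m) \<mu>(C_n) for every
  pair, and the sum over all pairs is not controlled by E_N. What (SP) needs is a factor 1 +
  O(\<rho>^g) across a gap of length g. The transfer operator supplies it, because under iteration a
  function in the cone forgets its shape exponentially fast. Since (SP) is an upper bound, only the
  upper half of psi-mixing is proved for \<open>m\<close>. A further obstacle is that the measure is
  given through inequalities with an unspecified constant, so its word probabilities must be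
  identified with limits of weights that the operator can compute; the constant \<open>K\<close> of
  the comparison is harmless because it multiplies a variance that tends to 0. Nothing may depend on
  the lengths of the intervals, which is why all errors are relative and depend on gaps or margins
  alone.\<close>

definition admissible_seqs :: "'a set \<Rightarrow> ('a \<Rightarrow> 'a \<Rightarrow> bool) \<Rightarrow> (nat \<Rightarrow> 'a) set" where
  "admissible_seqs I E = {x. \<forall>n. x n \<in> I \<and> E (x n) (x (Suc n))}"

abbreviation prepend :: "'a list \<Rightarrow> (nat \<Rightarrow> 'a) \<Rightarrow> nat \<Rightarrow> 'a" where
  "prepend w x \<equiv> foldr case_nat w x"

lemma prepend_add_length [simp]: "prepend w x (j + length w) = x j"
  by (induction w arbitrary: j) auto

lemma prepend_nth: "k < length w \<Longrightarrow> prepend w x k = w ! k"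
  by (induction w arbitrary: k) (auto simp: nth_Cons split: nat.splits)

lemma case_nat_admissible_iff:
  "case_nat i x \<in> admissible_seqs I E \<longleftrightarrow> i \<in> I \<and> E i (x 0) \<and> x \<in> admissible_seqs I E"
  unfolding admissible_seqs_def by (auto split: nat.splits simp: all_conj_distrib)

lemma prepend_admissibleD: "prepend w x \<in> admissible_seqs I E \<Longrightarrow> x \<in> admissible_seqs I E"
  by (induction w) (auto simp: case_nat_admissible_iff)

lemma prepend_admissible_set: "prepend w x \<in> admissible_seqs I E \<Longrightarrow> set w \<subseteq> I"
  by (induction w) (auto simp: case_nat_admissible_iff)

text \<open>A one-sided subshift of finite type with a Hoelder potential. Distance is coded by the
  length of the common prefix, and \<open>\<phi>_holder\<close> starts at n = 1: points with
  different first symbols are compared only through \<open>mixing\<close>, which joins any symbol to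
  any point by a word of the one length \<open>N\<close>.\<close>

locale transfer_operator =
  fixes I :: "'a set" and E :: "'a \<Rightarrow> 'a \<Rightarrow> bool" and \<phi> :: "(nat \<Rightarrow> 'a) \<Rightarrow> real"
    and B H \<theta> :: real and N :: nat
  assumes finite_I: "finite I"
    and \<theta>_pos: "0 < \<theta>" and \<theta>_less: "\<theta> < 1" and H_nonneg: "0 \<le> H"
    and \<phi>_bound: "\<And>x. x \<in> admissible_seqs I E \<Longrightarrow> \<bar>\<phi> x\<bar> \<le> B"
    and \<phi>_holder: "\<And>x y n. x \<in> admissible_seqs I E \<Longrightarrow> y \<in> admissible_seqs I E \<Longrightarrow> n \<ge> 1 \<Longrightarrow>
        (\<And>k. k < n \<Longrightarrow> x k = y k) \<Longrightarrow> \<bar>\<phi> x - \<phi> y\<bar> \<le> H * \<theta> ^ n"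
    and mixing: "\<And>i x. i \<in> I \<Longrightarrow> x \<in> admissible_seqs I E \<Longrightarrow>
        \<exists>w. length w = N \<and> w \<noteq> [] \<and> hd w = i \<and> prepend w x \<in> admissible_seqs I E"
    and nonempty: "admissible_seqs I E \<noteq> {}"
begin

abbreviation "X \<equiv> admissible_seqs I E"

text \<open>One inverse branch of the transfer operator. Forbidden transitions give 0 instead of
  being excluded, so every branch is a total linear operator and \<open>L\<close> sums over all of
  \<open>I\<close>.\<close>

definition letter :: "'a \<Rightarrow> ((nat \<Rightarrow> 'a) \<Rightarrow> real) \<Rightarrow> (nat \<Rightarrow> 'a) \<Rightarrow> real" where
  "letter i f x = (if i \<in> I \<and> E i (x 0) then exp (\<phi> (case_nat i x)) * f (case_nat i x) else 0)"

text \<open>\<open>fold\<close> applies the head of \<open>w\<close> innermost, so the composed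
  branches evaluate \<open>f\<close> at \<open>prepend w x\<close>, with the Birkhoff sum
  \<open>weight w x\<close> as exponent.\<close>

definition word :: "'a list \<Rightarrow> ((nat \<Rightarrow> 'a) \<Rightarrow> real) \<Rightarrow> (nat \<Rightarrow> 'a) \<Rightarrow> real" where
  "word w f = fold letter w f"

definition L :: "((nat \<Rightarrow> 'a) \<Rightarrow> real) \<Rightarrow> (nat \<Rightarrow> 'a) \<Rightarrow> real" where
  "L f x = (\<Sum>i\<in>I. letter i f x)"

definition words :: "nat \<Rightarrow> 'a list set" where
  "words n = {w. set w \<subseteq> I \<and> length w = n}"

definition weight :: "'a list \<Rightarrow> (nat \<Rightarrow> 'a) \<Rightarrow> real" where
  "weight w x = (\<Sum>k<length w. \<phi> (\<lambda>j. prepend w x (j + k)))"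

lemma N_pos: "N \<ge> 1"
proof -
  obtain x where x: "x \<in> X" using nonempty by auto
  then have "x 0 \<in> I" by (auto simp: admissible_seqs_def)
  from mixing[OF this x] show ?thesis by (auto simp: Suc_le_eq)
qed

lemma finite_words [simp]: "finite (words n)"
  unfolding words_def using finite_lists_length_eq[OF finite_I] by simp

lemma word_Nil [simp]: "word [] f = f"
  and word_append: "word (u @ v) f = word v (word u f)"
  and word_snoc: "word (u @ [i]) f = letter i (word u f)"
  by (simp_all add: word_def)

lemma letter_sum: "finite S \<Longrightarrow> letter i (\<lambda>x. \<Sum>s\<in>S. h s x) = (\<lambda>x. \<Sum>s\<in>S. letter i (h s) x)"
  by (auto simp: letter_def sum_distrib_left fun_eq_iff)

lemma letter_lin: "letter i (\<lambda>x. c * f x + d * g x) = (\<lambda>x. c * letter i f x + d * letter i g x)"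
  by (auto simp: letter_def fun_eq_iff algebra_simps)

lemma L_lin: "L (\<lambda>x. c * f x + d * g x) = (\<lambda>x. c * L f x + d * L g x)"
  by (auto simp: L_def fun_eq_iff letter_lin sum.distrib sum_distrib_left)

lemma word_lin: "word w (\<lambda>x. c * f x + d * g x) = (\<lambda>x. c * word w f x + d * word w g x)"
  by (induction w rule: rev_induct) (simp_all add: word_snoc letter_lin)

lemma Lpow_lin: "(L ^^ n) (\<lambda>x. c * f x + d * g x) = (\<lambda>x. c * (L ^^ n) f x + d * (L ^^ n) g x)"
  by (induction n) (simp_all add: L_lin)

lemma word_scale: "word w (\<lambda>x. c * f x) = (\<lambda>x. c * word w f x)"
  using word_lin[of w c f 0 f] by simp

lemma Lpow_scale: "(L ^^ n) (\<lambda>x. c * f x) = (\<lambda>x. c * (L ^^ n) f x)"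
  using Lpow_lin[of n c f 0 f] by simp

lemma word_sum: "finite S \<Longrightarrow> word w (\<lambda>x. \<Sum>s\<in>S. h s x) = (\<lambda>x. \<Sum>s\<in>S. word w (h s) x)"
  by (induction w rule: rev_induct) (simp_all add: word_snoc letter_sum)

lemma sum_words_Suc: "(\<Sum>w\<in>words (Suc n). F w) = (\<Sum>w\<in>words n. \<Sum>i\<in>I. F (w @ [i]))"
proof -
  have "bij_betw (\<lambda>(w, i). w @ [i]) (words n \<times> I) (words (Suc n))"
    unfolding bij_betw_def
  proof
    show "inj_on (\<lambda>(w, i). w @ [i]) (words n \<times> I)" by (auto simp: inj_on_def)
    show "(\<lambda>(w, i). w @ [i]) ` (words n \<times> I) = words (Suc n)"
    proof (intro equalityI subsetI)
      fix v assume "v \<in> words (Suc n)"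
      then show "v \<in> (\<lambda>(w, i). w @ [i]) ` (words n \<times> I)"
        by (cases v rule: rev_cases) (auto simp: words_def image_iff)
    qed (auto simp: words_def)
  qed
  then have "(\<Sum>w\<in>words (Suc n). F w) = (\<Sum>(w,i)\<in>words n \<times> I. F (w @ [i]))"
    by (subst sum.reindex_bij_betw[symmetric]) (auto simp: case_prod_beta')
  then show ?thesis by (simp add: sum.cartesian_product finite_I)
qed

lemma sum_words_0 [simp]: "(\<Sum>w\<in>words 0. F w) = F []"
proof -
  have "words 0 = {[]}" by (auto simp: words_def)
  then show ?thesis by simp
qed

lemma Lpow_eq: "(L ^^ n) f x = (\<Sum>w\<in>words n. word w f x)"
proof (induction n arbitrary: x)
  case (Suc n)
  have *: "(L ^^ n) f = (\<lambda>x. \<Sum>w\<in>words n. word w f x)" using Suc by auto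
  have "(L ^^ Suc n) f x = (\<Sum>i\<in>I. \<Sum>w\<in>words n. letter i (word w f) x)"
    by (simp add: L_def * letter_sum)
  also have "\<dots> = (\<Sum>w\<in>words n. \<Sum>i\<in>I. word (w @ [i]) f x)"
    by (subst sum.swap) (simp add: word_snoc)
  finally show ?case by (simp add: sum_words_Suc)
qed simp

lemma case_nat_admissible: "x \<in> X \<Longrightarrow> i \<in> I \<Longrightarrow> E i (x 0) \<Longrightarrow> case_nat i x \<in> X"
  by (simp add: case_nat_admissible_iff)

lemma letter_mono:
  assumes "\<And>x. x \<in> X \<Longrightarrow> f x \<le> g x" "x \<in> X"
  shows "letter i f x \<le> letter i g x"
  using assms by (auto simp: letter_def case_nat_admissible)

lemma word_mono:
  assumes "\<And>x. x \<in> X \<Longrightarrow> f x \<le> g x"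
  shows "x \<in> X \<Longrightarrow> word w f x \<le> word w g x"
proof (induction w arbitrary: x rule: rev_induct)
  case (snoc i w)
  then show ?case unfolding word_snoc by (intro letter_mono)
qed (use assms in auto)

lemma Lpow_mono:
  assumes "\<And>x. x \<in> X \<Longrightarrow> f x \<le> g x"
  shows "x \<in> X \<Longrightarrow> (L ^^ n) f x \<le> (L ^^ n) g x"
  by (simp add: Lpow_eq sum_mono word_mono assms)

lemma word_eq:
  "x \<in> X \<Longrightarrow> word w f x = (if prepend w x \<in> X then exp (weight w x) * f (prepend w x) else 0)"
proof (induction w arbitrary: x rule: rev_induct)
  case (snoc i w)
  show ?case
  proof (cases "i \<in> I \<and> E i (x 0)")
    case True
    let ?y = "case_nat i x"
    have y: "?y \<in> X" using True snoc.prems case_nat_admissible by auto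
    have "weight (w @ [i]) x = weight w ?y + \<phi> ?y"
      by (simp add: weight_def)
    then show ?thesis using True snoc.IH[OF y]
      by (auto simp: word_snoc letter_def exp_add)
  next
    case False
    then have "prepend (w @ [i]) x \<notin> X"
      using prepend_admissibleD[of w "case_nat i x" I E] by (auto simp: case_nat_admissible_iff)
    then show ?thesis using False by (auto simp: word_snoc letter_def)
  qed
qed (simp add: weight_def)

lemma B_nonneg: "B \<ge> 0"
  using nonempty \<phi>_bound by (metis abs_ge_zero ex_in_conv order_trans)

lemma shift_admissible: "x \<in> X \<Longrightarrow> (\<lambda>j. x (j + k)) \<in> X"
  by (auto simp: admissible_seqs_def)

lemma weight_bound:
  assumes "prepend w x \<in> X"
  shows "\<bar>weight w x\<bar> \<le> real (length w) * B"
proof -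
  have "\<bar>weight w x\<bar> \<le> (\<Sum>k<length w. B)"
    unfolding weight_def
    by (intro order.trans[OF sum_abs] sum_mono \<phi>_bound shift_admissible assms)
  then show ?thesis by simp
qed

subsection \<open>An invariant cone\<close>

text \<open>Log-Hoelder functions, written multiplicatively so that zeros are allowed:
  \<open>word w f\<close> vanishes at every point that \<open>w\<close> cannot precede. Only points
  with a common first symbol are compared, so a function may vanish on one such class and not on
  another.\<close>

definition cone :: "real \<Rightarrow> ((nat \<Rightarrow> 'a) \<Rightarrow> real) set" where
  "cone c = {f. (\<forall>x\<in>X. 0 \<le> f x) \<and>
     (\<forall>x\<in>X. \<forall>y\<in>X. \<forall>n\<ge>1. (\<forall>k<n. x k = y k) \<longrightarrow> f x \<le> exp (c * \<theta> ^ n) * f y)}"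

text \<open>The parameter is chosen so that one application of a letter sharpens it from \<open>b\<close> to \<open>b - 1\<close>.\<close>

definition b :: real where "b = (\<theta> * H + 1) / (1 - \<theta>)"

lemma b_ge: "b \<ge> 1"
  unfolding b_def using \<theta>_pos \<theta>_less H_nonneg by (simp add: field_simps)

lemma b_step: "\<theta> * (b + H) = b - 1"
  unfolding b_def using \<theta>_less by (simp add: field_simps)

lemma cone_nonneg: "f \<in> cone c \<Longrightarrow> x \<in> X \<Longrightarrow> 0 \<le> f x"
  by (auto simp: cone_def)

lemma cone_le: "f \<in> cone c \<Longrightarrow> x \<in> X \<Longrightarrow> y \<in> X \<Longrightarrow> n \<ge> 1 \<Longrightarrow> (\<And>k. k < n \<Longrightarrow> x k = y k) \<Longrightarrow>
    f x \<le> exp (c * \<theta> ^ n) * f y"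
  by (auto simp: cone_def)

lemma coneI:
  assumes "\<And>x. x \<in> X \<Longrightarrow> 0 \<le> f x"
    and "\<And>x y n. x \<in> X \<Longrightarrow> y \<in> X \<Longrightarrow> n \<ge> 1 \<Longrightarrow> (\<And>k. k < n \<Longrightarrow> x k = y k) \<Longrightarrow>
      f x \<le> exp (c * \<theta> ^ n) * f y"
  shows "f \<in> cone c"
  using assms by (auto simp: cone_def)

lemma cone_mono:
  assumes "f \<in> cone c" "c \<le> d" shows "f \<in> cone d"
proof (rule coneI)
  fix x y n assume a: "x \<in> X" "y \<in> X" "n \<ge> (1::nat)" "\<And>k. k < n \<Longrightarrow> x k = y k"
  have "f x \<le> exp (c * \<theta> ^ n) * f y" using cone_le[OF assms(1) a] .
  also have "\<dots> \<le> exp (d * \<theta> ^ n) * f y"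
    using assms \<theta>_pos cone_nonneg[OF assms(1) a(2)] by (intro mult_right_mono) auto
  finally show "f x \<le> exp (d * \<theta> ^ n) * f y" .
qed (use cone_nonneg assms in auto)

lemma cone_sum:
  assumes "\<And>s. s \<in> S \<Longrightarrow> h s \<in> cone c"
  shows "(\<lambda>x. \<Sum>s\<in>S. h s x) \<in> cone c"
proof (rule coneI)
  fix x y n assume a: "x \<in> X" "y \<in> X" "n \<ge> (1::nat)" "\<And>k. k < n \<Longrightarrow> x k = y k"
  show "(\<Sum>s\<in>S. h s x) \<le> exp (c * \<theta> ^ n) * (\<Sum>s\<in>S. h s y)"
    unfolding sum_distrib_left by (intro sum_mono cone_le[OF assms a])
qed (use cone_nonneg assms sum_nonneg in \<open>metis (no_types, lifting)\<close>)

lemma cone_scale: "f \<in> cone c \<Longrightarrow> 0 \<le> t \<Longrightarrow> (\<lambda>x. t * f x) \<in> cone c"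
proof (rule coneI)
  fix x y n assume f: "f \<in> cone c" "0 \<le> t"
    and a: "x \<in> X" "y \<in> X" "n \<ge> (1::nat)" "\<And>k. k < n \<Longrightarrow> x k = y k"
  show "t * f x \<le> exp (c * \<theta> ^ n) * (t * f y)"
    using mult_left_mono[OF cone_le[OF f(1) a] f(2)] by (simp add: algebra_simps)
qed (auto simp: cone_nonneg)

lemma cone_one: "(\<lambda>_. 1) \<in> cone b"
  using b_ge \<theta>_pos by (intro coneI) auto

text \<open>Prepending the same symbol lengthens the common prefix by one, which multiplies both the
  constant \<open>c\<close> of \<open>f\<close> and the constant \<open>H\<close> of
  \<open>\<phi>\<close> by \<theta>.\<close>

lemma letter_cone:
  assumes "f \<in> cone c" shows "letter i f \<in> cone (\<theta> * (c + H))"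
proof (rule coneI)
  fix x y n assume a: "x \<in> X" "y \<in> X" "n \<ge> (1::nat)" "\<And>k. k < n \<Longrightarrow> x k = y k"
  show "letter i f x \<le> exp (\<theta> * (c + H) * \<theta> ^ n) * letter i f y"
  proof (cases "i \<in> I \<and> E i (x 0)")
    case True
    let ?x = "case_nat i x" and ?y = "case_nat i y"
    have 0: "x 0 = y 0" using a by auto
    have X: "?x \<in> X" "?y \<in> X" using case_nat_admissible True a 0 by auto
    have ag: "\<And>k. k < Suc n \<Longrightarrow> ?x k = ?y k" using a(4) by (auto split: nat.splits)
    have 1: "f ?x \<le> exp (c * \<theta> ^ Suc n) * f ?y" by (rule cone_le[OF assms X _ ag]) auto
    have "\<bar>\<phi> ?x - \<phi> ?y\<bar> \<le> H * \<theta> ^ Suc n" by (rule \<phi>_holder[OF X _ ag]) auto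
    then have 2: "exp (\<phi> ?x) \<le> exp (H * \<theta> ^ Suc n) * exp (\<phi> ?y)"
      unfolding exp_add[symmetric] by simp
    have "exp (\<phi> ?x) * f ?x \<le> (exp (H * \<theta> ^ Suc n) * exp (\<phi> ?y)) * (exp (c * \<theta> ^ Suc n) * f ?y)"
      by (intro mult_mono 1 2) (auto simp: cone_nonneg[OF assms X(1)])
    also have "\<dots> = exp (\<theta> * (c + H) * \<theta> ^ n) * (exp (\<phi> ?y) * f ?y)"
      by (simp add: algebra_simps exp_add)
    finally show ?thesis using True 0 by (simp add: letter_def)
  next
    case False
    moreover have "x 0 = y 0" using a by auto
    ultimately show ?thesis by (auto simp: letter_def)
  qed
qed (use cone_nonneg[OF assms] case_nat_admissible in \<open>auto simp: letter_def\<close>)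

lemma letter_cone': "f \<in> cone b \<Longrightarrow> letter i f \<in> cone (b - 1)"
  using letter_cone[of f b i] b_step by simp

lemma word_cone: "f \<in> cone b \<Longrightarrow> word w f \<in> cone b"
  by (induction w rule: rev_induct) (auto simp: word_snoc intro: cone_mono[OF letter_cone'])

lemma L_cone: "f \<in> cone b \<Longrightarrow> L f \<in> cone (b - 1)"
  unfolding L_def[abs_def] by (intro cone_sum letter_cone')

lemma Lpow_cone: "f \<in> cone b \<Longrightarrow> (L ^^ n) f \<in> cone b"
  by (induction n) (auto intro: cone_mono[OF L_cone])

lemma Lpow_cone': "f \<in> cone b \<Longrightarrow> n \<ge> 1 \<Longrightarrow> (L ^^ n) f \<in> cone (b - 1)"
  by (cases n) (auto intro: L_cone Lpow_cone)

subsection \<open>Birkhoff contraction\<close>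

text \<open>Price of moving the evaluation point: exp(N B) bounds the weight of the joining word,
  and exp b the variation of a cone function over points with the same first symbol.\<close>

definition \<kappa> :: real where "\<kappa> = exp (real N * B + b)"

lemma \<kappa>_ge: "\<kappa> \<ge> 1"
  unfolding \<kappa>_def using B_nonneg b_ge by simp

text \<open>A word \<open>w\<close> of length \<open>N\<close> starting with the symbol
  \<open>z 0\<close> is put in front of \<open>x\<close>. The cone condition with n = 1 compares
  \<open>z\<close> with \<open>prepend w x\<close>, and the branch of \<open>w\<close> is one of the
  nonnegative terms of \<open>L ^^ N\<close>.\<close>

lemma le_LpowN:
  assumes f: "f \<in> cone b" and z: "z \<in> X" and x: "x \<in> X"
  shows "f z \<le> \<kappa> * (L ^^ N) f x"
proof -
  have "z 0 \<in> I" using z by (auto simp: admissible_seqs_def)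
  from mixing[OF this x] obtain w where w: "length w = N" "w \<noteq> []" "hd w = z 0" "prepend w x \<in> X"
    by auto
  have "f z \<le> exp (b * \<theta> ^ 1) * f (prepend w x)"
    using w by (intro cone_le[OF f z w(4)]) (auto simp: hd_conv_nth[symmetric] neq_Nil_conv)
  also have "\<dots> \<le> exp b * (exp (real N * B) * word w f x)"
  proof (intro mult_mono)
    have "f (prepend w x) = exp (- weight w x) * word w f x"
      using w x by (simp add: word_eq exp_minus)
    also have "\<dots> \<le> exp (real N * B) * word w f x"
      using weight_bound[OF w(4)] w(1) cone_nonneg[OF word_cone[OF f] x]
      by (intro mult_right_mono) auto
    finally show "f (prepend w x) \<le> exp (real N * B) * word w f x" .
  qed (use b_ge \<theta>_less \<theta>_pos cone_nonneg[OF f w(4)] in auto)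
  also have "word w f x \<le> (L ^^ N) f x"
    unfolding Lpow_eq using w prepend_admissible_set[OF w(4)] cone_nonneg[OF word_cone[OF f] x]
    by (intro member_le_sum finite_words) (auto simp: words_def)
  finally show ?thesis by (simp add: \<kappa>_def exp_add mult_ac)
qed

text \<open>In the Harnack inequality one factor \<open>\<kappa>\<close> bounds the weight of a word
  of length \<open>N\<close>, the other comes from \<open>le_LpowN\<close>, and the cardinality
  counts the words. The summand 1 secures R \<ge> 1.\<close>

definition R :: real where "R = real (card (words N)) * \<kappa>\<^sup>2 + 1"

lemma R_ge: "R \<ge> 1" by (simp add: R_def)

lemma harnack:
  assumes f: "f \<in> cone b" and y: "y \<in> X" and x: "x \<in> X"
  shows "(L ^^ N) f y \<le> R * (L ^^ N) f x"
proof -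
  have nn: "(L ^^ N) f x \<ge> 0" by (rule cone_nonneg[OF Lpow_cone[OF f] x])
  have "(L ^^ N) f y \<le> (\<Sum>w\<in>words N. \<kappa> * (\<kappa> * (L ^^ N) f x))"
    unfolding Lpow_eq[of N f y]
  proof (intro sum_mono)
    fix w assume w: "w \<in> words N"
    show "word w f y \<le> \<kappa> * (\<kappa> * (L ^^ N) f x)"
    proof (cases "prepend w y \<in> X")
      case True
      have "exp (weight w y) \<le> \<kappa>"
        using weight_bound[OF True] w b_ge by (auto simp: \<kappa>_def words_def)
      then show ?thesis using le_LpowN[OF f True x] True y \<kappa>_ge nn
        by (auto simp: word_eq intro!: mult_mono cone_nonneg[OF f])
    qed (use y nn \<kappa>_ge in \<open>auto simp: word_eq\<close>)
  qed
  also have "\<dots> \<le> R * (L ^^ N) f x"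
    using nn by (simp add: R_def power2_eq_square algebra_simps)
  finally show ?thesis .
qed

definition c0 :: real where "c0 = 2 * b * exp b"

lemma c0_ge: "c0 \<ge> 1"
proof -
  have "1 \<le> b * exp b" using b_ge by (intro mult_ge1_I) auto
  then show ?thesis by (simp add: c0_def)
qed

text \<open>The room for a subtraction comes from \<open>f\<close> and \<open>g\<close> lying in the
  smaller cone b - 1. With s = \<theta>^n, passing from b - 1 to b gains at least s times f(y),
  while the subtracted term costs at most c0 s times t g(y). This linear bound is the origin of
  \<open>c0\<close>: exp(b s) \<le> exp b and 1 - exp(-u) \<le> u.\<close>

lemma cone_sub:
  assumes f: "f \<in> cone (b - 1)" and g: "g \<in> cone (b - 1)" and t: "t \<ge> 0"
    and le: "\<And>x. x \<in> X \<Longrightarrow> t * c0 * g x \<le> f x"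
  shows "(\<lambda>x. f x - t * g x) \<in> cone b"
proof (rule coneI)
  fix x assume x: "x \<in> X"
  have "t * g x * 1 \<le> t * g x * c0"
    using t cone_nonneg[OF g x] c0_ge by (intro mult_left_mono) auto
  then show "0 \<le> f x - t * g x" using le[OF x] by (simp add: algebra_simps)
next
  fix x y n assume a: "x \<in> X" "y \<in> X" "n \<ge> (1::nat)" "\<And>k. k < n \<Longrightarrow> x k = y k"
  define s where "s = \<theta> ^ n"
  have s: "0 < s" "s \<le> 1" using \<theta>_pos \<theta>_less by (auto simp: s_def power_le_one)
  have gy: "g y \<ge> 0" "f y \<ge> 0" using cone_nonneg f g a by auto
  have 1: "f x \<le> exp ((b - 1) * s) * f y" using cone_le[OF f a] by (simp add: s_def)
  have "g y \<le> exp ((b - 1) * s) * g x" using cone_le[OF g a(2,1,3)] a(4) by (simp add: s_def)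
  then have 2: "exp (- ((b - 1) * s)) * g y \<le> g x" 
    by (subst exp_minus) (simp add: divide_simps mult.commute)
  have "exp (b * s) - exp (- ((b - 1) * s)) = exp (b * s) * (1 - exp (- ((2 * b - 1) * s)))"
    by (simp add: algebra_simps flip: exp_add)
  also have "\<dots> \<le> exp b * (2 * b * s)"
  proof (rule mult_mono)
    show "exp (b * s) \<le> exp b" using s b_ge by simp
    have "1 - (2 * b - 1) * s \<le> exp (- ((2 * b - 1) * s))"
      using exp_ge_add_one_self[of "- ((2 * b - 1) * s)"] by simp
    then show "1 - exp (- ((2 * b - 1) * s)) \<le> 2 * b * s" using s by (simp add: algebra_simps)
    show "0 \<le> 1 - exp (- ((2 * b - 1) * s))" using s b_ge by simp
  qed simp
  finally have 3: "exp (b * s) - exp (- ((b - 1) * s)) \<le> c0 * s" by (simp add: c0_def mult_ac)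
  have "exp (b * s) - exp ((b - 1) * s) = exp ((b - 1) * s) * (exp s - 1)"
    by (simp add: algebra_simps flip: exp_add)
  also have "\<dots> \<ge> 1 * s"
  proof (rule mult_mono)
    show "s \<le> exp s - 1" using exp_ge_add_one_self[of s] by linarith
  qed (use s b_ge in auto)
  finally have 4: "s \<le> exp (b * s) - exp ((b - 1) * s)" by simp
  have "t * g y * (exp (b * s) - exp (- ((b - 1) * s))) \<le> t * g y * (c0 * s)"
    using 3 t gy by (intro mult_left_mono) auto
  also have "\<dots> \<le> f y * s" using le[OF a(2)] s by (simp add: mult_ac)
  also have "\<dots> \<le> f y * (exp (b * s) - exp ((b - 1) * s))"
    using 4 gy by (intro mult_left_mono) auto
  finally have 5: "exp ((b - 1) * s) * f y - t * (exp (- ((b - 1) * s)) * g y)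
      \<le> exp (b * s) * (f y - t * g y)" by (simp add: algebra_simps)
  have "t * (exp (- ((b - 1) * s)) * g y) \<le> t * g x" using 2 t by (rule mult_left_mono)
  then show "f x - t * g x \<le> exp (b * \<theta> ^ n) * (f y - t * g y)"
    using 1 5 by (simp add: s_def)
qed

text \<open>With this value \<delta> R^2 c0 = 1/2, the share of F + G that one of the two summands
  must carry at a point. R^2 pays for two uses of the Harnack inequality and \<open>c0\<close> for
  \<open>cone_sub\<close>.\<close>

definition \<delta> :: real where "\<delta> = 1 / (2 * R\<^sup>2 * c0)"

lemma \<delta>: "0 < \<delta>" "\<delta> < 1"
proof -
  have "R\<^sup>2 * c0 \<ge> 1" using R_ge c0_ge by (intro mult_ge1_I one_le_power)
  then show "0 < \<delta>" "\<delta> < 1" by (simp_all add: \<delta>_def field_simps)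
qed

text \<open>A comparison at the single point \<open>z\<close> is enough: the Harnack inequality
  carries \<open>h\<close> from \<open>x\<close> to \<open>z\<close> and \<open>F\<close> from
  \<open>z\<close> to \<open>x\<close>, which accounts for R^2, and \<open>cone_sub\<close> does the
  rest.\<close>

lemma Lpow_sub_cone:
  assumes F: "F \<in> cone b" and h: "h \<in> cone b" and t: "t \<ge> 0"
    and z: "z \<in> X" and le: "t * R\<^sup>2 * c0 * (L ^^ N) h z \<le> (L ^^ N) F z"
  shows "(\<lambda>x. (L ^^ N) F x - t * (L ^^ N) h x) \<in> cone b"
proof (rule cone_sub[OF Lpow_cone'[OF F N_pos] Lpow_cone'[OF h N_pos] t])
  fix x assume x: "x \<in> X"
  have "t * c0 * (L ^^ N) h x \<le> t * c0 * (R * (L ^^ N) h z)"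
    using harnack[OF h x z] t c0_ge by (intro mult_left_mono) auto
  also have "R * \<dots> \<le> (L ^^ N) F z" using le by (simp add: power2_eq_square mult_ac)
  also have "(L ^^ N) F z \<le> R * (L ^^ N) F x" by (rule harnack[OF F z x])
  finally show "t * c0 * (L ^^ N) h x \<le> (L ^^ N) F x"
    using R_ge by (smt (verit, best) mult_le_cancel_left)
qed

text \<open>Since the images of \<open>F\<close> and \<open>G\<close> add up to that of \<open>F + G\<close>, one of them carries half of it at a
  reference point, hence by the Harnack inequality a fixed fraction everywhere.\<close>

lemma contraction_step:
  assumes F: "F \<in> cone b" and G: "G \<in> cone b"
  shows "(\<lambda>x. (L ^^ N) F x - \<delta> * ((L ^^ N) F x + (L ^^ N) G x)) \<in> cone b \<or>
    (\<lambda>x. (L ^^ N) G x - \<delta> * ((L ^^ N) F x + (L ^^ N) G x)) \<in> cone b"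
proof -
  obtain z where z: "z \<in> X" using nonempty by auto
  let ?h = "\<lambda>x. F x + G x"
  have h: "?h \<in> cone b" using cone_sum[of UNIV "\<lambda>s. if s then F else G" b] F G
    by (auto simp: UNIV_bool add.commute)
  have Lh: "(L ^^ N) ?h x = (L ^^ N) F x + (L ^^ N) G x" for x
    using Lpow_lin[of N 1 F 1 G] by (simp add: fun_eq_iff)
  have eq: "\<delta> * R\<^sup>2 * c0 = 1 / 2" using R_ge c0_ge by (simp add: \<delta>_def)
  have "\<delta> * R\<^sup>2 * c0 * (L ^^ N) ?h z \<le> (L ^^ N) F z \<or> \<delta> * R\<^sup>2 * c0 * (L ^^ N) ?h z \<le> (L ^^ N) G z"
    unfolding eq Lh by argo
  then show ?thesis
    using Lpow_sub_cone[OF F h _ z, of \<delta>] Lpow_sub_cone[OF G h _ z, of \<delta>] \<delta> by (auto simp: Lh)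
qed

text \<open>The functions f - \<alpha> g and \<beta> g - f (after iteration) stay in the cone and
  add up to (\<beta> - \<alpha>) g, so \<open>contraction_step\<close> raises \<alpha> or lowers
  \<beta> by \<delta>(\<beta> - \<alpha>). The lower constant never drops below
  \<open>\<alpha>0\<close>, which later turns the additive gap into a relative error.\<close>

lemma contraction_iterate:
  assumes f: "f \<in> cone b" and g: "g \<in> cone b"
    and 0: "(\<lambda>x. f x - \<alpha>0 * g x) \<in> cone b" "(\<lambda>x. \<beta>0 * g x - f x) \<in> cone b" "\<alpha>0 \<le> \<beta>0"
  shows "\<exists>\<alpha> \<beta>. \<alpha>0 \<le> \<alpha> \<and> \<beta> - \<alpha> = (1 - \<delta>) ^ k * (\<beta>0 - \<alpha>0) \<and>
    (\<lambda>x. (L ^^ (k * N)) f x - \<alpha> * (L ^^ (k * N)) g x) \<in> cone b \<and>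
    (\<lambda>x. \<beta> * (L ^^ (k * N)) g x - (L ^^ (k * N)) f x) \<in> cone b"
proof (induction k)
  case 0
  then show ?case using assms by (intro exI[of _ \<alpha>0] exI[of _ \<beta>0]) auto
next
  case (Suc k)
  then obtain \<alpha> \<beta> where ab: "\<alpha>0 \<le> \<alpha>" "\<beta> - \<alpha> = (1 - \<delta>) ^ k * (\<beta>0 - \<alpha>0)"
    and F: "(\<lambda>x. (L ^^ (k * N)) f x - \<alpha> * (L ^^ (k * N)) g x) \<in> cone b" (is "?F \<in> _")
    and G: "(\<lambda>x. \<beta> * (L ^^ (k * N)) g x - (L ^^ (k * N)) f x) \<in> cone b" (is "?G \<in> _")
    by blast
  let ?f = "(L ^^ (Suc k * N)) f" and ?g = "(L ^^ (Suc k * N)) g"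
  have fg: "?f = (L ^^ N) ((L ^^ (k * N)) f)" "?g = (L ^^ N) ((L ^^ (k * N)) g)"
    by (simp_all add: funpow_add)
  have LF: "(L ^^ N) ?F x = ?f x - \<alpha> * ?g x" and LG: "(L ^^ N) ?G x = \<beta> * ?g x - ?f x" for x
    unfolding fg using Lpow_lin[of N 1 "(L ^^ (k * N)) f" "- \<alpha>" "(L ^^ (k * N)) g"]
      Lpow_lin[of N \<beta> "(L ^^ (k * N)) g" "- 1" "(L ^^ (k * N)) f"]
    by (simp_all add: fun_eq_iff)
  have FN: "(\<lambda>x. ?f x - \<alpha> * ?g x) \<in> cone b" "(\<lambda>x. \<beta> * ?g x - ?f x) \<in> cone b"
    using Lpow_cone[OF F, of N, unfolded ext[of "(L ^^ N) ?F", OF LF]]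
      Lpow_cone[OF G, of N, unfolded ext[of "(L ^^ N) ?G", OF LG]] .
  have mono: "\<alpha> \<le> \<beta>" using ab \<delta> 0 by (smt (verit) mult_nonneg_nonneg zero_le_power)
  from contraction_step[OF F G]
  consider "(\<lambda>x. ?f x - (\<alpha> + \<delta> * (\<beta> - \<alpha>)) * ?g x) \<in> cone b"
    | "(\<lambda>x. (\<beta> - \<delta> * (\<beta> - \<alpha>)) * ?g x - ?f x) \<in> cone b"
    unfolding LF LG by (auto simp: algebra_simps)
  then show ?case
  proof cases
    case 1
    have "\<beta> - (\<alpha> + \<delta> * (\<beta> - \<alpha>)) = (1 - \<delta>) * (\<beta> - \<alpha>)" by (simp add: algebra_simps)
    also have "\<dots> = (1 - \<delta>) ^ Suc k * (\<beta>0 - \<alpha>0)" by (simp add: ab(2))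
    finally have "\<beta> - (\<alpha> + \<delta> * (\<beta> - \<alpha>)) = (1 - \<delta>) ^ Suc k * (\<beta>0 - \<alpha>0)" .
    moreover have "\<alpha>0 \<le> \<alpha> + \<delta> * (\<beta> - \<alpha>)" using ab(1) mono \<delta>
        by (simp add: add_increasing2)
    ultimately show ?thesis using 1 FN(2) by blast
  next
    case 2
    have "(\<beta> - \<delta> * (\<beta> - \<alpha>)) - \<alpha> = (1 - \<delta>) * (\<beta> - \<alpha>)" by (simp add: algebra_simps)
    also have "\<dots> = (1 - \<delta>) ^ Suc k * (\<beta>0 - \<alpha>0)" by (simp add: ab(2))
    finally have "(\<beta> - \<delta> * (\<beta> - \<alpha>)) - \<alpha> = (1 - \<delta>) ^ Suc k * (\<beta>0 - \<alpha>0)" .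
    then show ?thesis using 2 FN(1) ab(1) by blast
  qed
qed

lemma contraction_aux:
  assumes f: "f \<in> cone b" and g: "g \<in> cone b" and gpos: "\<And>x. x \<in> X \<Longrightarrow> 0 < g x" and n: "n \<ge> N"
  shows "\<exists>\<alpha>\<ge>0. \<forall>x\<in>X. \<alpha> * (L ^^ n) g x \<le> (L ^^ n) f x \<and>
      (L ^^ n) f x \<le> (1 + R ^ 4 * c0\<^sup>2 * (1 - \<delta>) ^ ((n - N) div N)) * \<alpha> * (L ^^ n) g x"
proof -
  obtain z where z: "z \<in> X" using nonempty by auto
  let ?f = "(L ^^ N) f" and ?g = "(L ^^ N) g"
  have fN: "?f \<in> cone b" "?g \<in> cone b" using Lpow_cone f g by auto
  have gz: "?g z > 0"
    using le_LpowN[OF g z z] gpos[OF z] \<kappa>_ge by (smt (verit) mult_le_0_iff)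
  define r where "r = ?f z / ?g z"
  have r: "r \<ge> 0" "?f z = r * ?g z" using gz cone_nonneg[OF fN(1) z] by (auto simp: r_def)
  \<comment> \<open>\<open>r\<close> is the ratio of the N-th iterates at \<open>z\<close>. The
    factor R^2 c0 in either direction is what \<open>Lpow_sub_cone\<close> asks for, and it gives
    \<beta>0 = R^4 c0^2 \<alpha>0 whatever \<open>r\<close> is.\<close>
  define \<alpha>0 \<beta>0 where "\<alpha>0 = r / (R\<^sup>2 * c0)" and "\<beta>0 = r * R\<^sup>2 * c0"
  have RC: "R\<^sup>2 * c0 \<ge> 1" using R_ge c0_ge by (intro mult_ge1_I one_le_power)
  have a0: "(\<lambda>x. ?f x - \<alpha>0 * ?g x) \<in> cone b"
    using R_ge c0_ge r by (intro Lpow_sub_cone[OF f g _ z]) (auto simp: \<alpha>0_def)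
  have b0: "(\<lambda>x. \<beta>0 * ?g x - ?f x) \<in> cone b"
  proof -
    have "1 * R\<^sup>2 * c0 * (L ^^ N) f z \<le> (L ^^ N) (\<lambda>x. \<beta>0 * g x) z"
      unfolding Lpow_scale r(2) \<beta>0_def by (simp add: mult_ac)
    moreover have "\<beta>0 \<ge> 0" using r c0_ge by (simp add: \<beta>0_def)
    ultimately show ?thesis
      using Lpow_sub_cone[OF cone_scale[OF g, of \<beta>0] f, of 1 z] z by (simp add: Lpow_scale)
  qed
  have "r \<le> r * (R\<^sup>2 * c0)" "r / (R\<^sup>2 * c0) \<le> r"
    using RC r mult_left_mono[of 1 "R\<^sup>2 * c0" r] by (auto simp: divide_simps)
  then have ab0: "\<alpha>0 \<le> \<beta>0" "\<alpha>0 \<ge> 0" using r c0_ge by (auto simp: \<alpha>0_def \<beta>0_def mult_ac)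
  define k where "k = (n - N) div N"
  define j where "j = (n - N) mod N"
  have nk: "n = j + (k * N + N)" using n by (simp add: k_def j_def)
  from contraction_iterate[OF fN a0 b0 ab0(1), of k]
  obtain \<alpha> \<beta> where ab: "\<alpha>0 \<le> \<alpha>" "\<beta> - \<alpha> = (1 - \<delta>) ^ k * (\<beta>0 - \<alpha>0)"
    and F: "(\<lambda>x. (L ^^ (k * N)) ?f x - \<alpha> * (L ^^ (k * N)) ?g x) \<in> cone b"
    and G: "(\<lambda>x. \<beta> * (L ^^ (k * N)) ?g x - (L ^^ (k * N)) ?f x) \<in> cone b"
    by blast
  have 1: "\<alpha> * (L ^^ n) g x \<le> (L ^^ n) f x" if "x \<in> X" for x
  proof -
    have "(L ^^ j) (\<lambda>x. \<alpha> * (L ^^ (k * N)) ?g x) x \<le> (L ^^ j) ((L ^^ (k * N)) ?f) x"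
      using cone_nonneg[OF F] by (intro Lpow_mono that) auto
    then show ?thesis by (simp add: Lpow_scale nk funpow_add)
  qed
  have 2: "(L ^^ n) f x \<le> \<beta> * (L ^^ n) g x" if "x \<in> X" for x
  proof -
    have "(L ^^ j) ((L ^^ (k * N)) ?f) x \<le> (L ^^ j) (\<lambda>x. \<beta> * (L ^^ (k * N)) ?g x) x"
      using cone_nonneg[OF G] by (intro Lpow_mono that) auto
    then show ?thesis by (simp add: Lpow_scale nk funpow_add)
  qed
  have "\<beta>0 = R ^ 4 * c0\<^sup>2 * \<alpha>0" using R_ge c0_ge
    by (simp add: \<alpha>0_def \<beta>0_def field_simps power2_eq_square power4_eq_xxxx)
  then have "\<beta>0 - \<alpha>0 \<le> R ^ 4 * c0\<^sup>2 * \<alpha>0" using ab0 by simp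
  also have "\<dots> \<le> R ^ 4 * c0\<^sup>2 * \<alpha>" using ab(1) by (intro mult_left_mono) auto
  finally have "(1 - \<delta>) ^ k * (\<beta>0 - \<alpha>0) \<le> (1 - \<delta>) ^ k * (R ^ 4 * c0\<^sup>2 * \<alpha>)"
    using \<delta> by (intro mult_left_mono) auto
  then have 3: "\<beta> \<le> (1 + R ^ 4 * c0\<^sup>2 * (1 - \<delta>) ^ k) * \<alpha>" using ab(2) by (simp add: algebra_simps)
  have "\<beta> * (L ^^ n) g x \<le> (1 + R ^ 4 * c0\<^sup>2 * (1 - \<delta>) ^ k) * \<alpha> * (L ^^ n) g x" if "x \<in> X" for x
    using 3 cone_nonneg[OF Lpow_cone[OF g] that] by (intro mult_right_mono)
  then show ?thesis using 1 2 ab ab0 unfolding k_def[symmetric]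
    by (intro exI[of _ \<alpha>]) (smt (verit, best))
qed

text \<open>A block of \<open>N\<close> iterates contracts by 1 - \<delta>, so the root is the rate
  per iterate. The power rate^(2 N) in \<open>Crate\<close> pays for the \<open>N\<close> initial
  iterates and for the incomplete last block.\<close>

definition rate :: real where "rate = root N (1 - \<delta>)"
definition Crate :: real where "Crate = R ^ 4 * c0\<^sup>2 / rate ^ (2 * N)"

lemma rate: "0 < rate" "rate < 1"
  using \<delta> N_pos by (auto simp: rate_def real_root_lt_1_iff)

lemma Crate_nonneg: "Crate \<ge> 0" using rate by (simp add: Crate_def)

lemma contraction:
  assumes f: "f \<in> cone b" and g: "g \<in> cone b" and gpos: "\<And>x. x \<in> X \<Longrightarrow> 0 < g x" and n: "n \<ge> N"
  obtains \<alpha> where "\<alpha> \<ge> 0" "\<And>x. x \<in> X \<Longrightarrow> \<alpha> * (L ^^ n) g x \<le> (L ^^ n) f x"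
      "\<And>x. x \<in> X \<Longrightarrow> (L ^^ n) f x \<le> (1 + Crate * rate ^ n) * \<alpha> * (L ^^ n) g x"
proof -
  from contraction_aux[OF assms] obtain \<alpha> where a: "\<alpha> \<ge> 0"
    "\<And>x. x \<in> X \<Longrightarrow> \<alpha> * (L ^^ n) g x \<le> (L ^^ n) f x"
    "\<And>x. x \<in> X \<Longrightarrow> (L ^^ n) f x \<le> (1 + R ^ 4 * c0\<^sup>2 * (1 - \<delta>) ^ ((n - N) div N)) * \<alpha> * (L ^^ n) g x"
    by blast
  have "(1 - \<delta>) ^ ((n - N) div N) = rate ^ (N * ((n - N) div N))"
    using \<delta> N_pos by (simp add: rate_def power_mult)
  also have "\<dots> = rate ^ (2 * N + N * ((n - N) div N)) / rate ^ (2 * N)"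
    using rate by (simp add: power_add)
  also have "\<dots> \<le> rate ^ n / rate ^ (2 * N)"
  proof (intro divide_right_mono power_decreasing)
    have "(n - N) mod N < N" using N_pos by (intro mod_less_divisor) auto
    moreover have "N * ((n - N) div N) + (n - N) mod N = n - N" by simp
    ultimately show "n \<le> 2 * N + N * ((n - N) div N)" by linarith
  qed (use rate in auto)
  finally have "R ^ 4 * c0\<^sup>2 * (1 - \<delta>) ^ ((n - N) div N) \<le> R ^ 4 * c0\<^sup>2 * (rate ^ n / rate ^ (2 * N))"
    by (intro mult_left_mono) auto
  then have le: "R ^ 4 * c0\<^sup>2 * (1 - \<delta>) ^ ((n - N) div N) \<le> Crate * rate ^ n"
    by (simp add: Crate_def)
  have "(1 + R ^ 4 * c0\<^sup>2 * (1 - \<delta>) ^ ((n - N) div N)) * \<alpha> * (L ^^ n) g x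
      \<le> (1 + Crate * rate ^ n) * \<alpha> * (L ^^ n) g x" if "x \<in> X" for x
    using le a(1) cone_nonneg[OF Lpow_cone[OF g] that] by (intro mult_right_mono) auto
  then show ?thesis using a by (intro that[of \<alpha>]) (auto intro: order.trans)
qed

end

section \<open>Gibbs weights on words\<close>

context transfer_operator
begin

lemma sum_words_append: "(\<Sum>w\<in>words (k + n). F w) = (\<Sum>u\<in>words k. \<Sum>v\<in>words n. F (u @ v))"
proof (induction n arbitrary: F)
  case (Suc n)
  then show ?case by (simp add: sum_words_Suc)
qed simp

lemma sum_words_occurrence:
  assumes "w \<in> words l"
  shows "(\<Sum>W\<in>words (k + (l + n)). F W * of_bool (take l (drop k W) = w)) =
    (\<Sum>u\<in>words k. \<Sum>v\<in>words n. F (u @ w @ v) :: real)"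
proof -
  have "(\<Sum>W\<in>words (k + (l + n)). F W * of_bool (take l (drop k W) = w)) =
      (\<Sum>u\<in>words k. \<Sum>w'\<in>words l. \<Sum>v\<in>words n. F (u @ w' @ v) * of_bool (w' = w))"
    unfolding sum_words_append by (intro sum.cong refl) (auto simp: words_def)
  also have "\<dots> = (\<Sum>u\<in>words k. \<Sum>w'\<in>words l. if w' = w then (\<Sum>v\<in>words n. F (u @ w' @ v)) else 0)"
    by (intro sum.cong refl) auto
  finally show ?thesis using assms by simp
qed

lemma L_sum: "finite S \<Longrightarrow> L (\<lambda>x. \<Sum>s\<in>S. h s x) = (\<lambda>x. \<Sum>s\<in>S. L (h s) x)"
  unfolding L_def by (subst sum.swap) (simp add: letter_sum)

lemma Lpow_sum: "finite S \<Longrightarrow> (L ^^ n) (\<lambda>x. \<Sum>s\<in>S. h s x) = (\<lambda>x. \<Sum>s\<in>S. (L ^^ n) (h s) x)"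
  by (induction n) (simp_all add: L_sum)

lemma Lpow_fun_eq: "(\<lambda>x. \<Sum>v\<in>words n. word v f x) = (L ^^ n) f"
  by (auto simp: Lpow_eq)

lemma Lpow_add: "(L ^^ m) ((L ^^ n) f) = (L ^^ (m + n)) f"
  by (simp add: funpow_add)

lemma sum_Lpow_word_word:
  "(\<Sum>v\<in>words n. (L ^^ q) (word w (word v f)) x) = (L ^^ q) (word w ((L ^^ n) f)) x"
  unfolding Lpow_fun_eq[where n = n and f = f, symmetric] word_sum[OF finite_words] Lpow_sum[OF finite_words] ..

section \<open>Finite-volume weights of words and their consistency\<close>

definition base :: "nat \<Rightarrow> 'a" where "base = (SOME z. z \<in> X)"

lemma base: "base \<in> X"
  unfolding base_def using nonempty by (simp add: some_in_eq)

abbreviation Lone :: "nat \<Rightarrow> (nat \<Rightarrow> 'a) \<Rightarrow> real" where "Lone n \<equiv> (L ^^ n) (\<lambda>_. 1)"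

text \<open>The weight of \<open>w\<close> in a window with \<open>p\<close> free symbols to its
  left and \<open>q\<close> to its right. Beyond the right end the configuration is frozen to
  \<open>base\<close>; on the left the function 1 leaves the boundary free.\<close>

definition Q :: "'a list \<Rightarrow> nat \<Rightarrow> nat \<Rightarrow> real" where
  "Q w p q = (L ^^ q) (word w (Lone p)) base / Lone (p + length w + q) base"

text \<open>The last letter of a joining word is an admissible predecessor of \<open>y\<close>, so L
  1 is at least exp(-B) on \<open>X\<close>, and positivity of the operator iterates this.\<close>

lemma Lone_pos: "x \<in> X \<Longrightarrow> Lone n x > 0"
proof (induction n arbitrary: x)
  case (Suc n)
  have pre: "exp (- B) \<le> L (\<lambda>_. 1) y" if y: "y \<in> X" for y
  proof -
    have "y 0 \<in> I" using y by (auto simp: admissible_seqs_def)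
    from mixing[OF this y] obtain w where w: "w \<noteq> []" "prepend w y \<in> X" by auto
    have "prepend (butlast w @ [last w]) y \<in> X" using w by simp
    then have "prepend (butlast w) (case_nat (last w) y) \<in> X" by (simp del: append_butlast_last_id)
    then have i: "case_nat (last w) y \<in> X" by (rule prepend_admissibleD)
    then have i': "last w \<in> I" "E (last w) (y 0)" by (auto simp: case_nat_admissible_iff)
    have "exp (- B) \<le> letter (last w) (\<lambda>_. 1) y"
      using i' \<phi>_bound[OF i] by (simp add: letter_def)
    also have "\<dots> \<le> L (\<lambda>_. 1) y"
      unfolding L_def using i'(1) finite_I by (intro member_le_sum) (auto simp: letter_def)
    finally show ?thesis .
  qed
  have "0 < exp (- B) * Lone n x" using Suc by simp
  also have "\<dots> = (L ^^ n) (\<lambda>x. exp (- B) * 1) x" unfolding Lpow_scale ..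
  also have "\<dots> \<le> (L ^^ n) (L (\<lambda>_. 1)) x"
    using pre by (intro Lpow_mono Suc.prems) auto
  finally show ?case by (simp only: funpow_Suc_right o_apply)
qed simp

lemma Lone_cone: "Lone n \<in> cone b" by (intro Lpow_cone cone_one)

lemma Q_nonneg: "Q w p q \<ge> 0"
  unfolding Q_def
  by (intro divide_nonneg_nonneg cone_nonneg[OF Lpow_cone[OF word_cone[OF Lone_cone]]]
      cone_nonneg[OF Lone_cone] base)

text \<open>Summing a block of \<open>n\<close> symbols over all words turns it into part of the
  margin; the total length, and with it the normalisation, is unchanged. The weights are thus
  consistent except that the margins grow.\<close>

lemma sum_Q_right: "(\<Sum>v\<in>words n. Q (w @ v) p q) = Q w p (n + q)"
proof -
  have "(\<Sum>v\<in>words n. (L ^^ q) (word (w @ v) (Lone p)) base) = (L ^^ (n + q)) (word w (Lone p)) base"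
    unfolding word_append using sum_Lpow_word_word[where w = "[]" and q = q and n = n] by (simp add: Lpow_add add.commute)
  moreover have "(\<Sum>v\<in>words n. Q (w @ v) p q) =
      (\<Sum>v\<in>words n. (L ^^ q) (word (w @ v) (Lone p)) base / Lone (p + length w + (n + q)) base)"
    unfolding Q_def by (intro sum.cong refl) (auto simp: words_def add.assoc)
  ultimately show ?thesis unfolding Q_def by (simp add: sum_divide_distrib[symmetric])
qed

lemma sum_Q_left: "(\<Sum>v\<in>words n. Q (v @ w) p q) = Q w (p + n) q"
proof -
  have "(\<Sum>v\<in>words n. (L ^^ q) (word (v @ w) (Lone p)) base) = (L ^^ q) (word w (Lone (p + n))) base"
    unfolding word_append by (simp add: sum_Lpow_word_word Lpow_add add.commute)
  moreover have "(\<Sum>v\<in>words n. Q (v @ w) p q) =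
      (\<Sum>v\<in>words n. (L ^^ q) (word (v @ w) (Lone p)) base / Lone (p + n + length w + q) base)"
    unfolding Q_def by (intro sum.cong refl) (auto simp: words_def add_ac)
  ultimately show ?thesis unfolding Q_def by (simp add: sum_divide_distrib[symmetric])
qed

lemma Q_Nil [simp]: "Q [] p q = 1"
  using Lone_pos[OF base, of "q + p"] by (simp add: Q_def Lpow_add add.commute)

lemma sum_Q_words: "(\<Sum>v\<in>words n. Q v p q) = 1"
  using sum_Q_right[where w = "[]" and n = n and p = p and q = q] by simp

lemma Q_le_1: "w \<in> words n \<Longrightarrow> Q w p q \<le> 1"
  using member_le_sum[of w "words n" "\<lambda>v. Q v p q"] sum_Q_words Q_nonneg by simp

definition err :: "nat \<Rightarrow> real" where "err n = Crate * rate ^ n"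

lemma err_nonneg: "err n \<ge> 0"
  using Crate_nonneg rate by (simp add: err_def)

lemma err_antimono: "m \<le> n \<Longrightarrow> err n \<le> err m"
  unfolding err_def using Crate_nonneg rate by (intro mult_left_mono power_decreasing) auto

lemma err_tendsto: "err \<longlonglongrightarrow> 0"
  unfolding err_def[abs_def] using rate by (auto intro!: tendsto_eq_intros LIMSEQ_realpow_zero)

text \<open>Applying L^g flattens \<open>word u (Lone p)\<close> to nearly \<alpha> times the
  corresponding iterate of 1. The upper bound pulls \<alpha> out of the joint weight and leaves the
  weight of \<open>w\<close>; the lower bound says that \<alpha> is at most the weight of
  \<open>u\<close>. Since one \<alpha> serves both, the error is relative and depends on the gap
  only.\<close>

lemma Q_joint:
  assumes g: "g \<ge> N"
  shows "(\<Sum>v\<in>words g. Q (u @ v @ w) p q)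
    \<le> (1 + err g) * Q u p (g + length w + q) * Q w (p + length u + g) q"
proof -
  let ?F = "word u (Lone p)" and ?G = "Lone (p + length u)"
  let ?Z = "Lone (p + length u + g + length w + q) base"
  have Z: "?Z > 0" by (rule Lone_pos[OF base])
  have F: "?F \<in> cone b" by (intro word_cone Lone_cone)
  from contraction[OF F Lone_cone Lone_pos g, of "p + length u"] obtain \<alpha> where \<alpha>: "\<alpha> \<ge> 0"
    "\<And>x. x \<in> X \<Longrightarrow> \<alpha> * (L ^^ g) ?G x \<le> (L ^^ g) ?F x"
    "\<And>x. x \<in> X \<Longrightarrow> (L ^^ g) ?F x \<le> (1 + err g) * \<alpha> * (L ^^ g) ?G x"
    unfolding err_def by blast
  have "(\<Sum>v\<in>words g. (L ^^ q) (word (u @ v @ w) (Lone p)) base)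
      = (L ^^ q) (word w ((L ^^ g) ?F)) base"
    unfolding word_append by (simp add: sum_Lpow_word_word)
  also have "\<dots> \<le> (L ^^ q) (word w (\<lambda>x. ((1 + err g) * \<alpha>) * (L ^^ g) ?G x)) base"
    using \<alpha>(3) by (intro Lpow_mono word_mono base) auto
  also have "\<dots> = ((1 + err g) * \<alpha>) * (L ^^ q) (word w (Lone (p + length u + g))) base"
    unfolding word_scale Lpow_scale by (simp add: Lpow_add add_ac)
  finally have 1: "(\<Sum>v\<in>words g. (L ^^ q) (word (u @ v @ w) (Lone p)) base) / ?Z
      \<le> ((1 + err g) * \<alpha>) * Q w (p + length u + g) q"
    using Z by (simp add: Q_def divide_right_mono)
  have "\<alpha> * ?Z = (L ^^ (q + length w)) (\<lambda>x. \<alpha> * (L ^^ g) ?G x) base"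
    unfolding Lpow_scale by (simp add: Lpow_add add_ac)
  also have "\<dots> \<le> (L ^^ (q + length w)) ((L ^^ g) ?F) base"
    using \<alpha>(2) by (intro Lpow_mono base) auto
  also have "\<dots> = (L ^^ (g + length w + q)) ?F base"
    by (simp add: Lpow_add add_ac)
  finally have 2: "\<alpha> \<le> Q u p (g + length w + q)"
    using Z by (simp add: Q_def field_simps add_ac)
  have "(\<Sum>v\<in>words g. Q (u @ v @ w) p q)
      = (\<Sum>v\<in>words g. (L ^^ q) (word (u @ v @ w) (Lone p)) base / ?Z)"
    unfolding Q_def by (intro sum.cong refl) (auto simp: words_def add_ac)
  also have "\<dots> \<le> ((1 + err g) * \<alpha>) * Q w (p + length u + g) q"
    using 1 by (simp add: sum_divide_distrib)
  also have "\<dots> \<le> ((1 + err g) * Q u p (g + length w + q)) * Q w (p + length u + g) q"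
    using 2 err_nonneg Q_nonneg by (intro mult_right_mono mult_left_mono) auto
  finally show ?thesis .
qed

section \<open>Stability of the weights under a change of margins\<close>

lemma ratio_bounds:
  fixes \<alpha> e s s' t t' :: real
  assumes "\<alpha> > 0" "e \<ge> 0" "s > 0" "t \<ge> 0"
    and t: "\<alpha> * t \<le> t'" "t' \<le> (1 + e) * \<alpha> * t" and s: "\<alpha> * s \<le> s'" "s' \<le> (1 + e) * \<alpha> * s"
  shows "t' / s' \<le> (1 + e) * (t / s)" and "t / s \<le> (1 + e) * (t' / s')"
proof -
  have "0 < \<alpha> * s" "0 \<le> \<alpha> * t" using assms by auto
  then have s': "s' > 0" "t' \<ge> 0" using s t by linarith+
  have "t' / s' \<le> (1 + e) * \<alpha> * t / (\<alpha> * s)"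
    using assms s' by (intro frac_le) auto
  then show "t' / s' \<le> (1 + e) * (t / s)" using assms by simp
  have "t / s = (1 + e) * (\<alpha> * t / ((1 + e) * \<alpha> * s))" using assms by simp
  also have "\<dots> \<le> (1 + e) * (t' / s')"
    using assms s' by (intro mult_left_mono frac_le) auto
  finally show "t / s \<le> (1 + e) * (t' / s')" .
qed

text \<open>The iterates of 1 of orders \<open>p\<close> and \<open>p'\<close> are proportional up
  to \<open>err p\<close>, and the constant of proportionality cancels between numerator and
  normalisation.\<close>

lemma Q_left_stationary_aux:
  assumes p: "N \<le> p" "p \<le> p'"
  shows "Q w p' q \<le> (1 + err p) * Q w p q" "Q w p q \<le> (1 + err p) * Q w p' q"
proof -
  from contraction[OF Lone_cone[of "p' - p"] Lone_cone[of 0] Lone_pos p(1),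
      unfolded Lpow_add le_add_diff_inverse[OF p(2)] add_0_right]
  obtain \<alpha> where \<alpha>: "\<alpha> \<ge> 0"
    "\<And>x. x \<in> X \<Longrightarrow> \<alpha> * Lone p x \<le> Lone p' x"
    "\<And>x. x \<in> X \<Longrightarrow> Lone p' x \<le> (1 + err p) * \<alpha> * Lone p x"
    unfolding err_def by blast
  have \<alpha>0: "\<alpha> > 0" using \<alpha>(1) \<alpha>(3)[OF base] Lone_pos[OF base, of p'] by (cases "\<alpha> = 0") auto
  have T: "\<alpha> * (L ^^ n) (word v (Lone p)) base \<le> (L ^^ n) (word v (Lone p')) base"
    "(L ^^ n) (word v (Lone p')) base \<le> (1 + err p) * \<alpha> * (L ^^ n) (word v (Lone p)) base" for n v
  proof -
    have "(L ^^ n) (word v (\<lambda>x. \<alpha> * Lone p x)) base \<le> (L ^^ n) (word v (Lone p')) base"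
      using \<alpha> by (intro Lpow_mono word_mono base)
    then show "\<alpha> * (L ^^ n) (word v (Lone p)) base \<le> (L ^^ n) (word v (Lone p')) base"
      by (simp add: word_scale Lpow_scale)
    have "(L ^^ n) (word v (Lone p')) base \<le> (L ^^ n) (word v (\<lambda>x. ((1 + err p) * \<alpha>) * Lone p x)) base"
      using \<alpha> by (intro Lpow_mono word_mono base)
    then show "(L ^^ n) (word v (Lone p')) base \<le> (1 + err p) * \<alpha> * (L ^^ n) (word v (Lone p)) base"
      by (simp only: word_scale Lpow_scale)
  qed
  have nn: "0 \<le> (L ^^ q) (word w (Lone p)) base"
    by (intro cone_nonneg[OF Lpow_cone[OF word_cone[OF Lone_cone]]] base)
  have S: "\<alpha> * Lone (p + length w + q) base \<le> Lone (p' + length w + q) base"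
    "Lone (p' + length w + q) base \<le> (1 + err p) * \<alpha> * Lone (p + length w + q) base"
    using T[of "length w + q" "[]"] by (simp_all add: Lpow_add add_ac)
  show "Q w p' q \<le> (1 + err p) * Q w p q" "Q w p q \<le> (1 + err p) * Q w p' q"
    unfolding Q_def
    by (rule ratio_bounds[OF \<alpha>0 err_nonneg Lone_pos[OF base] nn T S])+
qed

text \<open>After \<open>q\<close> iterates \<open>word w (Lone p)\<close> lies between \<alpha> and
  (1 + err q) \<alpha> times an iterate of 1, and further applications of \<open>L\<close> preserve
  this. So the weights for all right margins r \<ge> q lie in one interval.\<close>

lemma Q_right_stationary_aux:
  assumes q: "N \<le> q" "q \<le> q'"
  shows "Q w p q' \<le> (1 + err q) * Q w p q" "Q w p q \<le> (1 + err q) * Q w p q'"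
proof -
  let ?F = "word w (Lone p)" and ?G = "Lone (p + length w)"
  have F: "?F \<in> cone b" by (intro word_cone Lone_cone)
  from contraction[OF F Lone_cone Lone_pos q(1), of "p + length w"] obtain \<alpha> where \<alpha>: "\<alpha> \<ge> 0"
    "\<And>x. x \<in> X \<Longrightarrow> \<alpha> * (L ^^ q) ?G x \<le> (L ^^ q) ?F x"
    "\<And>x. x \<in> X \<Longrightarrow> (L ^^ q) ?F x \<le> (1 + err q) * \<alpha> * (L ^^ q) ?G x"
    unfolding err_def by blast
  have *: "\<alpha> \<le> Q w p r \<and> Q w p r \<le> (1 + err q) * \<alpha>" if r: "r \<ge> q" for r
  proof -
    have Z: "Lone (p + length w + r) base > 0" by (rule Lone_pos[OF base])
    have eq: "(L ^^ (r - q)) ((L ^^ q) f) = (L ^^ r) f" for f using r by (simp add: Lpow_add)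
    have ZG: "(L ^^ r) ?G = Lone (p + length w + r)" by (simp add: Lpow_add add_ac)
    have "(L ^^ (r - q)) (\<lambda>x. \<alpha> * (L ^^ q) ?G x) base \<le> (L ^^ (r - q)) ((L ^^ q) ?F) base"
      using \<alpha> by (intro Lpow_mono base)
    then have 1: "\<alpha> * Lone (p + length w + r) base \<le> (L ^^ r) ?F base"
      unfolding Lpow_scale eq ZG .
    have "(L ^^ (r - q)) ((L ^^ q) ?F) base \<le> (L ^^ (r - q)) (\<lambda>x. ((1 + err q) * \<alpha>) * (L ^^ q) ?G x) base"
      using \<alpha> by (intro Lpow_mono base)
    then have 2: "(L ^^ r) ?F base \<le> (1 + err q) * \<alpha> * Lone (p + length w + r) base"
      unfolding Lpow_scale eq ZG .
    show ?thesis unfolding Q_def using 1 2 Z by (simp add: divide_simps)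
  qed
  have mono: "(1 + err q) * \<alpha> \<le> (1 + err q) * Q w p r" if "r \<ge> q" for r
    using *[OF that] err_nonneg by (intro mult_left_mono) auto
  show "Q w p q' \<le> (1 + err q) * Q w p q" "Q w p q \<le> (1 + err q) * Q w p q'"
    using *[of q] *[of q'] mono[of q] mono[of q'] q by auto
qed

lemma Q_stationary:
  assumes "N \<le> n" "n \<le> p" "n \<le> q" "n \<le> p'" "n \<le> q'"
  shows "Q w p' q' \<le> (1 + err n)\<^sup>2 * Q w p q"
proof -
  have up: "(1 + err k) * Q w i j \<le> (1 + err n) * Q w i j" if "n \<le> k" for k i j
    using err_antimono[OF that] Q_nonneg by (intro mult_right_mono) auto
  have "Q w p' q' \<le> (1 + err (min p p')) * Q w p q'"
    using Q_left_stationary_aux[of "min p p'" "max p p'" w q'] assms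
    by (cases "p \<le> p'") (auto simp: min_def max_def)
  also have "\<dots> \<le> (1 + err n) * Q w p q'" using assms by (intro up) auto
  finally have 1: "Q w p' q' \<le> (1 + err n) * Q w p q'" .
  have "Q w p q' \<le> (1 + err (min q q')) * Q w p q"
    using Q_right_stationary_aux[of "min q q'" "max q q'" w p] assms
    by (cases "q \<le> q'") (auto simp: min_def max_def)
  also have "\<dots> \<le> (1 + err n) * Q w p q" using assms by (intro up) auto
  finally have "Q w p q' \<le> (1 + err n) * Q w p q" .
  then have "(1 + err n) * Q w p q' \<le> (1 + err n) * ((1 + err n) * Q w p q)"
    using err_nonneg[of n] by (intro mult_left_mono) auto
  then show ?thesis using 1 by (simp add: power2_eq_square mult.assoc)
qed

end

text \<open>What is retained of the invariant measure: word probabilities consistent on both sides,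
  where \<open>m_Cons\<close> expresses stationarity, and the Gibbs inequality with the pressure
  already absorbed in \<phi>.\<close>

locale gibbs_words = transfer_operator +
  fixes m :: "'a list \<Rightarrow> real" and c :: real
  assumes c_ge: "c \<ge> 1"
    and m_nonneg: "m w \<ge> 0" and m_Nil: "m [] = 1"
    and m_snoc: "(\<Sum>i\<in>I. m (w @ [i])) = m w"
    and m_Cons: "(\<Sum>i\<in>I. m (i # w)) = m w"
    and m_le: "x \<in> X \<Longrightarrow> prepend w x \<in> X \<Longrightarrow> m w \<le> c * exp (weight w x)"
    and m_ge: "x \<in> X \<Longrightarrow> prepend w x \<in> X \<Longrightarrow> exp (weight w x) \<le> c * m w"
    and m_supp: "m w \<noteq> 0 \<Longrightarrow> \<exists>x. prepend w x \<in> X"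
begin

lemma sum_m_right: "(\<Sum>v\<in>words n. m (w @ v)) = m w"
proof (induction n)
  case (Suc n)
  have "(\<Sum>v\<in>words (Suc n). m (w @ v)) = (\<Sum>v\<in>words n. \<Sum>i\<in>I. m ((w @ v) @ [i]))"
    by (simp add: sum_words_Suc)
  then show ?case using Suc by (simp only: m_snoc)
qed simp

lemma sum_m_left: "(\<Sum>v\<in>words n. m (v @ w)) = m w"
proof (induction n arbitrary: w)
  case (Suc n)
  have "(\<Sum>v\<in>words (Suc n). m (v @ w)) = (\<Sum>i\<in>I. \<Sum>v\<in>words n. m (v @ (i # w)))"
    by (simp add: sum_words_Suc sum.swap[of _ I])
  then show ?case by (simp only: Suc m_Cons)
qed simp

lemma sum_m_words: "(\<Sum>v\<in>words n. m v) = 1"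
  using sum_m_right[where w = "[]"] by (simp add: m_Nil)

lemma m_le_1: "w \<in> words n \<Longrightarrow> m w \<le> 1"
  using member_le_sum[of w "words n" m] sum_m_words m_nonneg by simp

text \<open>The probabilities of all words of length \<open>n\<close> add up to 1, so the Gibbs
  inequality keeps the iterates of 1 bounded. Together with the lower bound below this says that
  \<phi> has pressure 0.\<close>

lemma Lone_le: "x \<in> X \<Longrightarrow> Lone n x \<le> c"
proof -
  assume x: "x \<in> X"
  have "Lone n x \<le> (\<Sum>w\<in>words n. c * m w)"
    unfolding Lpow_eq using m_ge[OF x] c_ge m_nonneg by (intro sum_mono) (auto simp: word_eq[OF x])
  then show ?thesis by (simp add: sum_distrib_left[symmetric] sum_m_words)
qed

text \<open>A word of positive probability is compared at a point that it can precede, and this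
  point depends on the word; \<open>le_LpowN\<close> moves all these points to \<open>x\<close> at
  the cost of \<open>N\<close> iterates.\<close>

lemma Lone_ge: "x \<in> X \<Longrightarrow> n \<ge> N \<Longrightarrow> 1 \<le> c * \<kappa> * Lone n x"
proof -
  assume x: "x \<in> X" and n: "n \<ge> N"
  have le: "m w \<le> c * (\<kappa> * (L ^^ N) (word w (\<lambda>_. 1)) x)" for w
  proof (cases "m w = 0")
    case True
    have "0 \<le> (L ^^ N) (word w (\<lambda>_. 1)) x"
      by (intro cone_nonneg[OF Lpow_cone[OF word_cone[OF cone_one]]] x)
    then show ?thesis using True c_ge \<kappa>_ge by simp
  next
    case False
    then obtain y where y: "prepend w y \<in> X" using m_supp by auto
    then have yX: "y \<in> X" by (rule prepend_admissibleD)
    have "m w \<le> c * word w (\<lambda>_. 1) y" using m_le[OF yX y] y yX by (simp add: word_eq)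
    also have "\<dots> \<le> c * (\<kappa> * (L ^^ N) (word w (\<lambda>_. 1)) x)"
      using c_ge by (intro mult_left_mono le_LpowN[OF word_cone[OF cone_one] yX x]) auto
    finally show ?thesis .
  qed
  have "1 \<le> (\<Sum>w\<in>words (n - N). c * (\<kappa> * (L ^^ N) (word w (\<lambda>_. 1)) x))"
    using sum_mono[of "words (n - N)" m, OF le] by (simp add: sum_m_words)
  also have "\<dots> = c * \<kappa> * Lone n x"
    using sum_Lpow_word_word[where w = "[]" and q = N and n = "n - N" and x = x and f = "\<lambda>_. 1"] n
    by (simp add: sum_distrib_left[symmetric] Lpow_add mult.assoc)
  finally show ?thesis .
qed

definition K :: real where "K = c ^ 4 * \<kappa> ^ 3"

lemma K_ge: "K \<ge> 1"
  unfolding K_def using c_ge \<kappa>_ge by (intro mult_ge1_I one_le_power)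

text \<open>Of the right margin, \<open>N\<close> iterates move the point \<open>y\<close> to
  \<open>base\<close> and at least \<open>N\<close> more are used for the lower bound on the
  iterates of 1, hence q \<ge> 2 N. \<open>K\<close> collects the constants and is independent of
  the word, its length and both margins.\<close>

lemma m_le_Q:
  assumes "p \<ge> N" "q \<ge> 2 * N"
  shows "m w \<le> K * Q w p q"
proof (cases "m w = 0")
  case True
  then show ?thesis using K_ge Q_nonneg by simp
next
  case False
  then obtain y where y: "prepend w y \<in> X" using m_supp by auto
  then have yX: "y \<in> X" by (rule prepend_admissibleD)
  let ?F = "word w (Lone p)"
  have F: "?F \<in> cone b" by (intro word_cone Lone_cone)
  have Fy: "0 \<le> ?F y" by (rule cone_nonneg[OF F yX])
  have "m w \<le> c * word w (\<lambda>_. 1) y" using m_le[OF yX y] y yX by (simp add: word_eq)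
  also have "\<dots> \<le> c * word w (\<lambda>x. (c * \<kappa>) * Lone p x) y"
    using c_ge Lone_ge assms by (intro mult_left_mono word_mono yX) auto
  also have "\<dots> = c * (c * \<kappa>) * ?F y" by (simp add: word_scale)
  finally have 1: "m w \<le> c * (c * \<kappa>) * ?F y" .
  have "?F y \<le> ?F y * (c * \<kappa> * Lone (q - N) base)"
    using Lone_ge[OF base, of "q - N"] assms Fy mult_left_mono[of 1 _ "?F y"] by simp
  also have "\<dots> = c * \<kappa> * (L ^^ (q - N)) (\<lambda>x. ?F y * 1) base"
    unfolding Lpow_scale by simp
  also have "\<dots> \<le> c * \<kappa> * (L ^^ (q - N)) (\<lambda>x. \<kappa> * (L ^^ N) ?F x) base"
    using c_ge \<kappa>_ge le_LpowN[OF F yX] by (intro mult_left_mono Lpow_mono base) auto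
  also have "\<dots> = c * \<kappa>\<^sup>2 * (L ^^ q) ?F base"
    using assms unfolding Lpow_scale Lpow_add by (simp add: power2_eq_square)
  also have "(L ^^ q) ?F base = Lone (p + length w + q) base * Q w p q"
    using Lone_pos[OF base, of "p + length w + q"] by (simp add: Q_def)
  also have "\<dots> \<le> c * Q w p q"
    by (intro mult_right_mono Lone_le base Q_nonneg)
  finally have 2: "?F y \<le> c * \<kappa>\<^sup>2 * (c * Q w p q)" using c_ge by (simp add: mult_left_mono)
  have "m w \<le> c * (c * \<kappa>) * (c * \<kappa>\<^sup>2 * (c * Q w p q))"
    using 1 2 c_ge \<kappa>_ge by (smt (verit) mult_left_mono mult_nonneg_nonneg)
  then show ?thesis by (simp add: K_def power2_eq_square power3_eq_cube power4_eq_xxxx mult_ac)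
qed

subsection \<open>Identification of the invariant weights by a second moment argument\<close>

text \<open>Occurrences are tested only at multiples of \<open>length w + g\<close>, so two tested
  positions are always separated by at least \<open>g\<close> symbols.\<close>

definition freq :: "'a list \<Rightarrow> nat \<Rightarrow> nat \<Rightarrow> 'a list \<Rightarrow> real" where
  "freq w g T W = (\<Sum>t<T. of_bool (take (length w) (drop (t * (length w + g)) W) = w)) / real T"

lemma sum_m_occurrence:
  assumes "w \<in> words l" "k + l \<le> n"
  shows "(\<Sum>W\<in>words n. m W * of_bool (take l (drop k W) = w)) = m w"
proof -
  have n: "n = k + (l + (n - k - l))" using assms by simp
  have "(\<Sum>W\<in>words n. m W * of_bool (take l (drop k W) = w)) =
     (\<Sum>u\<in>words k. \<Sum>v\<in>words (n - k - l). m (u @ w @ v))"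
    by (subst n, subst sum_words_occurrence[OF assms(1)]) simp
  also have "\<dots> = (\<Sum>u\<in>words k. m (u @ w))"
    by (intro sum.cong refl) (use sum_m_right in \<open>simp flip: append_assoc\<close>)
  finally show ?thesis by (simp add: sum_m_left)
qed

lemma sum_Q_occurrence:
  assumes "w \<in> words l" "k + l \<le> n"
  shows "(\<Sum>W\<in>words n. Q W p q * of_bool (take l (drop k W) = w)) = Q w (p + k) (n - k - l + q)"
proof -
  have n: "n = k + (l + (n - k - l))" using assms by simp
  have "(\<Sum>W\<in>words n. Q W p q * of_bool (take l (drop k W) = w)) =
     (\<Sum>u\<in>words k. \<Sum>v\<in>words (n - k - l). Q (u @ w @ v) p q)"
    by (subst n, subst sum_words_occurrence[OF assms(1)]) simp
  also have "\<dots> = (\<Sum>u\<in>words k. Q (u @ w) p (n - k - l + q))"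
    by (intro sum.cong refl) (use sum_Q_right in \<open>simp flip: append_assoc\<close>)
  finally show ?thesis by (simp add: sum_Q_left)
qed

lemma sum_Q_two_occurrences:
  assumes w: "w \<in> words l" and kn: "k + (l + (g + (l + r))) = n"
  shows "(\<Sum>W\<in>words n. Q W p q *
        (of_bool (take l (drop k W) = w) * of_bool (take l (drop (k + l + g) W) = w)))
    = (\<Sum>v\<in>words g. Q (w @ v @ w) (p + k) (r + q))"
proof -
  have "(\<Sum>W\<in>words n. Q W p q *
        (of_bool (take l (drop k W) = w) * of_bool (take l (drop (k + l + g) W) = w)))
     = (\<Sum>W\<in>words (k + (l + (g + (l + r)))).
         (Q W p q * of_bool (take l (drop (k + l + g) W) = w)) * of_bool (take l (drop k W) = w))"
    unfolding kn by (simp add: mult_ac)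
  also have "\<dots> = (\<Sum>u\<in>words k. \<Sum>V\<in>words (g + (l + r)).
      Q (u @ w @ V) p q * of_bool (take l (drop (k + l + g) (u @ w @ V)) = w))"
    by (rule sum_words_occurrence[OF w])
  also have "\<dots> = (\<Sum>u\<in>words k. \<Sum>V\<in>words (g + (l + r)).
      Q (u @ w @ V) p q * of_bool (take l (drop g V) = w))"
    using w by (intro sum.cong refl) (auto simp: words_def)
  also have "\<dots> = (\<Sum>u\<in>words k. \<Sum>v\<in>words g. \<Sum>y\<in>words r. Q (u @ w @ v @ w @ y) p q)"
    by (subst sum_words_occurrence[OF w]) simp
  also have "\<dots> = (\<Sum>u\<in>words k. \<Sum>v\<in>words g. Q (u @ w @ v @ w) p (r + q))"
    by (intro sum.cong refl) (use sum_Q_right[where n = r and p = p and q = q] in \<open>simp flip: append_assoc\<close>)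
  also have "\<dots> = (\<Sum>v\<in>words g. Q (w @ v @ w) (p + k) (r + q))"
    by (subst sum.swap) (simp add: sum_Q_left)
  finally show ?thesis .
qed

text \<open>Diagonal pairs contribute at most 1/T. Off the diagonal \<open>Q_joint\<close> costs 1 +
  e and restoring the standard margins costs (1 + e)^2 for each factor, whence the fifth power; the
  linear term needs the mean from below, whence the division by (1 + e)^2.\<close>

lemma second_moment_Q:
  assumes w: "w \<in> words l" and n: "N \<le> n" and T: "T > 0"
  defines "q0 \<equiv> Q w n n" and "e \<equiv> err n"
  shows "(\<Sum>W\<in>words (T * (l + n)). Q W n n * (freq w n T W - q0)\<^sup>2)
     \<le> 1 / real T + (1 + e) ^ 5 * q0\<^sup>2 - 2 * q0\<^sup>2 / (1 + e)\<^sup>2 + q0\<^sup>2"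
proof -
  let ?n = "T * (l + n)"
  define oc where "oc t W = (of_bool (take l (drop (t * (l + n)) W) = w) :: real)" for t W
  have lw: "length w = l" using w by (simp add: words_def)
  have freq: "freq w n T W = (\<Sum>t<T. oc t W) / real T" for W
    by (simp add: freq_def oc_def lw)
  have e: "e \<ge> 0" by (simp add: e_def err_nonneg)
  have q0: "0 \<le> q0" by (simp add: q0_def Q_nonneg)
  have block: "t * (l + n) + l + (T - Suc t) * (l + n) + n = ?n" if "t < T" for t
  proof -
    have "?n = (t + Suc (T - Suc t)) * (l + n)" using that by simp
    then show ?thesis by (simp add: algebra_simps)
  qed
  have single: "q0 \<le> (1 + e)\<^sup>2 * (\<Sum>W\<in>words ?n. Q W n n * oc t W)"
    "(\<Sum>W\<in>words ?n. Q W n n * oc t W) \<le> 1" if t: "t < T" for t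
  proof -
    have "(\<Sum>W\<in>words ?n. Q W n n * oc t W) = Q w (n + t * (l + n)) (?n - t * (l + n) - l + n)"
      unfolding oc_def using block[OF t] by (intro sum_Q_occurrence w) linarith
    then show "q0 \<le> (1 + e)\<^sup>2 * (\<Sum>W\<in>words ?n. Q W n n * oc t W)"
      "(\<Sum>W\<in>words ?n. Q W n n * oc t W) \<le> 1"
      using Q_stationary[OF n] Q_le_1[OF w] by (auto simp: q0_def e_def)
  qed
  have pair': "(\<Sum>W\<in>words ?n. Q W n n * (oc s W * oc t W)) \<le> (1 + e) ^ 5 * q0\<^sup>2" if st: "s < t" "t < T" for s t
  proof -
    \<comment> \<open>The symbols between the two tested occurrences: t - s - 1 whole blocks and the
      gap that follows occurrence \<open>s\<close>.\<close>
    define g where "g = (t - Suc s) * (l + n) + n"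
    define r where "r = (T - Suc t) * (l + n) + n"
    have t: "t * (l + n) = s * (l + n) + l + g"
    proof -
      have "t = s + Suc (t - Suc s)" using st by simp
      then have "t * (l + n) = (s + Suc (t - Suc s)) * (l + n)" by metis
      then show ?thesis by (simp add: g_def algebra_simps)
    qed
    have nn: "s * (l + n) + (l + (g + (l + r))) = ?n"
      using block[OF st(2)] t by (simp add: r_def)
    have g: "n \<le> g" by (simp add: g_def)
    have "(\<Sum>W\<in>words ?n. Q W n n * (oc s W * oc t W)) = (\<Sum>v\<in>words g. Q (w @ v @ w) (n + s * (l + n)) (r + n))"
      unfolding oc_def t by (rule sum_Q_two_occurrences[OF w nn])
    also have "\<dots> \<le> (1 + err g) * Q w (n + s * (l + n)) (g + length w + (r + n))
        * Q w (n + s * (l + n) + length w + g) (r + n)"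
      using n g by (intro Q_joint) simp
    also have "\<dots> \<le> (1 + e) * ((1 + e)\<^sup>2 * q0) * ((1 + e)\<^sup>2 * q0)"
      using err_antimono[OF g] err_nonneg[of g] Q_nonneg e q0 unfolding q0_def e_def
      by (intro mult_mono Q_stationary n mult_nonneg_nonneg) auto
    also have "\<dots> = (1 + e) ^ 5 * q0\<^sup>2" by (simp add: power2_eq_square eval_nat_numeral)
    finally show ?thesis .
  qed
  have pair: "(\<Sum>W\<in>words ?n. Q W n n * (oc s W * oc t W)) \<le> of_bool (s = t) + (1 + e) ^ 5 * q0\<^sup>2"
    if "s < T" "t < T" for s t
  proof (cases s t rule: linorder_cases)
    case less
    then show ?thesis using pair' that by auto
  next
    case greater
    then show ?thesis using pair'[of t s] that by (auto simp: mult_ac)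
  next
    case equal
    have "oc s W * oc t W = oc t W" for W by (simp add: oc_def equal)
    then show ?thesis unfolding equal using single(2)[OF that(2)] e q0
      by (simp only: refl of_bool_eq add_increasing2 mult_nonneg_nonneg zero_le_power2 zero_le_power add_nonneg_nonneg zero_le_one)
  qed
  have "(\<Sum>W\<in>words ?n. Q W n n * (\<Sum>t<T. oc t W)\<^sup>2) = (\<Sum>s<T. \<Sum>t<T. \<Sum>W\<in>words ?n. Q W n n * (oc s W * oc t W))"
  proof -
    have "(\<Sum>s<T. \<Sum>t<T. \<Sum>W\<in>words ?n. Q W n n * (oc s W * oc t W))
        = (\<Sum>s<T. \<Sum>W\<in>words ?n. \<Sum>t<T. Q W n n * (oc s W * oc t W))"
      by (intro sum.cong refl) (rule sum.swap)
    also have "\<dots> = (\<Sum>W\<in>words ?n. \<Sum>s<T. \<Sum>t<T. Q W n n * (oc s W * oc t W))"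
      by (rule sum.swap)
    finally show ?thesis unfolding power2_eq_square sum_product by (simp only: sum_distrib_left)
  qed
  also have "\<dots> \<le> (\<Sum>s<T. \<Sum>t<T. of_bool (s = t) + (1 + e) ^ 5 * q0\<^sup>2)"
    by (intro sum_mono pair) auto
  also have "\<dots> = real T + (real T)\<^sup>2 * ((1 + e) ^ 5 * q0\<^sup>2)"
    by (simp add: sum.distrib of_bool_def power2_eq_square algebra_simps)
  finally have A: "(\<Sum>W\<in>words ?n. Q W n n * (\<Sum>t<T. oc t W)\<^sup>2) \<le> real T + (real T)\<^sup>2 * ((1 + e) ^ 5 * q0\<^sup>2)" .
  have B: "(\<Sum>W\<in>words ?n. Q W n n * (\<Sum>t<T. oc t W)) \<ge> real T * (q0 / (1 + e)\<^sup>2)"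
  proof -
    have "real T * (q0 / (1 + e)\<^sup>2) = (\<Sum>t<T. q0 / (1 + e)\<^sup>2)" by simp
    also have "\<dots> \<le> (\<Sum>t<T. \<Sum>W\<in>words ?n. Q W n n * oc t W)"
      using single e by (intro sum_mono) (auto simp: divide_simps mult_ac)
    also have "\<dots> = (\<Sum>W\<in>words ?n. Q W n n * (\<Sum>t<T. oc t W))"
      by (subst sum.swap) (simp add: sum_distrib_left)
    finally show ?thesis .
  qed
  have sq: "((\<Sum>t<T. oc t W) / real T - q0)\<^sup>2 =
      (\<Sum>t<T. oc t W)\<^sup>2 / (real T)\<^sup>2 - 2 * q0 * ((\<Sum>t<T. oc t W) / real T) + q0\<^sup>2" for W
    by (simp add: power2_diff power_divide)
  have "(\<Sum>W\<in>words ?n. Q W n n * (freq w n T W - q0)\<^sup>2) =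
      (\<Sum>W\<in>words ?n. Q W n n * (\<Sum>t<T. oc t W)\<^sup>2) / (real T)\<^sup>2
       - 2 * q0 * ((\<Sum>W\<in>words ?n. Q W n n * (\<Sum>t<T. oc t W)) / real T) + q0\<^sup>2 * (\<Sum>W\<in>words ?n. Q W n n)"
  proof -
    have "y * (x\<^sup>2 / (real T)\<^sup>2 - 2 * q0 * (x / real T) + q0\<^sup>2)
        = (y * x\<^sup>2) / (real T)\<^sup>2 - (2 * q0 / real T) * (y * x) + q0\<^sup>2 * y" for x y :: real
      by (simp add: algebra_simps)
    then show ?thesis
      unfolding freq sq
      by (simp only: sum.distrib sum_subtractf sum_divide_distrib[symmetric] sum_distrib_left[symmetric]) simp
  qed
  also have "\<dots> \<le> (real T + (real T)\<^sup>2 * ((1 + e) ^ 5 * q0\<^sup>2)) / (real T)\<^sup>2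
       - 2 * q0 * ((real T * (q0 / (1 + e)\<^sup>2)) / real T) + q0\<^sup>2 * 1"
    unfolding sum_Q_words
    using A B q0 T by (intro add_mono diff_mono divide_right_mono mult_left_mono) auto
  also have "\<dots> = 1 / real T + (1 + e) ^ 5 * q0\<^sup>2 - 2 * q0\<^sup>2 / (1 + e)\<^sup>2 + q0\<^sup>2"
    using T by (simp add: add_divide_distrib power2_eq_square)
  finally show ?thesis .
qed

lemma m_sub_Q_sq:
  assumes w: "w \<in> words l" and n: "2 * N \<le> n"
  shows "(m w - Q w n n)\<^sup>2 \<le> K * ((1 + err n) ^ 5 - 2 / (1 + err n)\<^sup>2 + 1)"
proof -
  define e where "e = err n"
  define q0 where "q0 = Q w n n"
  define \<eta> where "\<eta> = (1 + e) ^ 5 - 2 / (1 + e)\<^sup>2 + 1"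
  have e: "e \<ge> 0" by (simp add: e_def err_nonneg)
  have "1 \<le> (1 + e) ^ 5" "1 \<le> (1 + e)\<^sup>2" using e by (auto intro!: one_le_power)
  moreover from this(2) have "2 / (1 + e)\<^sup>2 \<le> 2" by (simp add: divide_le_eq)
  ultimately have \<eta>: "\<eta> \<ge> 0" by (simp add: \<eta>_def)
  have q0: "0 \<le> q0" "q0 \<le> 1" unfolding q0_def using Q_nonneg Q_le_1[OF w] by auto
  have "q0\<^sup>2 * \<eta> \<le> 1 * \<eta>" using q0 \<eta> by (intro mult_right_mono power_le_one) auto
  then have q0\<eta>: "(1 + e) ^ 5 * q0\<^sup>2 - 2 * q0\<^sup>2 / (1 + e)\<^sup>2 + q0\<^sup>2 \<le> \<eta>"
    by (simp add: \<eta>_def algebra_simps)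
  have "(m w - q0)\<^sup>2 \<le> K * (1 / real T + \<eta>)" if T: "T > 0" for T
  proof -
    let ?W = "words (T * (l + n))"
    let ?f = "freq w n T"
    have lw: "length w = l" using w by (simp add: words_def)
    have mean: "(\<Sum>W\<in>?W. m W * ?f W) = m w"
    proof -
      have "(\<Sum>W\<in>?W. m W * of_bool (take l (drop (t * (l + n)) W) = w)) = m w" if "t < T" for t
      proof (rule sum_m_occurrence[OF w])
        have "Suc t * (l + n) \<le> T * (l + n)" using that by (intro mult_right_mono) auto
        then show "t * (l + n) + l \<le> T * (l + n)" by simp
      qed
      then have "(\<Sum>t<T. \<Sum>W\<in>?W. m W * of_bool (take l (drop (t * (l + n)) W) = w)) = T * m w"
        by simp
      then show ?thesis using T
        by (subst (asm) sum.swap) (simp add: freq_def lw sum_distrib_left[symmetric] sum_divide_distrib[symmetric] mult.commute)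
    qed
    \<comment> \<open>This is the variance of the frequency under \<open>m\<close>, whose mean is
      exactly \<open>m w\<close>. Its nonnegativity shows that the squared bias is at most the mean
      square deviation from \<open>q0\<close>.\<close>
    have "0 \<le> (\<Sum>W\<in>?W. m W * (?f W - m w)\<^sup>2)" by (intro sum_nonneg) (simp add: m_nonneg)
    also have "\<dots> = (\<Sum>W\<in>?W. m W * (?f W - q0)\<^sup>2 + 2 * (q0 - m w) * (m W * ?f W) + ((m w)\<^sup>2 - q0\<^sup>2) * m W)"
      by (intro sum.cong refl) (simp add: power2_eq_square algebra_simps)
    also have "\<dots> = (\<Sum>W\<in>?W. m W * (?f W - q0)\<^sup>2) + 2 * (q0 - m w) * m w + ((m w)\<^sup>2 - q0\<^sup>2)"
      by (simp add: sum.distrib sum_distrib_left[symmetric] mean sum_m_words)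
    finally have "(m w - q0)\<^sup>2 \<le> (\<Sum>W\<in>?W. m W * (?f W - q0)\<^sup>2)"
      by (simp add: power2_eq_square algebra_simps)
    also have "\<dots> \<le> (\<Sum>W\<in>?W. (K * Q W n n) * (?f W - q0)\<^sup>2)"
      using n by (intro sum_mono mult_right_mono m_le_Q) auto
    also have "\<dots> = K * (\<Sum>W\<in>?W. Q W n n * (?f W - q0)\<^sup>2)"
      by (simp add: sum_distrib_left mult_ac)
    also have "\<dots> \<le> K * (1 / real T + (1 + e) ^ 5 * q0\<^sup>2 - 2 * q0\<^sup>2 / (1 + e)\<^sup>2 + q0\<^sup>2)"
      unfolding q0_def e_def using n K_ge by (intro mult_left_mono second_moment_Q w T) auto
    also have "\<dots> \<le> K * (1 / real T + \<eta>)" using q0\<eta> K_ge by (intro mult_left_mono) auto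
    finally show ?thesis .
  qed
  \<comment> \<open>\<open>T\<close> is free, and letting it grow removes the diagonal term 1/T
    while the margin \<open>n\<close> stays fixed.\<close>
  then have ev: "\<forall>\<^sub>F T in sequentially. (m w - q0)\<^sup>2 \<le> K * (1 / real T + \<eta>)"
    by (auto simp: eventually_at_top_linorder intro!: exI[of _ 1])
  have "(\<lambda>T. K * (1 / real T + \<eta>)) \<longlonglongrightarrow> K * (0 + \<eta>)"
    by (intro tendsto_intros lim_1_over_n)
  from tendsto_lowerbound[OF this ev] show ?thesis by (simp add: q0_def \<eta>_def e_def)
qed

lemma Q_tendsto:
  assumes w: "w \<in> words l"
  shows "(\<lambda>n. Q w n n) \<longlonglongrightarrow> m w"
proof -
  have "(\<lambda>n. K * ((1 + err n) ^ 5 - 2 / (1 + err n)\<^sup>2 + 1)) \<longlonglongrightarrow> K * ((1 + 0) ^ 5 - 2 / (1 + 0)\<^sup>2 + 1)"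
    by (intro tendsto_intros err_tendsto) auto
  then have lim: "(\<lambda>n. K * ((1 + err n) ^ 5 - 2 / (1 + err n)\<^sup>2 + 1)) \<longlonglongrightarrow> 0" by simp
  have "(\<lambda>n. (m w - Q w n n)\<^sup>2) \<longlonglongrightarrow> 0"
  proof (rule tendsto_sandwich[OF _ _ tendsto_const lim])
    show "\<forall>\<^sub>F n in sequentially. (m w - Q w n n)\<^sup>2 \<le> K * ((1 + err n) ^ 5 - 2 / (1 + err n)\<^sup>2 + 1)"
      using m_sub_Q_sq[OF w] by (auto simp: eventually_at_top_linorder intro!: exI[of _ "2 * N"])
  qed auto
  from tendsto_real_sqrt[OF this] have "(\<lambda>n. m w - Q w n n) \<longlonglongrightarrow> 0"
    by (simp add: tendsto_rabs_zero_iff)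
  from tendsto_diff[OF tendsto_const[of "m w"] this] show ?thesis by simp
qed

text \<open>In the limit of large margins the corrections (1 + err n)^2 disappear, and only the
  error of the gap between the two words remains.\<close>

lemma m_joint:
  assumes u: "u \<in> words i" and w: "w \<in> words j" and g: "g \<ge> N"
  shows "(\<Sum>v\<in>words g. m (u @ v @ w)) \<le> (1 + err g) * m u * m w"
proof -
  have lim1: "(\<lambda>n. \<Sum>v\<in>words g. Q (u @ v @ w) n n) \<longlonglongrightarrow> (\<Sum>v\<in>words g. m (u @ v @ w))"
    using u w by (intro tendsto_sum Q_tendsto[of _ "i + g + j"]) (auto simp: words_def)
  have "(\<lambda>n. (1 + err g) * ((1 + err n)\<^sup>2 * Q u n n) * ((1 + err n)\<^sup>2 * Q w n n))
      \<longlonglongrightarrow> (1 + err g) * ((1 + 0)\<^sup>2 * m u) * ((1 + 0)\<^sup>2 * m w)"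
    by (intro tendsto_intros err_tendsto Q_tendsto[OF u] Q_tendsto[OF w])
  then have lim2: "(\<lambda>n. (1 + err g) * ((1 + err n)\<^sup>2 * Q u n n) * ((1 + err n)\<^sup>2 * Q w n n))
      \<longlonglongrightarrow> (1 + err g) * m u * m w" by simp
  show ?thesis
  proof (rule LIMSEQ_le[OF lim1 lim2], intro exI allI impI)
    fix n assume n: "n \<ge> N"
    have "(\<Sum>v\<in>words g. Q (u @ v @ w) n n)
      \<le> (1 + err g) * Q u n (g + length w + n) * Q w (n + length u + g) n"
      by (rule Q_joint[OF g])
    also have "\<dots> \<le> (1 + err g) * ((1 + err n)\<^sup>2 * Q u n n) * ((1 + err n)\<^sup>2 * Q w n n)"
      using err_nonneg Q_nonneg by (intro mult_mono Q_stationary n mult_nonneg_nonneg) auto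
    finally show "(\<Sum>v\<in>words g. Q (u @ v @ w) n n)
      \<le> (1 + err g) * ((1 + err n)\<^sup>2 * Q u n n) * ((1 + err n)\<^sup>2 * Q w n n)" .
  qed
qed

end

text \<open>Converts decay per block of length \<open>p\<close> into decay per symbol; 1 / a pays
  for the incomplete block. It serves p = G + 1 in the decay of words and p = 2 when a protrusion is
  halved.\<close>

lemma power_div_le_geometric:
  fixes a :: real
  assumes a: "0 < a" "a < 1" and p: "p > 0"
  obtains \<rho> where "0 < \<rho>" "\<rho> < 1" "\<And>n. a ^ (n div p) \<le> \<rho> ^ n / a"
proof
  define \<rho> where "\<rho> = root p a"
  show \<rho>: "0 < \<rho>" "\<rho> < 1" using a p by (auto simp: \<rho>_def real_root_lt_1_iff)
  fix n
  have ap: "\<rho> ^ p = a" using a p by (simp add: \<rho>_def)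
  have "a * a ^ (n div p) = \<rho> ^ (p + p * (n div p))" by (simp add: power_add power_mult ap)
  also have "\<dots> \<le> \<rho> ^ n"
  proof (rule power_decreasing)
    have "n mod p < p" using p by simp
    moreover have "p * (n div p) + n mod p = n" by simp
    ultimately show "n \<le> p + p * (n div p)" by linarith
  qed (use \<rho> in auto)
  finally show "a ^ (n div p) \<le> \<rho> ^ n / a" using a by (simp add: field_simps)
qed

section \<open>Exponential decay and mixing of word probabilities\<close>

context gibbs_words
begin

lemma weight_append: "weight (u @ v) x = weight u (prepend v x) + weight v x"
proof -
  have split: "(\<Sum>k<a + n. g k) = (\<Sum>k<a. g k) + (\<Sum>k<n. g (k + a))" for a n and g :: "nat \<Rightarrow> real"
    by (induction n) (simp_all add: add.commute)
  have "weight (u @ v) x = (\<Sum>k<length u. \<phi> (\<lambda>j. prepend u (prepend v x) (j + k)))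
      + (\<Sum>k<length v. \<phi> (\<lambda>j. prepend u (prepend v x) (j + k + length u)))"
    by (simp add: weight_def split add.assoc)
  then show ?thesis by (simp add: weight_def)
qed

lemma m_append_le: "m (u @ v) \<le> c ^ 3 * m u * m v"
proof (cases "m (u @ v) = 0")
  case True
  then show ?thesis using c_ge m_nonneg by simp
next
  case False
  then obtain x where x: "prepend (u @ v) x \<in> X" using m_supp[of "u @ v"] by blast
  then have X: "prepend u (prepend v x) \<in> X" "prepend v x \<in> X" "x \<in> X"
    using prepend_admissibleD by (auto, fastforce+)
  have "m (u @ v) \<le> c * exp (weight (u @ v) x)" by (rule m_le[OF X(3) x])
  also have "\<dots> = c * (exp (weight u (prepend v x)) * exp (weight v x))"
    by (simp add: weight_append exp_add)
  also have "\<dots> \<le> c * ((c * m u) * (c * m v))"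
    using c_ge m_nonneg by (intro mult_left_mono mult_mono m_ge X) auto
  finally show ?thesis by (simp add: power3_eq_cube mult_ac)
qed

lemma m_joint_any: "(\<Sum>v\<in>words g. m (u @ v @ w)) \<le> c ^ 3 * m u * m w"
proof -
  have "(\<Sum>v\<in>words g. m (u @ v @ w)) \<le> (\<Sum>v\<in>words g. c ^ 3 * m u * m (v @ w))"
    by (intro sum_mono m_append_le)
  also have "\<dots> = c ^ 3 * m u * m w" by (simp add: sum_distrib_left[symmetric] sum_m_left)
  finally show ?thesis .
qed

lemma m_letter_pos: "i \<in> I \<Longrightarrow> m [i] > 0"
proof -
  assume i: "i \<in> I"
  from mixing[OF i base] obtain w where w: "w \<noteq> []" "hd w = i" "prepend w base \<in> X" by auto
  then have "0 < m w" using m_ge[OF base w(3)] c_ge exp_gt_zero[of "weight w base"]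
    by (smt (verit) mult_nonneg_nonpos)
  also have "w = [i] @ tl w" using w by (cases w) auto
  also have "m \<dots> \<le> c ^ 3 * m [i] * m (tl w)" by (rule m_append_le)
  finally show ?thesis using m_nonneg[of "[i]"] by (cases "m [i] = 0") auto
qed

text \<open>At least two letters have positive probability, so the most likely one has probability A
  < 1. Behind a gap long enough that (1 + err G) A < 1, each further letter costs a fixed
  factor.\<close>

lemma m_decay_step:
  assumes I2: "card I \<ge> 2"
  obtains a G where "0 < a" "a < 1"
    "\<And>u v i. set u \<subseteq> I \<Longrightarrow> v \<in> words G \<Longrightarrow> i \<in> I \<Longrightarrow> m (u @ v @ [i]) \<le> a * m u"
proof -
  have I: "I \<noteq> {}" using I2 by auto
  define A where "A = Max ((\<lambda>i. m [i]) ` I)"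
  have A: "m [i] \<le> A" if "i \<in> I" for i using that finite_I by (simp add: A_def)
  have "A \<in> (\<lambda>i. m [i]) ` I" unfolding A_def using finite_I I by (intro Max_in) auto
  then obtain i where i: "i \<in> I" "A = m [i]" by auto
  have "card (I - {i}) > 0" using I2 i(1) finite_I by (simp add: card_Diff_singleton)
  then have "I - {i} \<noteq> {}" by (metis card.empty less_numeral_extra(3))
  then obtain j where j: "j \<in> I" "j \<noteq> i" by auto
  have "m [i] + m [j] = (\<Sum>k\<in>{i, j}. m [k])" using j by auto
  also have "\<dots> \<le> (\<Sum>k\<in>I. m [k])" using finite_I i j m_nonneg by (intro sum_mono2) auto
  also have "\<dots> = 1" using m_Cons[of "[]"] by (simp add: m_Nil)
  finally have A1: "A < 1" using m_letter_pos[OF j(1)] i by simp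
  have A0: "A > 0" using m_letter_pos[OF i(1)] i by simp
  have "(\<lambda>n. (1 + err n) * A) \<longlonglongrightarrow> (1 + 0) * A" by (intro tendsto_intros err_tendsto)
  then have "\<forall>\<^sub>F n in sequentially. (1 + err n) * A < 1" using A1 by (intro order_tendstoD(2)[of _ "(1 + 0) * A"]) auto
  moreover have "\<forall>\<^sub>F n in sequentially. n \<ge> N" by (rule eventually_ge_at_top)
  ultimately have "\<forall>\<^sub>F n in sequentially. (1 + err n) * A < 1 \<and> n \<ge> N" by (rule eventually_conj)
  then obtain G where G: "(1 + err G) * A < 1" "G \<ge> N" using eventually_happens by fastforce
  show ?thesis
  proof (rule that[of "(1 + err G) * A" G])
    show "0 < (1 + err G) * A" using A0 err_nonneg[of G] by simp
    fix u v i assume u: "set u \<subseteq> I" and v: "v \<in> words G" and i: "i \<in> I"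
    have "m (u @ v @ [i]) \<le> (\<Sum>v\<in>words G. m (u @ v @ [i]))"
      by (rule member_le_sum[OF v]) (auto simp: m_nonneg)
    also have "\<dots> \<le> (1 + err G) * m u * m [i]"
      using u i by (intro m_joint[of _ "length u" _ 1] G) (auto simp: words_def)
    also have "\<dots> \<le> (1 + err G) * m u * A"
      using A[OF i] err_nonneg[of G] m_nonneg by (intro mult_left_mono) auto
    finally show "m (u @ v @ [i]) \<le> (1 + err G) * A * m u" by (simp add: mult_ac)
  qed (use G in auto)
qed

lemma m_decay:
  assumes I2: "card I \<ge> 2"
  obtains C \<rho> where "0 < \<rho>" "\<rho> < 1" "C \<ge> 0" "\<And>w. set w \<subseteq> I \<Longrightarrow> m w \<le> C * \<rho> ^ length w"
proof -
  obtain a G where a: "0 < a" "a < 1"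
    and step: "\<And>u v i. set u \<subseteq> I \<Longrightarrow> v \<in> words G \<Longrightarrow> i \<in> I \<Longrightarrow> m (u @ v @ [i]) \<le> a * m u"
    using m_decay_step[OF I2] by blast
  have iter: "m w \<le> a ^ k" if "set w \<subseteq> I" "k * Suc G \<le> length w" for w k
    using that
  proof (induction k arbitrary: w)
    case 0
    then show ?case using m_le_1[of w "length w"] by (simp add: words_def)
  next
    case (Suc k)
    define l where "l = length w - Suc G"
    have l: "length w = l + Suc G" using Suc.prems by (simp add: l_def)
    define v where "v = take G (drop l w)"
    have len: "length (drop (l + G) w) = Suc 0" using l by simp
    then obtain i where i: "drop (l + G) w = [i]" unfolding length_Suc_conv by auto
    have "w = take l w @ drop l w" by simp
    also have "drop l w = v @ drop G (drop l w)"
      unfolding v_def by (rule append_take_drop_id[symmetric])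
    also have "drop G (drop l w) = [i]" using i by (simp add: add.commute)
    finally have w: "w = take l w @ v @ [i]" .
    have "set v \<subseteq> set w" unfolding v_def by (meson set_drop_subset set_take_subset subset_trans)
    moreover have "length v = G" using l by (simp add: v_def)
    moreover have "i \<in> set w" using i set_drop_subset[of "l + G" w] by simp
    ultimately have sets: "set (take l w) \<subseteq> I" "v \<in> words G" "i \<in> I"
      using Suc.prems(1) set_take_subset[of l w] by (auto simp: words_def)
    have "m w = m (take l w @ v @ [i])" by (rule arg_cong[OF w])
    also have "\<dots> \<le> a * m (take l w)" by (rule step[OF sets])
    also have "\<dots> \<le> a * a ^ k"
      using sets(1) Suc.prems(2) l a by (intro mult_left_mono Suc.IH) auto
    finally show ?case by simp
  qed
  obtain \<rho> where \<rho>: "0 < \<rho>" "\<rho> < 1" "\<And>n. a ^ (n div Suc G) \<le> \<rho> ^ n / a"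
    using power_div_le_geometric[OF a, of "Suc G"] by blast
  show ?thesis
  proof (rule that[OF \<rho>(1,2), of "1 / a"])
    fix w assume "set w \<subseteq> I"
    then have "m w \<le> a ^ (length w div Suc G)" by (intro iter div_times_less_eq_dividend)
    then show "m w \<le> 1 / a * \<rho> ^ length w" using \<rho>(3)[of "length w"] by simp
  qed (use a in simp)
qed

theorem word_mixing:
  assumes I2: "card I \<ge> 2"
  obtains C \<rho> where "0 < \<rho>" "\<rho> < 1" "C \<ge> 0" "\<And>w. set w \<subseteq> I \<Longrightarrow> m w \<le> C * \<rho> ^ length w"
    "\<And>u w g. set u \<subseteq> I \<Longrightarrow> set w \<subseteq> I \<Longrightarrow> (\<Sum>v\<in>words g. m (u @ v @ w)) \<le> (1 + C * \<rho> ^ g) * (m u * m w)"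
proof -
  obtain C1 \<rho>1 where 1: "0 < \<rho>1" "\<rho>1 < 1" "C1 \<ge> 0" "\<And>w. set w \<subseteq> I \<Longrightarrow> m w \<le> C1 * \<rho>1 ^ length w"
    using m_decay[OF I2] by blast
  define \<rho> where "\<rho> = max \<rho>1 rate"
  \<comment> \<open>The last summand covers gaps g < N, where only the constant c^3 of
    \<open>m_joint_any\<close> is available: there c^3 \<le> C \<rho>^g.\<close>
  define C where "C = C1 + Crate + c ^ 3 / rate ^ N"
  have \<rho>: "0 < \<rho>" "\<rho> < 1" "\<rho>1 \<le> \<rho>" "rate \<le> \<rho>" using 1 rate by (auto simp: \<rho>_def)
  have C: "C \<ge> 0" "C1 \<le> C" "Crate \<le> C" "c ^ 3 / rate ^ N \<le> C"
    using 1 Crate_nonneg rate c_ge by (auto simp: C_def)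
  show ?thesis
  proof (rule that[OF \<rho>(1,2) C(1)])
    fix w assume "set w \<subseteq> I"
    then have "m w \<le> C1 * \<rho>1 ^ length w" by (rule 1)
    also have "\<dots> \<le> C * \<rho> ^ length w" using C \<rho> 1 by (intro mult_mono power_mono) auto
    finally show "m w \<le> C * \<rho> ^ length w" .
  next
    fix u w g assume uw: "set u \<subseteq> I" "set w \<subseteq> I"
    have nn: "0 \<le> m u * m w" using m_nonneg by simp
    show "(\<Sum>v\<in>words g. m (u @ v @ w)) \<le> (1 + C * \<rho> ^ g) * (m u * m w)"
    proof (cases "g \<ge> N")
      case True
      have "(\<Sum>v\<in>words g. m (u @ v @ w)) \<le> (1 + err g) * m u * m w"
        using uw True by (intro m_joint[of _ "length u" _ "length w"]) (auto simp: words_def)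
      also have "\<dots> = (1 + Crate * rate ^ g) * (m u * m w)" by (simp add: err_def)
      also have "\<dots> \<le> (1 + C * \<rho> ^ g) * (m u * m w)"
        using C \<rho> rate nn by (intro mult_right_mono add_left_mono mult_mono power_mono) auto
      finally show ?thesis .
    next
      case False
      have "c ^ 3 = c ^ 3 / rate ^ N * rate ^ N" using rate by simp
      also have "\<dots> \<le> C * \<rho> ^ g"
      proof (intro mult_mono C)
        have "rate ^ N \<le> rate ^ g" using False rate by (intro power_decreasing) auto
        also have "\<dots> \<le> \<rho> ^ g" using \<rho> rate by (intro power_mono) auto
        finally show "rate ^ N \<le> \<rho> ^ g" .
      qed (use rate in auto)
      finally have le: "c ^ 3 \<le> 1 + C * \<rho> ^ g" by simp
      have "(\<Sum>v\<in>words g. m (u @ v @ w)) \<le> c ^ 3 * (m u * m w)"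
        using m_joint_any[where g = g and u = u and w = w] by (simp add: mult.assoc)
      also have "\<dots> \<le> (1 + C * \<rho> ^ g) * (m u * m w)" by (rule mult_right_mono[OF le nn])
      finally show ?thesis .
    qed
  qed
qed

end

section \<open>A quantitative Borel--Cantelli lemma\<close>

text \<open>Induction over the levels: \<open>u\<close> differs from 2 (u div 2) by at most one step
  of the finest level, and the even indices pose the same problem with one level fewer. Each step is
  bounded by the root of the whole sum of squares of its level, so the bound is uniform in
  \<open>u\<close>.\<close>

lemma dyadic_chaining_abs:
  fixes x :: "nat \<Rightarrow> real"
  assumes "u \<le> 2 ^ r"
  shows "\<bar>x u - x 0\<bar> \<le> (\<Sum>j\<le>r. sqrt (\<Sum>i<2 ^ (r - j). (x (Suc i * 2 ^ j) - x (i * 2 ^ j))\<^sup>2))"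
  using assms
proof (induction r arbitrary: x u)
  case 0
  then have "u = 0 \<or> u = 1" by auto
  then show ?case by auto
next
  case (Suc r)
  define v where "v = u div 2"
  define y where "y = (\<lambda>i. x (2 * i))"
  have v: "v \<le> 2 ^ r" using Suc.prems by (simp add: v_def)
  let ?S = "\<lambda>j. \<Sum>i<2 ^ (Suc r - j). (x (Suc i * 2 ^ j) - x (i * 2 ^ j))\<^sup>2"
  have "\<bar>x u - x (2 * v)\<bar> \<le> sqrt (?S 0)"
  proof (cases "even u")
    case True
    then have "2 * v = u" by (simp add: v_def)
    then show ?thesis by (simp add: sum_nonneg)
  next
    case False
    then have u: "u = Suc (2 * v)" by (simp add: v_def)
    moreover have "2 * v < 2 ^ Suc r" using Suc.prems u by simp
    ultimately have "(x u - x (2 * v))\<^sup>2 \<le> ?S 0"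
      using member_le_sum[of "2 * v" "{..<2 ^ Suc r}" "\<lambda>i. (x (Suc i) - x i)\<^sup>2"] by simp
    then show ?thesis by (intro real_le_rsqrt) simp
  qed
  moreover have "\<bar>x (2 * v) - x 0\<bar> \<le> (\<Sum>j\<le>r. sqrt (?S (Suc j)))"
    using Suc.IH[OF v, of y] by (simp add: y_def mult_ac)
  ultimately show ?case
    unfolding sum.atMost_Suc_shift by linarith
qed

text \<open>Cauchy-Schwarz over the r + 1 levels. In the squared error this costs one power of the
  logarithm; a second comes from the number of levels in the expectation and 1 + 2 \<epsilon> from
  summability, which explains the exponent 3/2 + \<epsilon>.\<close>

lemma dyadic_chaining:
  fixes x :: "nat \<Rightarrow> real"
  assumes "u \<le> 2 ^ r"
  shows "(x u - x 0)\<^sup>2 \<le> (\<Sum>j\<le>r. \<Sum>i<2 ^ (r - j). (x (Suc i * 2 ^ j) - x (i * 2 ^ j))\<^sup>2) * real (Suc r)"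
proof -
  let ?S = "\<lambda>j. \<Sum>i<2 ^ (r - j). (x (Suc i * 2 ^ j) - x (i * 2 ^ j))\<^sup>2"
  have "(x u - x 0)\<^sup>2 \<le> (\<Sum>j\<le>r. sqrt (?S j))\<^sup>2"
    using dyadic_chaining_abs[OF assms, of x] by (intro abs_le_square_iff[THEN iffD1]) linarith
  also have "\<dots> \<le> (\<Sum>j\<le>r. (sqrt (?S j))\<^sup>2) * real (card {..r})"
    by (intro sum_squared_le_sum_of_squares)
  also have "(\<Sum>j\<le>r. (sqrt (?S j))\<^sup>2) = (\<Sum>j\<le>r. ?S j)"
    by (intro sum.cong refl real_sqrt_pow2 sum_nonneg) auto
  finally show ?thesis by simp
qed

text \<open>The number of levels is logarithmic in \<Phi>, so the squared bound is of order \<Phi>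
  with exponent 3 + 2 \<epsilon> on the logarithm. \<Phi> \<ge> e makes ln \<Phi> \<ge> 1, which
  absorbs the additive constants into the factor 5.\<close>

lemma chaining_scale_bound:
  fixes \<Phi> \<epsilon> :: real
  assumes \<Phi>: "\<Phi> \<ge> exp 1" and \<epsilon>: "\<epsilon> > 0" and r: "2 ^ r \<le> 4 * \<Phi>"
    and F: "F\<^sup>2 \<le> 2 ^ r * (real r + 1) powr (2 + 2 * \<epsilon>) * (real r + 1)"
  shows "\<bar>F\<bar> \<le> 2 * 5 powr (3/2 + \<epsilon>) * (\<Phi> powr (1/2) * ln \<Phi> powr (3/2 + \<epsilon>))"
proof -
  have \<Phi>pos: "\<Phi> > 0" and ln\<Phi>: "ln \<Phi> \<ge> 1"
    using \<Phi> exp_gt_zero[of 1] by (linarith, simp add: ln_ge_iff less_le_trans[OF exp_gt_zero])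
  have ln2: "1 / 2 \<le> ln (2 :: real)" using exp_half_le2 by (subst ln_ge_iff) auto
  have ln2': "ln (2::real) \<le> 1" using ln_le_minus_one[of "2::real"] by simp
  have "real r * ln 2 = ln (2 ^ r)" by (simp add: ln_realpow)
  also have "\<dots> \<le> ln (4 * \<Phi>)" using r \<Phi>pos by (simp del: ln_realpow)
  also have "\<dots> = 2 * ln 2 + ln \<Phi>" using \<Phi>pos ln_realpow[of 2 2] by (simp add: ln_mult)
  finally have "real r * ln 2 \<le> 2 * ln 2 + ln \<Phi> * (2 * ln 2)"
    using ln2 ln\<Phi> mult_left_mono[of 1 "2 * ln 2" "ln \<Phi>"] by linarith
  then have "real r * ln 2 \<le> (2 + 2 * ln \<Phi>) * ln 2" by (simp add: algebra_simps)
  then have "real r \<le> 2 + 2 * ln \<Phi>" using ln2 by simp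
  then have r5: "real r + 1 \<le> 5 * ln \<Phi>" using ln\<Phi> by simp
  have "(real r + 1) powr (2 + 2 * \<epsilon>) * (real r + 1) = (real r + 1) powr (2 + 2 * \<epsilon> + 1)"
    using powr_add[of "real r + 1" "2 + 2 * \<epsilon>" 1] by simp
  also have "\<dots> = ((real r + 1) powr (3/2 + \<epsilon>))\<^sup>2"
    by (simp add: powr_powr powr_realpow[symmetric] algebra_simps)
  finally have eq: "(real r + 1) powr (2 + 2 * \<epsilon>) * (real r + 1) = ((real r + 1) powr (3/2 + \<epsilon>))\<^sup>2" .
  have "F\<^sup>2 \<le> 2 ^ r * ((real r + 1) powr (3/2 + \<epsilon>))\<^sup>2"
    using F by (simp only: mult.assoc eq)
  also have "\<dots> \<le> (4 * \<Phi>) * ((5 * ln \<Phi>) powr (3/2 + \<epsilon>))\<^sup>2"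
    using r r5 \<epsilon> \<Phi>pos by (intro mult_mono power_mono powr_mono2) auto
  also have "\<dots> = (2 * sqrt \<Phi> * (5 * ln \<Phi>) powr (3/2 + \<epsilon>))\<^sup>2"
    using \<Phi>pos by (simp add: power_mult_distrib)
  finally have "\<bar>F\<bar> \<le> \<bar>2 * sqrt \<Phi> * (5 * ln \<Phi>) powr (3/2 + \<epsilon>)\<bar>"
    by (simp only: abs_le_square_iff)
  also have "\<dots> = 2 * sqrt \<Phi> * (5 * ln \<Phi>) powr (3/2 + \<epsilon>)"
    using \<Phi>pos by (intro abs_of_nonneg mult_nonneg_nonneg) auto
  also have "\<dots> = 2 * 5 powr (3/2 + \<epsilon>) * (\<Phi> powr (1/2) * ln \<Phi> powr (3/2 + \<epsilon>))"
    unfolding powr_mult[of 5 "ln \<Phi>"] powr_half_sqrt[OF less_imp_le[OF \<Phi>pos]] by (simp only: mult_ac)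
  finally show ?thesis .
qed

context prob_space
begin

text \<open>Time is measured by the partial sums of \<open>p\<close>, so the variance over a dyadic
  block is controlled by its length however small the single probabilities are. Borel-Cantelli
  bounds the sums of squares for all large r, chaining bounds the deviation at all sampled times,
  and between sampled times monotonicity of both sums suffices.\<close>

theorem quantitative_borel_cantelli:
  fixes f :: "nat \<Rightarrow> 'a \<Rightarrow> real" and p :: "nat \<Rightarrow> real" and C \<epsilon> :: real
  assumes [measurable]: "\<And>k. f k \<in> borel_measurable M"
    and f01: "\<And>k \<omega>. 0 \<le> f k \<omega> \<and> f k \<omega> \<le> 1" and p01: "\<And>k. 0 \<le> p k \<and> p k \<le> 1"
    and var: "\<And>m n. expectation (\<lambda>\<omega>. (\<Sum>k\<in>{m<..n}. f k \<omega> - p k)\<^sup>2) \<le> C * (\<Sum>k\<in>{m<..n}. p k)"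
    and div: "filterlim (\<lambda>N. \<Sum>k=1..N. p k) at_top sequentially"
    and C: "C \<ge> 0" and \<epsilon>: "\<epsilon> > 0"
  shows "AE \<omega> in M. (\<lambda>N. (\<Sum>k=1..N. f k \<omega>) - (\<Sum>k=1..N. p k)) \<in>
    O(\<lambda>N. (\<Sum>k=1..N. p k) powr (1/2) * ln (\<Sum>k=1..N. p k) powr (3/2 + \<epsilon>))"
proof -
  define \<Phi> where "\<Phi> N = (\<Sum>k=1..N. p k)" for N
  define F where "F N \<omega> = (\<Sum>k=1..N. f k \<omega> - p k)" for N \<omega>
  \<comment> \<open>The first index at which \<Phi> reaches \<open>u\<close>. As every
    \<open>p k\<close> is at most 1, \<Phi> exceeds \<open>u\<close> there by at most 1.\<close>
  define \<tau> where "\<tau> u = (LEAST n. real u \<le> \<Phi> n)" for u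
  have divE: "\<exists>n. x \<le> \<Phi> n" for x
    using div unfolding \<Phi>_def[symmetric] filterlim_at_top by (meson eventually_at_top_linorder order_refl)
  have \<tau>1: "real u \<le> \<Phi> (\<tau> u)" for u
    unfolding \<tau>_def by (rule LeastI_ex[OF divE])
  have \<tau>_le: "\<tau> u \<le> n" if "real u \<le> \<Phi> n" for u n
    unfolding \<tau>_def using that by (rule Least_le)
  have \<Phi>_mono: "\<Phi> m \<le> \<Phi> n" if "m \<le> n" for m n
    unfolding \<Phi>_def using that p01 by (intro sum_mono2) auto
  have \<tau>2: "\<Phi> (\<tau> u) \<le> real u + 1" for u
  proof (cases "\<tau> u")
    case 0
    then show ?thesis by (simp add: \<Phi>_def)
  next
    case (Suc n)
    then have "\<Phi> n < real u" using \<tau>_le[of u n] by linarith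
    moreover have "\<Phi> (Suc n) \<le> \<Phi> n + 1" using p01 by (simp add: \<Phi>_def)
    ultimately show ?thesis using Suc by simp
  qed
  have \<tau>_mono: "\<tau> u \<le> \<tau> v" if "u \<le> v" for u v
    using \<tau>1[of v] that by (intro \<tau>_le) simp
  have \<tau>0: "\<tau> 0 = 0" using \<tau>_le[of 0 0] by (simp add: \<Phi>_def)
  have diff: "(\<Sum>k=1..n. g k) - (\<Sum>k=1..m. g k) = (\<Sum>k\<in>{m<..n}. g k)" if "m \<le> n" for m n and g :: "nat \<Rightarrow> real"
  proof -
    have "{1..n} = {1..m} \<union> {m<..n}" using that by auto
    then show ?thesis by (simp add: sum.union_disjoint ivl_disj_int)
  qed
  define Z where "Z r \<omega> = (\<Sum>j\<le>r. \<Sum>i<2 ^ (r - j).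
      (F (\<tau> (Suc i * 2 ^ j)) \<omega> - F (\<tau> (i * 2 ^ j)) \<omega>)\<^sup>2)" for r \<omega>
  have Fm [measurable]: "F N \<in> borel_measurable M" for N unfolding F_def by measurable
  have Zm [measurable]: "Z r \<in> borel_measurable M" for r unfolding Z_def by measurable
  \<comment> \<open>\<open>Z r\<close> collects the squared increments of \<open>F\<close> over all dyadic blocks of the time scale \<open>\<Phi>\<close>.\<close>
  have Fb: "\<bar>F N \<omega>\<bar> \<le> real N" for N \<omega>
  proof -
    have "\<bar>F N \<omega>\<bar> \<le> (\<Sum>k=1..N. 1)"
      unfolding F_def by (intro order.trans[OF sum_abs] sum_mono)
        (use f01 p01 in \<open>smt (verit)\<close>)
    then show ?thesis by simp
  qed
  have int: "integrable M (\<lambda>\<omega>. (F m \<omega> - F n \<omega>)\<^sup>2)" for m n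
  proof (rule integrable_const_bound[where B = "(real m + real n)\<^sup>2"])
    have "\<bar>F m \<omega> - F n \<omega>\<bar> \<le> real m + real n" for \<omega>
      using Fb[of m \<omega>] Fb[of n \<omega>] by linarith
    then show "AE \<omega> in M. norm ((F m \<omega> - F n \<omega>)\<^sup>2) \<le> (real m + real n)\<^sup>2"
      by (intro AE_I2) (simp add: abs_le_square_iff[symmetric])
  qed measurable
  have Zint: "integrable M (Z r)" for r
    unfolding Z_def by (intro Bochner_Integration.integrable_sum int)
  have EZ: "expectation (Z r) \<le> 2 * C * (2 ^ r * real (Suc r))" for r
  proof -
    have "expectation (Z r) = (\<Sum>j\<le>r. \<Sum>i<2 ^ (r - j).
        expectation (\<lambda>\<omega>. (F (\<tau> (Suc i * 2 ^ j)) \<omega> - F (\<tau> (i * 2 ^ j)) \<omega>)\<^sup>2))"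
      unfolding Z_def by (simp add: Bochner_Integration.integral_sum Bochner_Integration.integrable_sum int)
    also have "\<dots> \<le> (\<Sum>j\<le>r. \<Sum>i<2 ^ (r - j). C * (\<Phi> (\<tau> (Suc i * 2 ^ j)) - \<Phi> (\<tau> (i * 2 ^ j))))"
    proof (intro sum_mono)
      fix i j
      have le: "\<tau> (i * 2 ^ j) \<le> \<tau> (Suc i * 2 ^ j)" by (intro \<tau>_mono) simp
      show "expectation (\<lambda>\<omega>. (F (\<tau> (Suc i * 2 ^ j)) \<omega> - F (\<tau> (i * 2 ^ j)) \<omega>)\<^sup>2)
          \<le> C * (\<Phi> (\<tau> (Suc i * 2 ^ j)) - \<Phi> (\<tau> (i * 2 ^ j)))"
        unfolding F_def \<Phi>_def diff[OF le] by (rule var)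
    qed
    also have "\<dots> = (\<Sum>j\<le>r. C * \<Phi> (\<tau> (2 ^ r)))"
    proof (intro sum.cong refl)
      fix j assume j: "j \<in> {..r}"
      have "(\<Sum>i<n. C * (\<Phi> (\<tau> (Suc i * 2 ^ j)) - \<Phi> (\<tau> (i * 2 ^ j)))) = C * (\<Phi> (\<tau> (n * 2 ^ j)) - \<Phi> (\<tau> 0))" for n
        by (induction n) (simp_all add: algebra_simps)
      moreover have "2 ^ (r - j) * 2 ^ j = (2::nat) ^ r" using j by (simp flip: power_add)
      ultimately show "(\<Sum>i<2 ^ (r - j). C * (\<Phi> (\<tau> (Suc i * 2 ^ j)) - \<Phi> (\<tau> (i * 2 ^ j)))) = C * \<Phi> (\<tau> (2 ^ r))"
        using \<tau>0 by (simp add: \<Phi>_def)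
    qed
    also have "\<dots> \<le> (\<Sum>j\<le>r. C * (2 * 2 ^ r))"
    proof (intro sum_mono mult_left_mono C)
      have "(1::real) \<le> 2 ^ r" by simp
      moreover have "\<Phi> (\<tau> (2 ^ r)) \<le> 2 ^ r + 1" using \<tau>2[of "2 ^ r"] by simp
      ultimately show "\<Phi> (\<tau> (2 ^ r)) \<le> 2 * 2 ^ r" by linarith
    qed
    finally show ?thesis by (simp add: mult_ac)
  qed
  \<comment> \<open>The excess over the bound for the expectation of \<open>Z r\<close> is (r +
    1)^(1 + 2 \<epsilon>), whose reciprocals are summable.\<close>
  define a where "a r = 2 ^ r * (real r + 1) powr (2 + 2 * \<epsilon>)" for r :: nat
  have a_pos: "a r > 0" for r by (simp add: a_def)
  have Z_nonneg: "Z r \<omega> \<ge> 0" for r \<omega> unfolding Z_def by (intro sum_nonneg) auto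
  have prob_le: "prob {\<omega>\<in>space M. Z r \<omega> \<ge> a r} \<le> 2 * C * (real (Suc r) powr (- 1 - 2 * \<epsilon>))" for r
  proof -
    have "prob {\<omega>\<in>space M. Z r \<omega> \<ge> a r} \<le> expectation (Z r) / a r"
      using Z_nonneg a_pos by (intro integral_Markov_inequality_measure[where A = "{}", OF Zint]) auto
    also have "\<dots> \<le> (2 * C * (2 ^ r * real (Suc r))) / a r"
      using EZ a_pos by (intro divide_right_mono) (auto intro: less_imp_le)
    also have "\<dots> = 2 * C * (real (Suc r) / (real (Suc r) powr (2 + 2 * \<epsilon>)))"
      by (simp add: a_def add.commute)
    also have "real (Suc r) / (real (Suc r) powr (2 + 2 * \<epsilon>)) = real (Suc r) powr (1 - (2 + 2 * \<epsilon>))"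
      by (subst powr_diff) simp
    finally show ?thesis by simp
  qed
  have "summable (\<lambda>r. real (Suc r) powr (- 1 - 2 * \<epsilon>))"
    using summable_real_powr_iff[of "- 1 - 2 * \<epsilon>"] \<epsilon>
    by (subst summable_Suc_iff[of "\<lambda>n. real n powr (- 1 - 2 * \<epsilon>)"]) simp
  then have "summable (\<lambda>r. prob {\<omega>\<in>space M. Z r \<omega> \<ge> a r})"
    by (rule summable_comparison_test'[OF summable_mult[of _ "2 * C"], where N = 0]) (use prob_le in auto)
  then have "AE \<omega> in M. eventually (\<lambda>r. \<omega> \<in> space M - {\<omega>\<in>space M. Z r \<omega> \<ge> a r}) sequentially"
    by (intro borel_cantelli_AE1) (auto simp: emeasure_eq_measure)
  then show ?thesis
  proof eventually_elim
    case (elim \<omega>)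
    then obtain r0 where r0: "\<And>r. r \<ge> r0 \<Longrightarrow> Z r \<omega> < a r"
      by (auto simp: eventually_at_top_linorder not_le)
    let ?b = "\<lambda>N. \<Phi> N powr (1/2) * ln (\<Phi> N) powr (3/2 + \<epsilon>)"
    have main: "\<bar>F N \<omega>\<bar> \<le> (2 + 2 * 5 powr (3/2 + \<epsilon>)) * ?b N" if N: "\<Phi> N \<ge> exp 1 + 2 ^ r0" for N
    proof -
      have \<Phi>1: "\<Phi> N \<ge> exp 1" "\<Phi> N \<ge> 2 ^ r0" using N by (auto intro: order.trans[rotated])
      have "\<Phi> N \<ge> 1" using \<Phi>1(1) exp_ge_add_one_self[of "1::real"] by linarith
      define u where "u = nat \<lfloor>\<Phi> N\<rfloor>"
      have u: "real u \<le> \<Phi> N" "\<Phi> N < real u + 1" using \<open>\<Phi> N \<ge> 1\<close> unfolding u_def by linarith+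
      have u1: "u \<ge> 1" using u \<open>\<Phi> N \<ge> 1\<close> by linarith
      \<comment> \<open>\<open>r\<close> must cover u + 1, since both neighbours of \<open>N\<close>
        on the time scale are used; minimality keeps 2^r at most 4 \<Phi> N.\<close>
      obtain r where r: "Suc u \<le> 2 ^ r" "2 ^ r \<le> 2 * Suc u"
      proof -
        define r where "r = (LEAST r. Suc u \<le> 2 ^ r)"
        have ex: "Suc u \<le> 2 ^ Suc u" using less_exp[of "Suc u"] by (rule less_imp_le)
        have 1: "Suc u \<le> 2 ^ r" unfolding r_def by (rule LeastI[of "\<lambda>r. Suc u \<le> 2 ^ r", OF ex])
        have "2 ^ r \<le> 2 * Suc u"
        proof (cases r)
          case (Suc s)
          then have "\<not> Suc u \<le> 2 ^ s" using not_less_Least[of s "\<lambda>r. Suc u \<le> 2 ^ r"] by (simp add: r_def)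
          then show ?thesis using Suc by simp
        qed simp
        then show ?thesis using 1 that by blast
      qed
      have "(2::real) ^ r0 < 2 ^ r"
      proof -
        have "real (Suc u) \<le> real (2 ^ r)" using r(1) by (rule of_nat_mono)
        then have "real u + 1 \<le> 2 ^ r" by simp
        then show ?thesis using \<Phi>1(2) u(2) by linarith
      qed
      then have rr0: "r \<ge> r0" by simp
      have r4: "2 ^ r \<le> 4 * \<Phi> N"
      proof -
        have "real (2 ^ r) \<le> real (2 * Suc u)" using r(2) by (rule of_nat_mono)
        then show ?thesis using u u1 by simp
      qed
      have ch: "\<bar>F (\<tau> v) \<omega>\<bar> \<le> 2 * 5 powr (3/2 + \<epsilon>) * ?b N" if v: "v \<le> 2 ^ r" for v
      proof (rule chaining_scale_bound[OF \<Phi>1(1) \<epsilon> r4])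
        have "(F (\<tau> v) \<omega>)\<^sup>2 \<le> Z r \<omega> * real (Suc r)"
          using dyadic_chaining[OF v, of "\<lambda>u. F (\<tau> u) \<omega>"] \<tau>0 by (simp add: Z_def F_def)
        also have "\<dots> \<le> a r * real (Suc r)" using r0[OF rr0] by (intro mult_right_mono) auto
        finally show "(F (\<tau> v) \<omega>)\<^sup>2 \<le> 2 ^ r * (real r + 1) powr (2 + 2 * \<epsilon>) * (real r + 1)"
          by (simp add: a_def add.commute)
      qed
      have S_mono: "(\<Sum>k=1..m. f k \<omega>) \<le> (\<Sum>k=1..n. f k \<omega>)" if "m \<le> n" for m n
        using that f01 by (intro sum_mono2) auto
      have FS: "F n \<omega> = (\<Sum>k=1..n. f k \<omega>) - \<Phi> n" for n by (simp add: F_def \<Phi>_def sum_subtractf)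
      have "\<tau> u \<le> N" using u by (intro \<tau>_le)
      moreover have "N \<le> \<tau> (Suc u)"
      proof (rule ccontr)
        assume "\<not> N \<le> \<tau> (Suc u)"
        then have "\<Phi> (\<tau> (Suc u)) \<le> \<Phi> N" by (intro \<Phi>_mono) simp
        then show False using \<tau>1[of "Suc u"] u by simp
      qed
      \<comment> \<open>The counts are monotone between the two sampled times. From u \<le>
        \<Phi>(\<tau> u) and \<Phi> N < u + 1 the loss below is 1; from \<Phi>(\<tau>(u + 1)) \<le>
        u + 2 and u \<le> \<Phi> N the loss above is 2.\<close>
      ultimately have "F (\<tau> u) \<omega> - 1 \<le> F N \<omega>" "F N \<omega> \<le> F (\<tau> (Suc u)) \<omega> + 2"
        using S_mono[of "\<tau> u" N] S_mono[of N "\<tau> (Suc u)"] \<tau>1[of u] \<tau>2[of "Suc u"] u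
        unfolding FS by auto
      then have "\<bar>F N \<omega>\<bar> \<le> 2 + 2 * 5 powr (3/2 + \<epsilon>) * ?b N"
        using ch[of u] ch[of "Suc u"] r(1) by linarith
      moreover have "1 \<le> ?b N"
      proof -
        have "1 \<le> ln (\<Phi> N)" using \<Phi>1(1) \<open>\<Phi> N \<ge> 1\<close> by (subst ln_ge_iff) auto
        then show ?thesis using \<open>\<Phi> N \<ge> 1\<close> \<epsilon>
          by (intro mult_ge1_I ge_one_powr_ge_zero) auto
      qed
      ultimately show ?thesis by (simp add: algebra_simps)
    qed
    have "eventually (\<lambda>N. \<Phi> N \<ge> exp 1 + 2 ^ r0) sequentially"
      using div unfolding \<Phi>_def[symmetric] filterlim_at_top by blast
    then have "(\<lambda>N. F N \<omega>) \<in> O(?b)"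
    proof (intro bigoI[where c = "2 + 2 * 5 powr (3/2 + \<epsilon>)"], eventually_elim)
      case (elim N)
      have "norm (F N \<omega>) \<le> (2 + 2 * 5 powr (3/2 + \<epsilon>)) * ?b N"
        using main[OF elim(2)] by simp
      also have "\<dots> \<le> (2 + 2 * 5 powr (3/2 + \<epsilon>)) * norm (?b N)"
        by (intro mult_left_mono) auto
      finally show ?case .
    qed
    then show ?case by (simp add: F_def \<Phi>_def sum_subtractf)
  qed
qed

end

section \<open>Gibbs measures of two-sided Markov chains\<close>

lemma shift_funpow: "(shift ^^ k) \<omega> = (\<lambda>i. \<omega> (i + int k))"
  by (induction k arbitrary: \<omega>) (auto simp: shift_def funpow_Suc_right algebra_simps simp del: funpow.simps)

lemma shift_tmc_iff: "shift \<omega> \<in> tmc M A \<longleftrightarrow> \<omega> \<in> tmc M A"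
proof -
  have "(\<forall>i. P (i + 1)) \<longleftrightarrow> (\<forall>i. P i)" for P :: "int \<Rightarrow> bool"
    by (metis diff_add_cancel)
  from this[of "\<lambda>i. \<omega> i \<in> {1..M}"] this[of "\<lambda>i. A (\<omega> i) (\<omega> (i + 1)) = 1"]
  show ?thesis by (auto simp: tmc_def shift_def)
qed

lemma shift_funpow_tmc_iff: "(shift ^^ k) \<omega> \<in> tmc M A \<longleftrightarrow> \<omega> \<in> tmc M A"
  by (induction k) (auto simp: shift_tmc_iff)

lemma mat_pow_SucD:
  assumes "mat_pow M A (Suc k) i j > 0"
  obtains l where "l \<in> {1..M}" "mat_pow M A k i l > 0" "A l j > 0"
proof -
  have "(\<Sum>l\<in>{1..M}. mat_pow M A k i l * A l j) \<noteq> 0"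
    using assms unfolding mat_pow.simps by (rule less_imp_neq[THEN not_sym])
  then obtain l where "l \<in> {1..M}" "mat_pow M A k i l * A l j \<noteq> 0" by (rule sum.not_neutral_contains_not_neutral)
  then show ?thesis using that by auto
qed

text \<open>Normal form of the hypotheses: \<open>\<kappa>\<close> absorbs the base of the metric
  and the Hoelder exponent, and the Gibbs inequality is freed of quotients. \<open>holder\<close>
  with n = 0 also bounds the oscillation of \<psi>.\<close>

locale gibbs_chain = prob_space \<mu> for \<mu> :: "(int \<Rightarrow> nat) measure" +
  fixes M :: nat and A :: "nat \<Rightarrow> nat \<Rightarrow> nat" and \<psi> :: "(int \<Rightarrow> nat) \<Rightarrow> real"
    and Lc \<kappa> P c :: real and N :: nat
  assumes M_ge: "M \<ge> 2" and zero_one: "zero_one_matrix M A"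
    and N_ge: "N \<ge> 1" and primitive: "\<And>i j. i \<in> {1..M} \<Longrightarrow> j \<in> {1..M} \<Longrightarrow> mat_pow M A N i j > 0"
    and \<kappa>: "0 < \<kappa>" "\<kappa> < 1" and Lc: "Lc \<ge> 0"
    and holder: "\<And>\<omega> \<omega>' n. \<omega> \<in> tmc M A \<Longrightarrow> \<omega>' \<in> tmc M A \<Longrightarrow> (\<And>i. \<bar>i\<bar> < int n \<Longrightarrow> \<omega> i = \<omega>' i) \<Longrightarrow>
       \<bar>\<psi> \<omega> - \<psi> \<omega>'\<bar> \<le> Lc * \<kappa> ^ n"
    and sets_\<mu>: "sets \<mu> = sets seq_space"
    and tmc_sets: "tmc M A \<in> sets \<mu>" and tmc_full: "prob (tmc M A) = 1"
    and shift_meas: "shift \<in> measurable \<mu> \<mu>" and shift_inv: "distr \<mu> \<mu> shift = \<mu>"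
    and c_ge1: "c \<ge> 1"
    and gibbs: "\<And>\<omega> n. \<omega> \<in> tmc M A \<Longrightarrow> n \<ge> 1 \<Longrightarrow>
       exp (- real n * P + (\<Sum>k<n. \<psi> ((shift ^^ k) \<omega>))) \<le> c * prob (cylinder (tmc M A) 0 (int n - 1) \<omega>) \<and>
       prob (cylinder (tmc M A) 0 (int n - 1) \<omega>) \<le> c * exp (- real n * P + (\<Sum>k<n. \<psi> ((shift ^^ k) \<omega>)))"
begin

abbreviation "S \<equiv> tmc M A"
abbreviation "Xo \<equiv> admissible_seqs {1..M} (\<lambda>i j. A i j = 1)"

lemma space_\<mu> [simp]: "space \<mu> = UNIV"
  using sets_eq_imp_space_eq[OF sets_\<mu>] by (simp add: space_PiM)

lemma entry_one: "i \<in> {1..M} \<Longrightarrow> j \<in> {1..M} \<Longrightarrow> A i j > 0 \<Longrightarrow> A i j = 1"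
  using zero_one unfolding zero_one_matrix_def by (metis less_irrefl)

lemma path_exists:
  assumes "mat_pow M A k i (x 0) > 0" "x \<in> Xo"
  shows "\<exists>w. length w = k \<and> prepend w x \<in> Xo \<and> prepend w x 0 = i"
  using assms
proof (induction k arbitrary: x)
  case 0
  then show ?case by (auto split: if_splits)
next
  case (Suc k)
  from Suc.prems(1) obtain l where l: "l \<in> {1..M}" "mat_pow M A k i l > 0" "A l (x 0) > 0"
    by (rule mat_pow_SucD)
  have "x 0 \<in> {1..M}" using Suc.prems(2) by (auto simp: admissible_seqs_def)
  then have "A l (x 0) = 1" using l by (intro entry_one)
  then have y: "case_nat l x \<in> Xo" using l Suc.prems(2) by (simp add: case_nat_admissible_iff)
  from Suc.IH[of "case_nat l x", OF _ y] l obtain w where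
    "length w = k" "prepend w (case_nat l x) \<in> Xo" "prepend w (case_nat l x) 0 = i" by auto
  then show ?case by (intro exI[of _ "w @ [l]"]) simp
qed

subsection \<open>Reduction to a one-sided potential\<close>

definition pre :: "nat \<Rightarrow> nat" where "pre j = (SOME i. i \<in> {1..M} \<and> A i j = 1)"

lemma pre:
  assumes j: "j \<in> {1..M}" shows "pre j \<in> {1..M}" "A (pre j) j = 1"
proof -
  obtain k where k: "N = Suc k" using N_ge by (cases N) auto
  have "mat_pow M A (Suc k) 1 j > 0" using primitive[of 1 j] j M_ge k by simp
  then obtain l where "l \<in> {1..M}" "A l j > 0" by (rule mat_pow_SucD)
  then have "l \<in> {1..M} \<and> A l j = 1" using j entry_one by blast
  then have "pre j \<in> {1..M} \<and> A (pre j) j = 1" unfolding pre_def by (rule someI)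
  then show "pre j \<in> {1..M}" "A (pre j) j = 1" by auto
qed

lemma pre_pow: "j \<in> {1..M} \<Longrightarrow> (pre ^^ k) j \<in> {1..M}"
  by (induction k) (use pre in auto)

definition ext :: "(nat \<Rightarrow> nat) \<Rightarrow> int \<Rightarrow> nat" where
  "ext x i = (if 0 \<le> i then x (nat i) else (pre ^^ nat (- i)) (x 0))"

lemma ext_tmc: assumes x: "x \<in> Xo" shows "ext x \<in> S"
proof -
  have xI: "x n \<in> {1..M}" "A (x n) (x (Suc n)) = 1" for n using x by (auto simp: admissible_seqs_def)
  have "ext x i \<in> {1..M}" for i
    using xI pre_pow[OF xI(1)] by (simp add: ext_def del: atLeastAtMost_iff)
  moreover have "A (ext x i) (ext x (i + 1)) = 1" for i
  proof (cases "0 \<le> i")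
    case True
    then have "nat (i + 1) = Suc (nat i)" by simp
    then show ?thesis using True xI(2) by (simp add: ext_def)
  next
    case False
    define k where "k = nat (- (i + 1))"
    have "nat (- i) = Suc k" using False by (simp add: k_def)
    then have 1: "ext x i = pre ((pre ^^ k) (x 0))" using False by (simp add: ext_def)
    have "ext x (i + 1) = (pre ^^ k) (x 0)"
      using False by (auto simp: ext_def k_def)
    then show ?thesis using 1 pre(2)[OF pre_pow[OF xI(1)]] by simp
  qed
  ultimately show ?thesis by (auto simp: tmc_def)
qed

text \<open>The sequence \<open>ext x\<close> replaces the past by one that depends on \<open>x 0\<close> only, so \<open>ext\<close> does not commute
  with the shift; \<open>U n\<close> is the resulting correction to Birkhoff sums of length \<open>n\<close>, and it is
  bounded uniformly in \<open>n\<close>.\<close>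

definition D :: "nat \<Rightarrow> (nat \<Rightarrow> nat) \<Rightarrow> nat \<Rightarrow> real" where
  "D n x j = \<psi> ((shift ^^ (j + n)) (ext x)) - \<psi> ((shift ^^ j) (ext (\<lambda>k. x (k + n))))"

definition U :: "nat \<Rightarrow> (nat \<Rightarrow> nat) \<Rightarrow> real" where "U n x = (\<Sum>j. D n x j)"

definition \<phi> :: "(nat \<Rightarrow> nat) \<Rightarrow> real" where "\<phi> x = \<psi> (ext x) - P + U 1 x"

lemma tail_admissible: "x \<in> Xo \<Longrightarrow> (\<lambda>k. x (k + n)) \<in> Xo"
  by (auto simp: admissible_seqs_def)

text \<open>Both sequences continue \<open>x\<close> from index \<open>n\<close> on, and after the
  respective shifts they can differ only at coordinates below -j.\<close>

lemma D_bound: assumes x: "x \<in> Xo" shows "\<bar>D n x j\<bar> \<le> Lc * \<kappa> ^ j"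
  unfolding D_def
proof (rule holder)
  show "(shift ^^ (j + n)) (ext x) \<in> S" "(shift ^^ j) (ext (\<lambda>k. x (k + n))) \<in> S"
    by (simp_all only: shift_funpow_tmc_iff ext_tmc tail_admissible x)
  fix i assume "\<bar>i\<bar> < int j"
  then have "0 \<le> i + int j" "nat (i + int (j + n)) = nat (i + int j) + n" by linarith+
  then show "(shift ^^ (j + n)) (ext x) i = (shift ^^ j) (ext (\<lambda>k. x (k + n))) i"
    unfolding shift_funpow ext_def by simp
qed

lemma D_summable: assumes x: "x \<in> Xo" shows "summable (D n x)"
  using \<kappa> D_bound[OF x, of n]
  by (intro summable_comparison_test'[OF summable_mult[OF summable_geometric, of \<kappa> Lc]]) auto

lemma U_bound: assumes x: "x \<in> Xo" shows "\<bar>U n x\<bar> \<le> Lc / (1 - \<kappa>)"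
proof -
  have sm: "summable (\<lambda>j. Lc * \<kappa> ^ j)" using \<kappa> by (intro summable_mult summable_geometric) auto
  have s: "summable (\<lambda>j. \<bar>D n x j\<bar>)"
    using D_bound[OF x] by (intro summable_comparison_test'[OF sm]) auto
  have "\<bar>U n x\<bar> \<le> (\<Sum>j. \<bar>D n x j\<bar>)" unfolding U_def by (rule summable_rabs[OF s])
  also have "\<dots> \<le> (\<Sum>j. Lc * \<kappa> ^ j)" by (intro suminf_le s sm D_bound x)
  also have "\<dots> = Lc / (1 - \<kappa>)" using \<kappa> by (simp add: suminf_mult suminf_geometric summable_geometric)
  finally show ?thesis .
qed

text \<open>\<open>U\<close> satisfies a cocycle relation up to the term j = 0: U n x + U 1 (x
  shifted by n) = D n x 0 + U (n + 1) x, because adjacent terms of the two series cancel. The term D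
  n x 0 is exactly the error of \<open>ext\<close> at time \<open>n\<close>.\<close>

lemma birkhoff_sum:
  assumes x: "x \<in> Xo"
  shows "(\<Sum>k<n. \<phi> (\<lambda>j. x (j + k))) = (\<Sum>k<n. \<psi> ((shift ^^ k) (ext x))) - real n * P + U n x"
proof (induction n)
  case 0
  have "D 0 x = (\<lambda>_. 0)" by (auto simp: D_def)
  then show ?case by (simp add: U_def)
next
  case (Suc n)
  let ?y = "\<lambda>j. x (j + n)"
  have y: "?y \<in> Xo" by (rule tail_admissible[OF x])
  have "U n x = D n x 0 + (\<Sum>j. D n x (Suc j))"
    unfolding U_def using suminf_split_head[OF D_summable[OF x, of n]] by simp
  moreover have "(\<Sum>j. D n x (Suc j)) + U 1 ?y = (\<Sum>j. D n x (Suc j) + D 1 ?y j)"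
    unfolding U_def using D_summable[OF x, of n] D_summable[OF y]
    by (intro suminf_add) (auto simp: summable_Suc_iff)
  moreover have "D n x (Suc j) + D 1 ?y j = D (Suc n) x j" for j
    by (simp add: D_def del: funpow.simps)
  ultimately have "U n x + U 1 ?y = D n x 0 + U (Suc n) x" by (simp add: U_def)
  moreover have "D n x 0 = \<psi> ((shift ^^ n) (ext x)) - \<psi> (ext ?y)" by (simp add: D_def)
  ultimately show ?case using Suc by (simp add: \<phi>_def algebra_simps)
qed

text \<open>The cube root makes the series in \<open>U 1\<close> decay in two directions at once.
  With n = p + 1, terms with 2 j \<ge> p are small by themselves, \<kappa>^j \<le> \<theta>^(p + j),
  and those with 2 j < p by agreement, \<kappa>^(p - j) \<le> \<theta>^(p + j).\<close>

definition \<theta> :: real where "\<theta> = root 3 \<kappa>"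

lemma \<theta>: "0 < \<theta>" "\<theta> < 1" "\<kappa> = \<theta> ^ 3"
  using \<kappa> by (auto simp: \<theta>_def real_root_lt_1_iff)

lemma \<kappa>_power: "\<kappa> ^ k = \<theta> ^ (3 * k)"
  unfolding power_mult \<theta>(3)[symmetric] ..

text \<open>The first term belongs to \<psi>; the second sums the bounds 2 Lc \<theta>^(p + j) over
  j with p = n - 1, hence the extra \<theta> in the denominator.\<close>

definition H :: real where "H = Lc + 2 * Lc / (\<theta> * (1 - \<theta>))"

text \<open>After \<open>j\<close> shifts the agreement reaches up to n - j. The subtraction is
  truncated: for j \<ge> n the exponent is 0 and the bound is the oscillation of \<psi>.\<close>

lemma holder_past:
  assumes "\<omega> \<in> S" "\<omega>' \<in> S" "\<And>i. i < int n \<Longrightarrow> \<omega> i = \<omega>' i"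
  shows "\<bar>\<psi> ((shift ^^ j) \<omega>) - \<psi> ((shift ^^ j) \<omega>')\<bar> \<le> Lc * \<kappa> ^ (n - j)"
proof (rule holder)
  show "(shift ^^ j) \<omega> \<in> S" "(shift ^^ j) \<omega>' \<in> S"
    using assms by (simp_all only: shift_funpow_tmc_iff)
qed (use assms in \<open>auto simp: shift_funpow\<close>)

lemma ext_agree:
  assumes "\<And>k. k < n \<Longrightarrow> x k = y k" "n \<ge> 1" "i < int n"
  shows "ext x i = ext y i"
  using assms by (auto simp: ext_def)

lemma \<phi>_holder_one_sided:
  assumes x: "x \<in> Xo" and y: "y \<in> Xo" and n: "n \<ge> 1" and agree: "\<And>k. k < n \<Longrightarrow> x k = y k"
  shows "\<bar>\<phi> x - \<phi> y\<bar> \<le> H * \<theta> ^ n"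
proof -
  obtain p where p: "n = Suc p" using n by (cases n) auto
  have D1: "\<bar>D 1 x j - D 1 y j\<bar> \<le> 2 * Lc * (\<theta> ^ p * \<theta> ^ j)" for j
  proof (cases "3 * j \<ge> p + j")
    case True
    have "\<bar>D 1 x j - D 1 y j\<bar> \<le> 2 * Lc * \<kappa> ^ j" using D_bound[OF x, of 1 j] D_bound[OF y, of 1 j] by linarith
    also have "\<kappa> ^ j = \<theta> ^ (3 * j)" by (rule \<kappa>_power)
    also have "2 * Lc * \<theta> ^ (3 * j) \<le> 2 * Lc * \<theta> ^ (p + j)"
      using True \<theta>(1,2) Lc by (intro mult_left_mono power_decreasing) auto
    finally show ?thesis by (simp add: power_add)
  next
    case False
    have 1: "\<bar>\<psi> ((shift ^^ (j + 1)) (ext x)) - \<psi> ((shift ^^ (j + 1)) (ext y))\<bar> \<le> Lc * \<kappa> ^ (n - (j + 1))"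
      by (intro holder_past ext_tmc x y ext_agree[of n] agree n)
    have 2: "\<bar>\<psi> ((shift ^^ j) (ext (\<lambda>k. x (k + 1)))) - \<psi> ((shift ^^ j) (ext (\<lambda>k. y (k + 1))))\<bar> \<le> Lc * \<kappa> ^ (p - j)"
      using False p by (intro holder_past ext_tmc tail_admissible x y ext_agree[of p] agree) auto
    have "\<bar>D 1 x j - D 1 y j\<bar> \<le> 2 * Lc * \<kappa> ^ (p - j)"
      using 1 2 unfolding D_def p by (simp del: funpow.simps)
    also have "\<kappa> ^ (p - j) = \<theta> ^ (3 * (p - j))" by (rule \<kappa>_power)
    also have "2 * Lc * \<theta> ^ (3 * (p - j)) \<le> 2 * Lc * \<theta> ^ (p + j)"
      using False \<theta>(1,2) Lc by (intro mult_left_mono power_decreasing) auto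
    finally show ?thesis by (simp add: power_add)
  qed
  have sm: "summable (\<lambda>j. 2 * Lc * (\<theta> ^ p * \<theta> ^ j))"
    using \<theta>(1,2) by (intro summable_mult summable_geometric) auto
  have s: "summable (\<lambda>j. \<bar>D 1 x j - D 1 y j\<bar>)"
    using D1 by (intro summable_comparison_test'[OF sm]) auto
  have "\<bar>U 1 x - U 1 y\<bar> = \<bar>\<Sum>j. D 1 x j - D 1 y j\<bar>"
    unfolding U_def by (subst suminf_diff[OF D_summable[OF x] D_summable[OF y]]) simp
  also have "\<dots> \<le> (\<Sum>j. \<bar>D 1 x j - D 1 y j\<bar>)" by (rule summable_rabs[OF s])
  also have "\<dots> \<le> (\<Sum>j. 2 * Lc * (\<theta> ^ p * \<theta> ^ j))" by (intro suminf_le s sm D1)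
  also have "\<dots> = 2 * Lc * (\<theta> ^ p * (1 / (1 - \<theta>)))"
    using \<theta>(1,2) by (simp add: suminf_mult suminf_geometric summable_geometric summable_mult)
  also have "\<dots> = 2 * Lc / (\<theta> * (1 - \<theta>)) * \<theta> ^ n" using \<theta>(1,2) by (simp add: p)
  finally have UU: "\<bar>U 1 x - U 1 y\<bar> \<le> 2 * Lc / (\<theta> * (1 - \<theta>)) * \<theta> ^ n" .
  have "\<bar>\<psi> (ext x) - \<psi> (ext y)\<bar> \<le> Lc * \<kappa> ^ n"
    using holder_past[OF ext_tmc[OF x] ext_tmc[OF y] ext_agree[OF agree n], where j = 0] by simp
  also have "\<dots> \<le> Lc * \<theta> ^ n"
  proof (intro mult_left_mono power_mono Lc)
    have "\<kappa> = \<theta> ^ 3" by (rule \<theta>(3))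
    also have "\<dots> \<le> \<theta> ^ 1" by (rule power_decreasing) (use \<theta>(1,2) in auto)
    finally show "\<kappa> \<le> \<theta>" by simp
  qed (use \<kappa> in simp)
  finally show ?thesis using UU by (simp add: \<phi>_def H_def algebra_simps)
qed

lemma tmc_nonempty: "S \<noteq> {}" using tmc_full by auto

lemma \<phi>_bounded: "\<exists>B. \<forall>x\<in>Xo. \<bar>\<phi> x\<bar> \<le> B"
proof -
  obtain \<omega>0 where \<omega>0: "\<omega>0 \<in> S" using tmc_nonempty by auto
  have "\<bar>\<phi> x\<bar> \<le> \<bar>\<psi> \<omega>0\<bar> + Lc + \<bar>P\<bar> + Lc / (1 - \<kappa>)" if x: "x \<in> Xo" for x
    using holder[OF ext_tmc[OF x] \<omega>0, of 0] U_bound[OF x, of 1] by (simp add: \<phi>_def)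
  then show ?thesis by blast
qed

definition B :: real where "B = (SOME B. \<forall>x\<in>Xo. \<bar>\<phi> x\<bar> \<le> B)"

lemma B: "x \<in> Xo \<Longrightarrow> \<bar>\<phi> x\<bar> \<le> B"
  unfolding B_def using someI_ex[OF \<phi>_bounded] by blast

subsection \<open>Cylinder probabilities\<close>

text \<open>Cylinders coded by their left end and the word read from there, so that shifts change
  only the first argument and adjacent cylinders concatenate. The empty word gives all of
  \<open>S\<close>.\<close>

definition cyl :: "int \<Rightarrow> nat list \<Rightarrow> (int \<Rightarrow> nat) set" where
  "cyl l w = {\<omega>\<in>S. \<forall>k<length w. \<omega> (l + int k) = w ! k}"

definition m :: "nat list \<Rightarrow> real" where "m w = prob (cyl 0 w)"

lemma cyl_sets [measurable]: "cyl l w \<in> events"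
proof -
  have "{\<omega>\<in>space seq_space. \<forall>k<length w. \<omega> (l + int k) = w ! k} \<in> sets seq_space"
    by measurable
  then have "{\<omega>. \<forall>k<length w. \<omega> (l + int k) = w ! k} \<in> events" by (simp add: sets_\<mu> space_PiM)
  then have "S \<inter> {\<omega>. \<forall>k<length w. \<omega> (l + int k) = w ! k} \<in> events"
    using tmc_sets by (rule sets.Int[rotated])
  moreover have "cyl l w = S \<inter> {\<omega>. \<forall>k<length w. \<omega> (l + int k) = w ! k}"
    unfolding cyl_def by blast
  ultimately show ?thesis by (simp only:)
qed

lemma prob_shift: "Y \<in> events \<Longrightarrow> prob (shift -` Y) = prob Y"
  using measure_distr[OF shift_meas, of Y] by (simp add: shift_inv)

lemma shift_vimage_cyl: "shift -` cyl l w = cyl (l + 1) w"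
  by (auto simp: cyl_def shift_tmc_iff) (simp_all add: shift_def add_ac)

lemma prob_cyl: "prob (cyl l w) = m w"
proof (induction l rule: int_induct[of _ 0])
  case (step1 i)
  then show ?case using prob_shift[OF cyl_sets, of i w] by (simp add: shift_vimage_cyl)
next
  case (step2 i)
  then show ?case using prob_shift[OF cyl_sets, of "i - 1" w] by (simp add: shift_vimage_cyl)
qed (simp add: m_def)

lemma cyl_append: "cyl l (u @ v) = cyl l u \<inter> cyl (l + int (length u)) v"
proof (intro set_eqI iffI)
  fix \<omega> assume a: "\<omega> \<in> cyl l (u @ v)"
  then have "\<omega> (l + int (length u + k)) = v ! k" if "k < length v" for k
    using that unfolding cyl_def by (auto simp: nth_append dest!: spec[of _ "length u + k"])
  then show "\<omega> \<in> cyl l u \<inter> cyl (l + int (length u)) v"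
    using a by (auto simp: cyl_def nth_append add.assoc)
next
  fix \<omega> assume a: "\<omega> \<in> cyl l u \<inter> cyl (l + int (length u)) v"
  have "\<omega> (l + int k) = (u @ v) ! k" if "k < length (u @ v)" for k
  proof (cases "k < length u")
    case False
    then have "k - length u < length v" "int k = int (length u) + int (k - length u)" using that by auto
    then show ?thesis using a False by (auto simp: cyl_def nth_append add.assoc)
  qed (use a in \<open>auto simp: cyl_def nth_append\<close>)
  then show "\<omega> \<in> cyl l (u @ v)" using a by (auto simp: cyl_def)
qed

lemma prob_letter_partition:
  assumes [measurable]: "Y \<in> events" and sub: "Y \<subseteq> S"
  shows "(\<Sum>i\<in>{1..M}. prob (Y \<inter> cyl l [i])) = prob Y"
proof -
  have "prob (\<Union>i\<in>{1..M}. Y \<inter> cyl l [i]) = (\<Sum>i\<in>{1..M}. prob (Y \<inter> cyl l [i]))"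
  proof (rule finite_measure_finite_Union)
    show "(\<lambda>i. Y \<inter> cyl l [i]) ` {1..M} \<subseteq> events" by auto
  qed (auto simp: disjoint_family_on_def cyl_def)
  moreover have "(\<Union>i\<in>{1..M}. Y \<inter> cyl l [i]) = Y"
    using sub by (fastforce simp: cyl_def tmc_def)
  ultimately show ?thesis by simp
qed

lemma cyl_subset: "cyl l w \<subseteq> S" by (auto simp: cyl_def)

lemma cyl_prepend: "x \<in> Xo \<Longrightarrow> prepend w x \<in> Xo \<Longrightarrow> w \<noteq> [] \<Longrightarrow>
    cylinder S 0 (int (length w) - 1) (ext (prepend w x)) = cyl 0 w"
proof -
  assume w: "w \<noteq> []"
  have "(\<forall>i\<in>{0..int (length w) - 1}. \<omega> i = ext (prepend w x) i) \<longleftrightarrow> (\<forall>k<length w. \<omega> (int k) = w ! k)" for \<omega>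
  proof (intro iffI allI impI ballI)
    fix k assume "\<forall>i\<in>{0..int (length w) - 1}. \<omega> i = ext (prepend w x) i" "k < length w"
    then show "\<omega> (int k) = w ! k" by (auto simp: ext_def prepend_nth dest!: bspec[of _ _ "int k"])
  next
    fix i assume a: "\<forall>k<length w. \<omega> (int k) = w ! k" and i: "i \<in> {0..int (length w) - 1}"
    then have "nat i < length w" by auto
    then show "\<omega> i = ext (prepend w x) i" using a i by (auto simp: ext_def prepend_nth dest!: spec[of _ "nat i"])
  qed
  then show ?thesis by (simp add: cylinder_def cyl_def)
qed

text \<open>The exponential is the price, from \<open>U_bound\<close>, of replacing Birkhoff sums of
  \<psi> by those of \<phi>.\<close>

definition cb :: real where "cb = c * exp (Lc / (1 - \<kappa>))"

lemma cb_ge: "cb \<ge> 1"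
  unfolding cb_def using c_ge1 Lc \<kappa> by (intro mult_ge1_I) auto

lemma m_Nil': "m [] = 1" using tmc_full by (simp add: m_def cyl_def)

lemma m_gibbs:
  assumes x: "x \<in> Xo" and wx: "prepend w x \<in> Xo"
  shows "m w \<le> cb * exp (\<Sum>k<length w. \<phi> (\<lambda>j. prepend w x (j + k)))"
    and "exp (\<Sum>k<length w. \<phi> (\<lambda>j. prepend w x (j + k))) \<le> cb * m w"
proof -
  define T where "T = - real (length w) * P + (\<Sum>k<length w. \<psi> ((shift ^^ k) (ext (prepend w x))))"
  define V where "V = Lc / (1 - \<kappa>)"
  have V: "V \<ge> 0" using Lc \<kappa> by (simp add: V_def)
  define u where "u = U (length w) (prepend w x)"
  have W: "(\<Sum>k<length w. \<phi> (\<lambda>j. prepend w x (j + k))) = T + u"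
    unfolding birkhoff_sum[OF wx] T_def u_def by simp
  have u: "\<bar>u\<bar> \<le> V" unfolding u_def V_def by (rule U_bound[OF wx])
  \<comment> \<open>The Gibbs inequality is given for n \<ge> 1 only, so the empty word is treated
    apart.\<close>
  have G: "exp T \<le> c * m w \<and> m w \<le> c * exp T"
  proof (cases "w = []")
    case True
    then show ?thesis using c_ge1 by (simp add: T_def m_Nil')
  next
    case False
    then show ?thesis using gibbs[OF ext_tmc[OF wx], of "length w"] cyl_prepend[OF x wx]
      by (simp add: T_def m_def Suc_le_eq)
  qed
  have "exp T \<le> exp V * exp (T + u)" using u by (simp flip: exp_add)
  then have "c * exp T \<le> c * (exp V * exp (T + u))" using c_ge1 by (intro mult_left_mono) auto
  then show "m w \<le> cb * exp (\<Sum>k<length w. \<phi> (\<lambda>j. prepend w x (j + k)))"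
    using G unfolding W cb_def V_def[symmetric] by (simp add: mult.assoc)
  have "exp (T + u) \<le> exp V * exp T" using u by (simp flip: exp_add)
  also have "\<dots> \<le> exp V * (c * m w)" using G by (intro mult_left_mono) auto
  finally show "exp (\<Sum>k<length w. \<phi> (\<lambda>j. prepend w x (j + k))) \<le> cb * m w"
    unfolding W cb_def V_def[symmetric] by (simp add: mult_ac)
qed

lemma m_support: assumes "m w \<noteq> 0" shows "\<exists>x. prepend w x \<in> Xo"
proof -
  have "cyl 0 w \<noteq> {}" using assms by (auto simp: m_def)
  then obtain \<omega> where \<omega>: "\<omega> \<in> S" "\<And>k. k < length w \<Longrightarrow> \<omega> (int k) = w ! k" by (auto simp: cyl_def)
  define x where "x k = \<omega> (int (k + length w))" for k
  have "prepend w x k = \<omega> (int k)" for k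
  proof (cases "k < length w")
    case False
    then show ?thesis using prepend_add_length[of w x "k - length w"] by (simp add: x_def)
  qed (simp add: prepend_nth \<omega>)
  then have "prepend w x = (\<lambda>k. \<omega> (int k))" by auto
  moreover have "(\<lambda>k. \<omega> (int k)) \<in> Xo"
    using \<omega>(1) by (auto simp: tmc_def admissible_seqs_def add.commute[of 1])
  ultimately show ?thesis by (intro exI[of _ x]) (simp only:)
qed

lemma nat_restrict_admissible: "\<omega> \<in> S \<Longrightarrow> (\<lambda>k. \<omega> (int k)) \<in> Xo"
  by (auto simp: tmc_def admissible_seqs_def add.commute[of 1])

sublocale transfer_operator "{1..M}" "\<lambda>i j. A i j = 1" \<phi> B H \<theta> N
proof
  show "0 < \<theta>" "\<theta> < 1" by (fact \<theta>(1,2))+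
  show "0 \<le> H" using Lc \<theta>(1,2) by (simp add: H_def)
  show "Xo \<noteq> {}" using tmc_nonempty nat_restrict_admissible by blast
next
  fix i x assume i: "i \<in> {1..M}" and x: "x \<in> Xo"
  have "x 0 \<in> {1..M}" using x by (auto simp: admissible_seqs_def)
  from path_exists[OF primitive[OF i this] x] obtain w
    where w: "length w = N" "prepend w x \<in> Xo" "prepend w x 0 = i" by blast
  then show "\<exists>w. length w = N \<and> w \<noteq> [] \<and> hd w = i \<and> prepend w x \<in> Xo"
    using N_ge by (intro exI[of _ w]) (cases w, auto)
qed (use B \<phi>_holder_one_sided in auto)

sublocale gibbs_words "{1..M}" "\<lambda>i j. A i j = 1" \<phi> B H \<theta> N m cb
proof
  show "1 \<le> cb" by (fact cb_ge)
  show "m [] = 1" by (fact m_Nil')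
  fix w
  show "0 \<le> m w" by (simp add: m_def)
  show "(\<Sum>i\<in>{1..M}. m (w @ [i])) = m w"
    using prob_letter_partition[OF cyl_sets cyl_subset, of 0 w] by (simp add: m_def cyl_append)
  have "m (i # w) = prob (cyl 1 w \<inter> cyl 0 [i])" for i
    using cyl_append[of 0 "[i]" w] by (simp add: m_def Int_commute)
  then show "(\<Sum>i\<in>{1..M}. m (i # w)) = m w"
    using prob_letter_partition[OF cyl_sets cyl_subset, of 1 w 0] by (simp add: prob_cyl)
qed (use m_gibbs m_support in \<open>auto simp: weight_def\<close>)

end

section \<open>Decay of correlations for nested cylinders\<close>

text \<open>With truncated subtraction the exponent is |m - n|, and each side of \<open>m\<close>
  contributes at most a full geometric series.\<close>

lemma sum_power_distance_le:
  fixes r :: real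
  assumes r: "0 < r" "r < 1" and J: "finite J"
  shows "(\<Sum>n\<in>J. r ^ ((m - n) + (n - m))) \<le> 2 / (1 - r)"
proof -
  have geo: "(\<Sum>j\<in>T. r ^ j) \<le> 1 / (1 - r)" if "finite T" for T
    using sum_le_suminf[of "\<lambda>j. r ^ j" T] that r by (simp add: summable_geometric suminf_geometric)
  have "J = {n\<in>J. n \<le> m} \<union> {n\<in>J. m < n}" by auto
  then have "(\<Sum>n\<in>J. r ^ ((m - n) + (n - m))) =
      (\<Sum>n\<in>{n\<in>J. n \<le> m} \<union> {n\<in>J. m < n}. r ^ ((m - n) + (n - m)))" by simp
  also have "\<dots> = (\<Sum>n\<in>{n\<in>J. n \<le> m}. r ^ ((m - n) + (n - m))) + (\<Sum>n\<in>{n\<in>J. m < n}. r ^ ((m - n) + (n - m)))"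
    using J by (intro sum.union_disjoint) auto
  also have "(\<Sum>n\<in>{n\<in>J. n \<le> m}. r ^ ((m - n) + (n - m))) = (\<Sum>j\<in>(\<lambda>n. m - n) ` {n\<in>J. n \<le> m}. r ^ j)"
    by (subst sum.reindex) (auto intro!: inj_onI)
  also have "\<dots> \<le> 1 / (1 - r)" using J by (intro geo) auto
  also have "(\<Sum>n\<in>{n\<in>J. m < n}. r ^ ((m - n) + (n - m))) = (\<Sum>j\<in>(\<lambda>n. n - m) ` {n\<in>J. m < n}. r ^ j)"
    by (subst sum.reindex) (auto intro!: inj_onI)
  also have "\<dots> \<le> 1 / (1 - r)" using J by (intro geo) auto
  finally show ?thesis by simp
qed

context gibbs_chain
begin

lemma sum_prob_cyl_words:
  assumes Y: "Y \<in> events" "Y \<subseteq> S"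
  shows "(\<Sum>v\<in>words g. prob (Y \<inter> cyl l v)) = prob Y"
proof (induction g)
  case 0
  have "Y \<inter> cyl l [] = Y" using Y(2) by (auto simp: cyl_def)
  then show ?case by (simp only: sum_words_0)
next
  case (Suc g)
  have "(\<Sum>v\<in>words (Suc g). prob (Y \<inter> cyl l v)) =
      (\<Sum>v\<in>words g. \<Sum>i\<in>{1..M}. prob ((Y \<inter> cyl l v) \<inter> cyl (l + int (length v)) [i]))"
    by (simp only: sum_words_Suc cyl_append Int_assoc)
  also have "\<dots> = (\<Sum>v\<in>words g. prob (Y \<inter> cyl l v))"
    using Y by (intro sum.cong refl prob_letter_partition sets.Int cyl_sets) auto
  finally show ?case using Suc by simp
qed

lemma prob_two_cyl:
  assumes "l' = l + int (length u) + int g"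
  shows "prob (cyl l u \<inter> cyl l' w) = (\<Sum>v\<in>words g. m (u @ v @ w))"
proof -
  have "prob (cyl l u \<inter> cyl l' w) = (\<Sum>v\<in>words g. prob ((cyl l u \<inter> cyl l' w) \<inter> cyl (l + int (length u)) v))"
    by (rule sum_prob_cyl_words[symmetric]) (use cyl_subset in auto)
  also have "\<dots> = (\<Sum>v\<in>words g. prob (cyl l (u @ v @ w)))"
  proof (intro sum.cong refl)
    fix v assume "v \<in> words g"
    then have "length v = g" unfolding words_def by simp
    then show "prob ((cyl l u \<inter> cyl l' w) \<inter> cyl (l + int (length u)) v) = prob (cyl l (u @ v @ w))"
      by (simp add: cyl_append assms Int_ac)
  qed
  finally show ?thesis by (simp add: prob_cyl)
qed

lemma m_zero: "\<not> set w \<subseteq> {1..M} \<Longrightarrow> m w = 0"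
  using m_support prepend_admissible_set by blast

text \<open>\<open>u\<close> is the protruding word, on the left in the first bound and on the right
  in the second, and only the probability of \<open>w\<close> is kept. With h = k div 2: if
  \<open>u\<close> has at least h symbols, its outermost h are retained, which do not meet
  \<open>w\<close> and cost a factor \<rho>^h; if \<open>u\<close> is shorter, it is at distance at
  least h from \<open>w\<close> and mixing applies directly.\<close>

lemma shifted_nested_correlation:
  obtains C r where "0 < r" "r < 1" "C \<ge> 0"
    "\<And>u w l l' k. l' \<ge> l + int k \<Longrightarrow> prob (cyl l u \<inter> cyl l' w) - m u * m w \<le> C * r ^ k * m w"
    "\<And>u w l l' k. l' + int (length w) + int k \<le> l + int (length u) \<Longrightarrow>
       prob (cyl l u \<inter> cyl l' w) - m u * m w \<le> C * r ^ k * m w"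
proof -
  have card: "card {1..M} \<ge> 2" using M_ge by simp
  obtain C \<rho> where \<rho>: "0 < \<rho>" "\<rho> < 1" and C: "C \<ge> 0"
    and decay: "\<And>w. set w \<subseteq> {1..M} \<Longrightarrow> m w \<le> C * \<rho> ^ length w"
    and mix: "\<And>u w g. set u \<subseteq> {1..M} \<Longrightarrow> set w \<subseteq> {1..M} \<Longrightarrow>
       (\<Sum>v\<in>words g. m (u @ v @ w)) \<le> (1 + C * \<rho> ^ g) * (m u * m w)"
    by (rule word_mixing[OF card], rule that)
  obtain r where r: "0 < r" "r < 1" and r2: "\<And>n. \<rho> ^ (n div 2) \<le> r ^ n / \<rho>"
    using power_div_le_geometric[OF \<rho>, of 2] by auto
  define C' where "C' = C * (1 + C) / \<rho>"
  have C': "C' \<ge> 0" using C \<rho> by (simp add: C'_def)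
  have conv: "C * (1 + C) * \<rho> ^ (k div 2) * m w \<le> C' * r ^ k * m w" for k w
  proof -
    have "C * (1 + C) * \<rho> ^ (k div 2) \<le> C * (1 + C) * (r ^ k / \<rho>)"
      using C r2 by (intro mult_left_mono) auto
    then show ?thesis using m_nonneg by (intro mult_right_mono) (auto simp: C'_def)
  qed
  have overlap: "prob T - m u * m w \<le> C * (1 + C) * \<rho> ^ h * m w"
    if T: "prob T \<le> (1 + C * \<rho> ^ g) * (m v * m w)" and v: "set v \<subseteq> {1..M}" "length v = h"
    for T u v w g h
  proof -
    have "\<rho> ^ g \<le> 1" using \<rho> by (simp add: power_le_one)
    then have 1: "1 + C * \<rho> ^ g \<le> 1 + C" using C by (simp add: mult_left_le)
    have "prob T \<le> (1 + C) * (C * \<rho> ^ h * m w)"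
      using T 1 decay[OF v(1)] v(2) C \<rho> m_nonneg
      by (intro order.trans[OF T] mult_mono mult_right_mono) auto
    moreover have "0 \<le> m u * m w" using m_nonneg by simp
    ultimately show ?thesis by (simp add: mult_ac)
  qed
  have apart: "prob T - m u * m w \<le> C * (1 + C) * \<rho> ^ h * m w"
    if T: "prob T \<le> (1 + C * \<rho> ^ g) * (m u * m w)" and u: "set u \<subseteq> {1..M}" and g: "h \<le> g"
    for T u w g h
  proof -
    have m1: "m u \<le> 1" using m_le_1[of u "length u"] u unfolding words_def by simp
    have "prob T - m u * m w \<le> C * \<rho> ^ g * (m u * m w)" using T by (simp add: algebra_simps)
    also have "\<dots> \<le> (C * (1 + C)) * \<rho> ^ h * (1 * m w)"
    proof (intro mult_mono)
      show "C \<le> C * (1 + C)" using C by (simp add: algebra_simps)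
      show "\<rho> ^ g \<le> \<rho> ^ h" using g \<rho> by (intro power_decreasing) auto
    qed (use m1 m_nonneg C \<rho> in auto)
    finally show ?thesis by simp
  qed
  have prob_le_word: "prob (cyl l u \<inter> Y) \<le> m u" "prob (Y \<inter> cyl l u) \<le> m u" for l u Y
    unfolding prob_cyl[symmetric, of u l] by (rule finite_measure_mono, auto)+
  \<comment> \<open>The symbols of a cylinder are arbitrary naturals, and a word with a symbol
    outside the alphabet has probability 0.\<close>
  have degenerate: "prob (cyl l u \<inter> cyl l' w) - m u * m w \<le> C' * r ^ k * m w"
    if "\<not> set u \<subseteq> {1..M} \<or> \<not> set w \<subseteq> {1..M}" for l l' u w k
  proof -
    have "prob (cyl l u \<inter> cyl l' w) \<le> 0"
      using that m_zero prob_le_word(1)[of l u "cyl l' w"] prob_le_word(2)[of "cyl l u" l' w] by fastforce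
    moreover have "0 \<le> m u * m w" "0 \<le> C' * r ^ k * m w" using m_nonneg C' r by auto
    ultimately show ?thesis by linarith
  qed
  show ?thesis
  proof (rule that[OF r C'])
    fix u w l l' k assume le: "l' \<ge> l + int k"
    show "prob (cyl l u \<inter> cyl l' w) - m u * m w \<le> C' * r ^ k * m w"
    proof (cases "set u \<subseteq> {1..M} \<and> set w \<subseteq> {1..M}")
      case uw: True
      define h where "h = k div 2"
      have hk: "h \<le> k" by (simp add: h_def)
      have "prob (cyl l u \<inter> cyl l' w) - m u * m w \<le> C * (1 + C) * \<rho> ^ h * m w"
      proof (cases "length u \<ge> h")
        case True
        define v where "v = take h u"
        have v: "length v = h" "set v \<subseteq> {1..M}"
          using True uw set_take_subset[of h u] by (auto simp: v_def)
        have "cyl l u \<subseteq> cyl l v" using cyl_append[of l v "drop h u"] by (simp add: v_def)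
        then have "prob (cyl l u \<inter> cyl l' w) \<le> prob (cyl l v \<inter> cyl l' w)"
          by (intro finite_measure_mono) auto
        also have "\<dots> = (\<Sum>x\<in>words (nat (l' - l - int h)). m (v @ x @ w))"
          using le v(1) hk by (intro prob_two_cyl) arith
        also have "\<dots> \<le> (1 + C * \<rho> ^ nat (l' - l - int h)) * (m v * m w)"
          using uw v by (intro mix) auto
        finally show ?thesis using v by (intro overlap)
      next
        case False
        have "prob (cyl l u \<inter> cyl l' w) = (\<Sum>x\<in>words (nat (l' - l - int (length u))). m (u @ x @ w))"
          using le False hk by (intro prob_two_cyl) arith
        also have "\<dots> \<le> (1 + C * \<rho> ^ nat (l' - l - int (length u))) * (m u * m w)"
          using uw by (intro mix) auto
        finally show ?thesis using uw le False by (intro apart) (auto simp: h_def)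
      qed
      also have "\<dots> \<le> C' * r ^ k * m w" unfolding h_def by (rule conv)
      finally show ?thesis .
    qed (use degenerate in auto)
  next
    fix u w :: "nat list" and l l' k assume le: "l' + int (length w) + int k \<le> l + int (length u)"
    show "prob (cyl l u \<inter> cyl l' w) - m u * m w \<le> C' * r ^ k * m w"
    proof (cases "set u \<subseteq> {1..M} \<and> set w \<subseteq> {1..M}")
      case uw: True
      define h where "h = k div 2"
      have hk: "h \<le> k" by (simp add: h_def)
      have "prob (cyl l u \<inter> cyl l' w) - m u * m w \<le> C * (1 + C) * \<rho> ^ h * m w"
      proof (cases "length u \<ge> h")
        case True
        define n where "n = length u - h"
        define v where "v = drop n u"
        have v: "length v = h" "set v \<subseteq> {1..M}"
          using True uw set_drop_subset[of n u] by (auto simp: v_def n_def)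
        have "cyl l (take n u @ v) = cyl l (take n u) \<inter> cyl (l + int (length (take n u))) v"
          by (rule cyl_append)
        moreover have "take n u @ v = u" "length (take n u) = n" by (simp_all add: v_def n_def)
        ultimately have "cyl l u \<subseteq> cyl (l + int n) v" by (metis Int_lower2)
        then have "prob (cyl l u \<inter> cyl l' w) \<le> prob (cyl l' w \<inter> cyl (l + int n) v)"
          by (intro finite_measure_mono) auto
        also have "\<dots> = (\<Sum>x\<in>words (nat (l + int n - l' - int (length w))). m (w @ x @ v))"
          using le True hk by (intro prob_two_cyl) (simp add: n_def, arith?)
        also have "\<dots> \<le> (1 + C * \<rho> ^ nat (l + int n - l' - int (length w))) * (m w * m v)"
          using uw v by (intro mix) auto
        also have "m w * m v = m v * m w" by simp
        finally show ?thesis using v by (intro overlap)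
      next
        case False
        have "prob (cyl l u \<inter> cyl l' w) = prob (cyl l' w \<inter> cyl l u)" by (simp add: Int_commute)
        also have "\<dots> = (\<Sum>x\<in>words (nat (l - l' - int (length w))). m (w @ x @ u))"
          using le False hk by (intro prob_two_cyl) arith
        also have "\<dots> \<le> (1 + C * \<rho> ^ nat (l - l' - int (length w))) * (m w * m u)"
          using uw by (intro mix) auto
        also have "m w * m u = m u * m w" by simp
        finally show ?thesis using uw le False by (intro apart) (auto simp: h_def)
      qed
      also have "\<dots> \<le> C' * r ^ k * m w" unfolding h_def by (rule conv)
      finally show ?thesis .
    qed (use degenerate in auto)
  qed
qed

section \<open>Correlations and second moments of the shifted cylinders\<close>

definition word_of :: "int \<Rightarrow> int \<Rightarrow> (int \<Rightarrow> nat) \<Rightarrow> nat list" where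
  "word_of lo hi s = map (\<lambda>k. s (lo + int k)) [0..<nat (hi - lo + 1)]"

lemma cylinder_eq_cyl: "cylinder S lo hi s = cyl lo (word_of lo hi s)"
proof -
  have "(\<forall>i\<in>{lo..hi}. \<omega> i = s i) \<longleftrightarrow> (\<forall>k<nat (hi - lo + 1). \<omega> (lo + int k) = s (lo + int k))" for \<omega>
  proof (intro iffI allI impI ballI)
    fix i assume a: "\<forall>k<nat (hi - lo + 1). \<omega> (lo + int k) = s (lo + int k)" and i: "i \<in> {lo..hi}"
    show "\<omega> i = s i" using a[rule_format, of "nat (i - lo)"] i by auto
  qed auto
  then show ?thesis by (simp add: cylinder_def cyl_def word_of_def cong: conj_cong)
qed

lemma preim_cyl: "preim n (cyl l w) = cyl (l + int n) w"
  by (simp add: preim_def cyl_def shift_funpow_tmc_iff) (simp add: shift_funpow add_ac)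

lemma nested_correlation:
  fixes lo hi :: "nat \<Rightarrow> int" and s :: "nat \<Rightarrow> int \<Rightarrow> nat" and D :: int
  assumes lohi: "\<And>n. n \<ge> 1 \<Longrightarrow> lo n \<le> hi n" and D: "D \<ge> 0"
    and nested: "\<And>m n. m \<ge> 1 \<Longrightarrow> n \<ge> 1 \<Longrightarrow> D_nested D (lo m) (hi m) (lo n) (hi n)"
  defines "Y n \<equiv> cylinder S (lo n) (hi n) (s n)"
  obtains C r where "0 < r" "r < 1" "C \<ge> 0"
    "\<And>m n. m \<ge> 1 \<Longrightarrow> n \<ge> 1 \<Longrightarrow> R_mn \<mu> Y m n \<le> C * r ^ ((m - n) + (n - m)) * (prob (Y m) + prob (Y n))"
proof -
  obtain C r where r: "0 < r" "r < 1" and C: "C \<ge> 0"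
    and right: "\<And>u w l l' k. l' \<ge> l + int k \<Longrightarrow> prob (cyl l u \<inter> cyl l' w) - m u * m w \<le> C * r ^ k * m w"
    and left: "\<And>u w l l' k. l' + int (length w) + int k \<le> l + int (length u) \<Longrightarrow>
       prob (cyl l u \<inter> cyl l' w) - m u * m w \<le> C * r ^ k * m w"
    by (rule shifted_nested_correlation, rule that)
  define d where "d = nat D"
  \<comment> \<open>Division by r^d covers two cases: for |i - n| \<le> d the trivial bound by the
    inner cylinder, and otherwise the loss of the d symbols by which nesting may fail.\<close>
  define C' where "C' = (1 + C) / r ^ d"
  have C': "C' \<ge> 0" using C r by (simp add: C'_def)
  let ?w = "\<lambda>n. word_of (lo n) (hi n) (s n)"
  have len: "int (length (?w n)) = hi n - lo n + 1" if "n \<ge> 1" for n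
    using lohi[OF that] by (simp add: word_of_def)
  have Y: "prob (Y n) = m (?w n)" for n by (simp add: Y_def cylinder_eq_cyl prob_cyl)
  have R: "R_mn \<mu> Y i n = prob (cyl (lo n + int n) (?w n) \<inter> cyl (lo i + int i) (?w i)) - m (?w n) * m (?w i)" for i n
    by (simp add: R_mn_def Y) (simp add: Y_def cylinder_eq_cyl preim_cyl Int_commute)
  have one: "R_mn \<mu> Y i n \<le> C' * r ^ ((i - n) + (n - i)) * prob (Y i)"
    if i: "i \<ge> 1" and n: "n \<ge> 1" and sub: "{lo i..hi i} \<subseteq> {lo n - D..hi n + D}" for i n
  proof -
    have b: "lo n - D \<le> lo i" "hi i \<le> hi n + D" using sub lohi[OF i] by auto
    define k where "k = (i - n) + (n - i)"
    have rd: "0 < r ^ d" using r by simp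
    show ?thesis
    proof (cases "k \<le> d")
      case True
      have "prob (cyl (lo n + int n) (?w n) \<inter> cyl (lo i + int i) (?w i)) \<le> prob (cyl (lo i + int i) (?w i))"
        by (intro finite_measure_mono) auto
      moreover have "0 \<le> m (?w n) * m (?w i)" using m_nonneg by simp
      ultimately have "R_mn \<mu> Y i n \<le> 1 * prob (Y i)" unfolding R by (simp add: prob_cyl Y)
      also have "\<dots> \<le> C' * r ^ k * prob (Y i)"
      proof (rule mult_right_mono)
        have "r ^ d \<le> r ^ k" using True r by (intro power_decreasing) auto
        also have "\<dots> \<le> (1 + C) * r ^ k" using C r by (simp add: mult_right_mono)
        finally show "1 \<le> C' * r ^ k" using rd by (simp add: C'_def field_simps)
      qed simp
      finally show ?thesis by (simp add: k_def)
    next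
      case False
      have "R_mn \<mu> Y i n \<le> C * r ^ (k - d) * m (?w i)"
      \<comment> \<open>For n \<le> i the preimages move the inner interval to the right relative to
        the outer one, so the outer word starts at least k - d symbols earlier; otherwise it ends at
        least k - d symbols later.\<close>
      proof (cases "n \<le> i")
        case True
        then show ?thesis unfolding R using False b D by (intro right) (simp add: k_def d_def of_nat_diff)
      next
        case False2: False
        then show ?thesis unfolding R using False b D len[OF i] len[OF n]
          by (intro left) (simp add: k_def d_def of_nat_diff)
      qed
      also have "\<dots> = C / r ^ d * r ^ k * prob (Y i)"
      proof -
        have "r ^ k = r ^ (k - d) * r ^ d" using False by (simp flip: power_add)
        then show ?thesis using r(1) by (simp add: Y)
      qed
      also have "\<dots> \<le> C' * r ^ k * prob (Y i)"
        unfolding C'_def using r by (intro mult_right_mono divide_right_mono) auto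
      finally show ?thesis by (simp add: k_def)
    qed
  qed
  show ?thesis
  proof (rule that[OF r C'])
    fix i n :: nat assume i: "i \<ge> 1" "n \<ge> 1"
    have nn: "0 \<le> C' * r ^ ((i - n) + (n - i)) * prob (Y k)" for k using C' r by simp
    from nested[OF i] consider "{lo i..hi i} \<subseteq> {lo n - D..hi n + D}" | "{lo n..hi n} \<subseteq> {lo i - D..hi i + D}"
      unfolding D_nested_def by blast
    then show "R_mn \<mu> Y i n \<le> C' * r ^ ((i - n) + (n - i)) * (prob (Y i) + prob (Y n))"
    proof cases
      case 1
      then show ?thesis using one[OF i] nn[of n] by (simp add: distrib_left)
    next
      case 2
      have "R_mn \<mu> Y i n = R_mn \<mu> Y n i" by (simp add: R_mn_def Int_commute mult.commute)
      then show ?thesis using one[OF i(2,1)] 2 nn[of i] by (simp add: distrib_left add.commute[of "i - n"])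
    qed
  qed
qed

lemma preim_cylinder_events: "preim n (cylinder S l h t) \<in> events"
  by (simp add: cylinder_eq_cyl preim_cyl)

lemma prob_preim_cylinder: "prob (preim n (cylinder S l h t)) = prob (cylinder S l h t)"
  by (simp add: cylinder_eq_cyl preim_cyl prob_cyl)

text \<open>Expanding the square gives covariances, diagonal included, so the double sum in (SP) is
  exactly the variance of the count. This makes (SP) the variance hypothesis of
  \<open>quantitative_borel_cantelli\<close>.\<close>

lemma second_moment_eq_sum_R:
  assumes J: "finite J" and Y: "\<And>n. preim n (Y n) \<in> events" "\<And>n. prob (preim n (Y n)) = prob (Y n)"
  shows "expectation (\<lambda>\<omega>. (\<Sum>k\<in>J. indicator (preim k (Y k)) \<omega> - prob (Y k))\<^sup>2)
    = (\<Sum>j\<in>J. \<Sum>k\<in>J. R_mn \<mu> Y j k)"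
proof -
  let ?A = "\<lambda>k. preim k (Y k)" and ?p = "\<lambda>k. prob (Y k)"
  have eq: "(\<Sum>k\<in>J. indicator (?A k) \<omega> - ?p k)\<^sup>2 =
      (\<Sum>j\<in>J. \<Sum>k\<in>J. indicator (?A j \<inter> ?A k) \<omega> - ?p k * indicator (?A j) \<omega>
         - ?p j * indicator (?A k) \<omega> + ?p j * ?p k)" for \<omega>
    unfolding power2_eq_square sum_product
    by (intro sum.cong refl) (simp add: indicator_inter_arith algebra_simps)
  have int: "integrable \<mu> (indicator (?A k) :: _ \<Rightarrow> real)" "integrable \<mu> (indicator (?A j \<inter> ?A k) :: _ \<Rightarrow> real)" for j k
    using Y(1) by (auto intro!: integrable_real_indicator simp: less_top[symmetric] emeasure_eq_measure)
  have "expectation (\<lambda>\<omega>. (\<Sum>k\<in>J. indicator (?A k) \<omega> - ?p k)\<^sup>2) =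
      (\<Sum>j\<in>J. \<Sum>k\<in>J. expectation (\<lambda>\<omega>. indicator (?A j \<inter> ?A k) \<omega> - ?p k * indicator (?A j) \<omega>
         - ?p j * indicator (?A k) \<omega> + ?p j * ?p k))"
    unfolding eq using int by (subst Bochner_Integration.integral_sum, simp)+ simp
  also have "\<dots> = (\<Sum>j\<in>J. \<Sum>k\<in>J. R_mn \<mu> Y j k)"
  proof (intro sum.cong refl)
    fix j k
    have "expectation (\<lambda>\<omega>. indicator (?A j \<inter> ?A k) \<omega> - ?p k * indicator (?A j) \<omega>
         - ?p j * indicator (?A k) \<omega> + ?p j * ?p k)
       = prob (?A j \<inter> ?A k) - ?p k * prob (?A j) - ?p j * prob (?A k) + ?p j * ?p k"
      using int Y(1) prob_space by simp
    then show "expectation (\<lambda>\<omega>. indicator (?A j \<inter> ?A k) \<omega> - ?p k * indicator (?A j) \<omega>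
         - ?p j * indicator (?A k) \<omega> + ?p j * ?p k) = R_mn \<mu> Y j k"
      by (simp add: R_mn_def Y(2) mult.commute)
  qed
  finally show ?thesis .
qed

text \<open>Arbitrary finite index sets allow one bound to serve both the intervals of (SP) and the
  half-open ones of the variance hypothesis. The weights are geometric in |m - n|, so every measure
  is counted with bounded total weight.\<close>

lemma sum_correlations_le:
  fixes lo hi :: "nat \<Rightarrow> int" and s :: "nat \<Rightarrow> int \<Rightarrow> nat" and D :: int
  assumes "\<And>n. n \<ge> 1 \<Longrightarrow> lo n \<le> hi n" "D \<ge> 0"
    and "\<And>m n. m \<ge> 1 \<Longrightarrow> n \<ge> 1 \<Longrightarrow> D_nested D (lo m) (hi m) (lo n) (hi n)"
  defines "Y n \<equiv> cylinder S (lo n) (hi n) (s n)"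
  obtains C where "C > 0" "\<And>J. finite J \<Longrightarrow> J \<subseteq> {1..} \<Longrightarrow>
    (\<Sum>m\<in>J. \<Sum>n\<in>J. R_mn \<mu> Y m n) \<le> C * (\<Sum>n\<in>J. prob (Y n))"
proof -
  obtain C r where r: "0 < r" "r < 1" and C: "C \<ge> 0"
    and R: "\<And>m n. m \<ge> 1 \<Longrightarrow> n \<ge> 1 \<Longrightarrow> R_mn \<mu> Y m n \<le> C * r ^ ((m - n) + (n - m)) * (prob (Y m) + prob (Y n))"
    unfolding Y_def
  proof (rule nested_correlation[where lo = lo and hi = hi and D = D and s = s])
  qed (use assms(1-3) that in auto)
  let ?d = "\<lambda>m n :: nat. (m - n) + (n - m)"
  show ?thesis
  proof (rule that[of "C * (4 / (1 - r)) + 1"])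
    show "0 < C * (4 / (1 - r)) + 1" using C r by (intro add_nonneg_pos) auto
    fix J :: "nat set" assume J: "finite J" "J \<subseteq> {1..}"
    have half: "(\<Sum>m\<in>J. \<Sum>n\<in>J. r ^ ?d m n * prob (Y m)) \<le> (\<Sum>m\<in>J. 2 / (1 - r) * prob (Y m))"
      unfolding sum_distrib_right[symmetric]
      by (intro sum_mono mult_right_mono sum_power_distance_le r J) auto
    have "(\<Sum>m\<in>J. \<Sum>n\<in>J. r ^ ?d m n * prob (Y n)) = (\<Sum>n\<in>J. \<Sum>m\<in>J. r ^ ?d n m * prob (Y n))"
      by (subst sum.swap) (simp add: add.commute)
    then have half': "(\<Sum>m\<in>J. \<Sum>n\<in>J. r ^ ?d m n * prob (Y n)) \<le> (\<Sum>m\<in>J. 2 / (1 - r) * prob (Y m))"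
      using half by simp
    have "(\<Sum>m\<in>J. \<Sum>n\<in>J. R_mn \<mu> Y m n) \<le> (\<Sum>m\<in>J. \<Sum>n\<in>J. C * r ^ ?d m n * (prob (Y m) + prob (Y n)))"
      using J(2) by (intro sum_mono R) auto
    also have "\<dots> = C * ((\<Sum>m\<in>J. \<Sum>n\<in>J. r ^ ?d m n * prob (Y m)) + (\<Sum>m\<in>J. \<Sum>n\<in>J. r ^ ?d m n * prob (Y n)))"
      by (simp add: sum_distrib_left sum.distrib[symmetric] algebra_simps)
    also have "\<dots> \<le> C * ((\<Sum>m\<in>J. 2 / (1 - r) * prob (Y m)) + (\<Sum>m\<in>J. 2 / (1 - r) * prob (Y m)))"
      by (intro mult_left_mono add_mono half half' C)
    also have "\<dots> = C * (4 / (1 - r)) * (\<Sum>n\<in>J. prob (Y n))"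
    proof -
      have "4 / (1 - r) = 2 / (1 - r) + 2 / (1 - r)" by simp
      then show ?thesis unfolding sum_distrib_left[symmetric] by (simp only: ring_distribs mult.assoc)
    qed
    also have "\<dots> \<le> (C * (4 / (1 - r)) + 1) * (\<Sum>n\<in>J. prob (Y n))"
      by (intro mult_right_mono sum_nonneg) auto
    finally show "(\<Sum>m\<in>J. \<Sum>n\<in>J. R_mn \<mu> Y m n) \<le> (C * (4 / (1 - r)) + 1) * (\<Sum>n\<in>J. prob (Y n))" .
  qed
qed

end

section \<open>Strong Borel--Cantelli property\<close>

lemma dist_a_le_power:
  assumes a: "0 < a" "a < 1" and agree: "\<And>i. \<bar>i\<bar> < int n \<Longrightarrow> \<omega> i = \<omega>' i"
  shows "dist_a a \<omega> \<omega>' \<le> a ^ n"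
proof (cases "\<omega> = \<omega>'")
  case False
  let ?P = "\<lambda>k. \<exists>i. nat \<bar>i\<bar> = k \<and> \<omega> i \<noteq> \<omega>' i"
  obtain i where "\<omega> i \<noteq> \<omega>' i" using False by auto
  then have "?P (nat \<bar>i\<bar>)" by auto
  then have "?P (LEAST k. ?P k)" by (rule LeastI)
  then obtain j where j: "nat \<bar>j\<bar> = (LEAST k. ?P k)" "\<omega> j \<noteq> \<omega>' j" by blast
  have "\<not> \<bar>j\<bar> < int n" using agree j(2) by blast
  then have "n \<le> (LEAST k. ?P k)" unfolding j(1)[symmetric] by linarith
  then show ?thesis using False a by (simp add: dist_a_def power_decreasing)
qed (use a in \<open>simp add: dist_a_def\<close>)

lemma gibbs_chainI:
  assumes "M \<ge> 2" "zero_one_matrix M A" "primitive_matrix M A"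
    and a: "0 < a" "a < 1" and hol: "holder_on (tmc M A) a \<psi>" and gibbs: "gibbs_measure (tmc M A) \<psi> \<mu>"
  obtains Lc \<kappa> P c N where "gibbs_chain \<mu> M A \<psi> Lc \<kappa> P c N"
proof -
  let ?S = "tmc M A"
  obtain N where N: "N \<ge> 1" "\<And>i j. i \<in> {1..M} \<Longrightarrow> j \<in> {1..M} \<Longrightarrow> mat_pow M A N i j > 0"
    using assms(3) unfolding primitive_matrix_def by blast
  obtain L \<beta> where \<beta>: "0 < \<beta>" "\<beta> \<le> 1"
    and L: "\<And>\<omega> \<omega>'. \<omega> \<in> ?S \<Longrightarrow> \<omega>' \<in> ?S \<Longrightarrow> \<bar>\<psi> \<omega> - \<psi> \<omega>'\<bar> \<le> L * dist_a a \<omega> \<omega>' powr \<beta>"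
    using hol unfolding holder_on_def by blast
  \<comment> \<open>A Hoelder bound with exponent \<beta> for the metric with base \<open>a\<close>
    is a geometric bound with ratio a^\<beta> in the half-width of the window of agreement.\<close>
  define \<kappa> where "\<kappa> = a powr \<beta>"
  have \<kappa>: "0 < \<kappa>" "\<kappa> < 1" using a \<beta> powr_less_mono2[of \<beta> a 1] by (auto simp: \<kappa>_def)
  have H: "\<bar>\<psi> \<omega> - \<psi> \<omega>'\<bar> \<le> \<bar>L\<bar> * \<kappa> ^ n"
    if "\<omega> \<in> ?S" "\<omega>' \<in> ?S" "\<And>i. \<bar>i\<bar> < int n \<Longrightarrow> \<omega> i = \<omega>' i" for \<omega> \<omega>' n
  proof -
    have "dist_a a \<omega> \<omega>' powr \<beta> \<le> (a ^ n) powr \<beta>"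
      using dist_a_le_power[OF a that(3)] a \<beta> by (intro powr_mono2) (auto simp: dist_a_def)
    also have "\<dots> = \<kappa> ^ n"
      using a by (simp add: \<kappa>_def powr_powr mult.commute flip: powr_realpow)
    finally have "\<bar>L\<bar> * dist_a a \<omega> \<omega>' powr \<beta> \<le> \<bar>L\<bar> * \<kappa> ^ n" by (intro mult_left_mono) auto
    moreover have "L * dist_a a \<omega> \<omega>' powr \<beta> \<le> \<bar>L\<bar> * dist_a a \<omega> \<omega>' powr \<beta>"
      by (intro mult_right_mono) auto
    ultimately show ?thesis using L[OF that(1,2)] by linarith
  qed
  from gibbs have ps: "prob_space \<mu>" and sets: "sets \<mu> = sets seq_space" "?S \<in> sets \<mu>"
    and full: "measure \<mu> ?S = 1" and sh: "shift \<in> measurable \<mu> \<mu>" "distr \<mu> \<mu> shift = \<mu>"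
    unfolding gibbs_measure_def by blast+
  let ?e = "\<lambda>P \<omega> n. exp (- real n * P + (\<Sum>k<n. \<psi> ((shift ^^ k) \<omega>)))"
  let ?m = "\<lambda>\<omega> n. measure \<mu> (cylinder ?S 0 (int n - 1) \<omega>)"
  from gibbs obtain P c where c: "c > 0"
    and q: "\<And>\<omega> n. \<omega> \<in> ?S \<Longrightarrow> n \<ge> 1 \<Longrightarrow> inverse c \<le> ?m \<omega> n / ?e P \<omega> n \<and> ?m \<omega> n / ?e P \<omega> n \<le> c"
    unfolding gibbs_measure_def Let_def by blast
  have q': "?e P \<omega> n \<le> c * ?m \<omega> n \<and> ?m \<omega> n \<le> c * ?e P \<omega> n" if "\<omega> \<in> ?S" "n \<ge> 1" for \<omega> n
  proof -
    have bounds: "y \<le> c * x \<and> x \<le> c * y" if "inverse c \<le> x / y" "x / y \<le> c" "y > 0" for x y :: real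
      using that c by (simp add: field_simps)
    show ?thesis using q[OF that] by (intro bounds) auto
  qed
  have "?S \<noteq> {}" using full by auto
  then obtain \<omega> where "\<omega> \<in> ?S" by auto
  from q[OF this, of 1] have "inverse c \<le> c" by linarith
  then have "1 \<le> c * c" using c by (simp add: field_simps)
  then have c1: "c \<ge> 1" using c by (metis abs_1 abs_le_square_iff abs_of_pos one_power2 power2_eq_square)
  interpret prob_space \<mu> by (rule ps)
  have "gibbs_chain \<mu> M A \<psi> \<bar>L\<bar> \<kappa> P c N"
    by unfold_locales (fact assms N \<kappa> abs_ge_zero H sets full sh c1 | use N H q' in blast)+
  then show ?thesis by (rule that)
qed

theorem theorem2p1:
  fixes M :: nat and A :: "nat \<Rightarrow> nat \<Rightarrow> nat" and a :: real
    and \<psi> :: "(int \<Rightarrow> nat) \<Rightarrow> real" and \<mu> :: "(int \<Rightarrow> nat) measure"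
    and lo hi :: "nat \<Rightarrow> int" and s :: "nat \<Rightarrow> int \<Rightarrow> nat" and D :: int
  assumes "M \<ge> 2"
    and "zero_one_matrix M A" and "primitive_matrix M A"
    and "0 < a" and "a < 1" and "holder_on (tmc M A) a \<psi>"
    and "gibbs_measure (tmc M A) \<psi> \<mu>"
    and "\<forall>n\<ge>1. lo n \<le> hi n"
    and "D \<ge> 0"
    and "\<forall>m\<ge>1. \<forall>n\<ge>1. D_nested D (lo m) (hi m) (lo n) (hi n)"
  shows "condition_SP \<mu> (\<lambda>n. cylinder (tmc M A) (lo n) (hi n) (s n))
       \<and> (filterlim (E_N \<mu> (\<lambda>n. cylinder (tmc M A) (lo n) (hi n) (s n))) at_top sequentially \<longrightarrow>
            strongly_BC \<mu> (\<lambda>n. cylinder (tmc M A) (lo n) (hi n) (s n))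
          \<and> (\<forall>\<epsilon>>0. AE \<omega> in \<mu>.
               (\<lambda>N. S_N (\<lambda>n. cylinder (tmc M A) (lo n) (hi n) (s n)) N \<omega>
                    - E_N \<mu> (\<lambda>n. cylinder (tmc M A) (lo n) (hi n) (s n)) N)
               \<in> O(\<lambda>N. E_N \<mu> (\<lambda>n. cylinder (tmc M A) (lo n) (hi n) (s n)) N powr (1/2)
                    * ln (E_N \<mu> (\<lambda>n. cylinder (tmc M A) (lo n) (hi n) (s n)) N) powr (3/2 + \<epsilon>))))"
proof -
  obtain Lc \<kappa> P c N where "gibbs_chain \<mu> M A \<psi> Lc \<kappa> P c N"
    by (rule gibbs_chainI[OF assms(1-7)])
  then interpret gibbs_chain \<mu> M A \<psi> Lc \<kappa> P c N .
  define Y where "Y n = cylinder (tmc M A) (lo n) (hi n) (s n)" for n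
  obtain C where C: "C > 0" and SP: "\<And>J. finite J \<Longrightarrow> J \<subseteq> {1..} \<Longrightarrow>
      (\<Sum>m\<in>J. \<Sum>n\<in>J. R_mn \<mu> Y m n) \<le> C * (\<Sum>n\<in>J. prob (Y n))"
    unfolding Y_def
    by (rule sum_correlations_le[where lo = lo and hi = hi and s = s and D = D])
      (use assms(8-10) that in \<open>auto simp: Y_def\<close>)
  have condSP: "condition_SP \<mu> Y"
    unfolding condition_SP_def using C by (intro exI[of _ C] conjI allI impI SP) auto
  have ev: "preim n (Y n) \<in> events" "prob (preim n (Y n)) = prob (Y n)" for n
    by (simp_all add: Y_def preim_cylinder_events prob_preim_cylinder)
  have rate: "AE \<omega> in \<mu>. (\<lambda>N. S_N Y N \<omega> - E_N \<mu> Y N)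
      \<in> O(\<lambda>N. E_N \<mu> Y N powr (1/2) * ln (E_N \<mu> Y N) powr (3/2 + \<epsilon>))"
    if div: "filterlim (E_N \<mu> Y) at_top sequentially" and \<epsilon>: "\<epsilon> > 0" for \<epsilon>
    unfolding S_N_def E_N_def
  proof (rule quantitative_borel_cantelli)
    show "filterlim (\<lambda>N. \<Sum>k=1..N. prob (Y k)) at_top sequentially"
      using div unfolding E_N_def .
    show "expectation (\<lambda>\<omega>. (\<Sum>k\<in>{m<..n}. indicator (preim k (Y k)) \<omega> - prob (Y k))\<^sup>2)
        \<le> C * (\<Sum>k\<in>{m<..n}. prob (Y k))" for m n
      by (subst second_moment_eq_sum_R[OF _ ev]) (auto intro!: SP)
  qed (use ev C \<epsilon> in auto)
  \<comment> \<open>With \<epsilon> = 1/2 the logarithm has exponent 2, and any error of order E_N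
    to a power below 1 makes the quotient converge.\<close>
  have BC: "strongly_BC \<mu> Y" if div: "filterlim (E_N \<mu> Y) at_top sequentially"
    unfolding strongly_BC_def using rate[OF div half_gt_zero[OF zero_less_one]]
  proof eventually_elim
    case (elim \<omega>)
    then have "(\<lambda>N. S_N Y N \<omega> - E_N \<mu> Y N) \<in> O(\<lambda>N. E_N \<mu> Y N powr (1/2) * ln (E_N \<mu> Y N) powr 2)"
      by simp
    then obtain K where K: "K > 0" and big: "\<forall>\<^sub>F N in sequentially.
        norm (S_N Y N \<omega> - E_N \<mu> Y N) \<le> K * norm (E_N \<mu> Y N powr (1/2) * ln (E_N \<mu> Y N) powr 2)"
      by (auto elim: landau_o.bigE)
    have "\<forall>\<^sub>F N in sequentially. E_N \<mu> Y N \<ge> 1"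
      using div by (simp add: filterlim_at_top)
    with big have "\<forall>\<^sub>F N in sequentially. norm (S_N Y N \<omega> / E_N \<mu> Y N - 1) \<le> 64 * K * E_N \<mu> Y N powr (- (1/4))"
    proof eventually_elim
      case (elim N)
      let ?x = "E_N \<mu> Y N"
      have x: "?x \<ge> 1" using elim by simp
      \<comment> \<open>The exponent 1/8 gives (ln x)^2 \<le> 64 x^(1/4), so the error is O(x^(3/4))
        and the relative error O(x^(-1/4)).\<close>
      have "ln ?x \<le> ?x powr (1/8) / (1/8)" by (rule ln_powr_bound) (use x in auto)
      then have "ln ?x powr 2 \<le> (8 * ?x powr (1/8)) powr 2" using x by (intro powr_mono2) auto
      also have "\<dots> = 64 * ?x powr (1/4)" using x by (simp add: powr_mult powr_powr)
      finally have "?x powr (1/2) * ln ?x powr 2 \<le> ?x powr (1/2) * (64 * ?x powr (1/4))"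
        by (intro mult_left_mono) auto
      also have "\<dots> = 64 * ?x powr (3/4)" by (simp flip: powr_add)
      finally have "K * (?x powr (1/2) * ln ?x powr 2) \<le> K * (64 * ?x powr (3/4))"
        using K by (intro mult_left_mono) auto
      then have "\<bar>S_N Y N \<omega> - ?x\<bar> \<le> 64 * K * ?x powr (3/4)" using elim by simp
      then have "\<bar>S_N Y N \<omega> - ?x\<bar> / ?x \<le> 64 * K * ?x powr (3/4) / ?x powr 1"
        using x by (simp add: divide_right_mono)
      also have "\<dots> = 64 * K * ?x powr (- (1/4))"
        using powr_diff[of ?x "3/4" 1] x by simp
      finally have "\<bar>S_N Y N \<omega> - ?x\<bar> / ?x \<le> 64 * K * ?x powr (- (1/4))" .
      moreover have "norm (S_N Y N \<omega> / ?x - 1) = \<bar>S_N Y N \<omega> - ?x\<bar> / ?x"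
        using x by (simp add: diff_divide_distrib[symmetric] field_simps)
      ultimately show ?case by simp
    qed
    moreover have "(\<lambda>N. 64 * K * E_N \<mu> Y N powr (- (1/4))) \<longlonglongrightarrow> 0"
      by (intro tendsto_mult_right_zero tendsto_neg_powr div) auto
    ultimately have "(\<lambda>N. S_N Y N \<omega> / E_N \<mu> Y N - 1) \<longlonglongrightarrow> 0"
      by (rule Lim_null_comparison)
    then show ?case by (simp add: LIM_zero_iff)
  qed
  show ?thesis
    unfolding Y_def[symmetric, abs_def] using condSP rate BC by blast
qed

end
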